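(* Let $\mathbf{A}$ be a finite algebra, let $\alpha\prec\beta$ in $\mathrm{Con}(\mathbf{A})$, and suppose $U$ is an $\langle\alpha,\beta\rangle$-minimal set of type $\mathbf{i}$ (i.e., $\mathrm{typ}(\alpha,\beta)=\mathbf{i}$) which has nonempty tail. Then there is a subalgebra $\mathbf{S}\le\mathbf{A}^2$ whose congruence lattice contains a pentagon of type $\mathbf{i}$.
   Context: Tame congruence theory (Hobby–McKenzie). For a finite algebra $\mathbf{A}$ and covering $\alpha\prec\beta$ in $\mathrm{Con}(\mathbf{A})$, an $\langle\alpha,\beta\rangle$-minimal set is a set $U\subseteq A$ minimal under inclusion among sets $e(A)$, $e$ an idempotent unary polynomial of $\mathbf{A}$, with $\alpha|_U\neq\beta|_U$. A trace of $U$ is a $\beta|_U$-class that is not an $\alpha|_U$-class; the body is the union of the traces and the tail is $U$ minus the body. Types are the tame congruence theory labels $\mathbf{1},\dots,\mathbf{5}$. A pentagon $[\gamma,\delta,\theta]$ in a lattice is the five-element sublattice generated by $\gamma,\delta,\theta$ with $\delta<\theta$, $\gamma\vee\delta\ge\theta$, $\gamma\wedge\theta\le\delta$; a pentagon of type $\mathbf{i}$ (in the congruence lattice of a finite algebra) is one whose critical quotient $\langle\delta,\theta\rangle$ is a covering $\delta\prec\theta$ of type $\mathbf{i}$. *)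

theory Defs
  imports Main "HOL-Algebra.Module"
begin

text \<open>An algebra is a carrier A together with a set F of basic operations;
  each operation is a pair (n, f) of an arity n and a function on lists
  (only its values on lists of length n over A matter).\<close>

type_synonym 'a ops = "(nat \<times> ('a list \<Rightarrow> 'a)) set"

definition tuples :: "'a set \<Rightarrow> nat \<Rightarrow> 'a list set" where
  "tuples A n = {xs. length xs = n \<and> set xs \<subseteq> A}"

definition is_algebra :: "'a set \<Rightarrow> 'a ops \<Rightarrow> bool" where
  "is_algebra A F \<longleftrightarrow> A \<noteq> {} \<and> (\<forall>(n, f) \<in> F. \<forall>xs \<in> tuples A n. f xs \<in> A)"

definition finite_algebra :: "'a set \<Rightarrow> 'a ops \<Rightarrow> bool" where
  "finite_algebra A F \<longleftrightarrow> is_algebra A F \<and> finite A"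

inductive tct_pol :: "'a set \<Rightarrow> 'a ops \<Rightarrow> nat \<Rightarrow> ('a list \<Rightarrow> 'a) \<Rightarrow> bool"
  for A :: "'a set" and F :: "'a ops" where
  proj: "i < n \<Longrightarrow> tct_pol A F n (\<lambda>xs. xs ! i)"
| const: "c \<in> A \<Longrightarrow> tct_pol A F n (\<lambda>_. c)"
| comp: "(k, f) \<in> F \<Longrightarrow> length ps = k \<Longrightarrow> (\<forall>p \<in> set ps. tct_pol A F n p)
          \<Longrightarrow> tct_pol A F n (\<lambda>xs. f (map (\<lambda>p. p xs) ps))"

definition agree_on :: "'a set \<Rightarrow> nat \<Rightarrow> ('a list \<Rightarrow> 'b) \<Rightarrow> ('a list \<Rightarrow> 'b) \<Rightarrow> bool" where
  "agree_on A n p q \<longleftrightarrow> (\<forall>xs \<in> tuples A n. p xs = q xs)"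

definition poly_equiv :: "'a set \<Rightarrow> 'a ops \<Rightarrow> 'a ops \<Rightarrow> bool" where
  "poly_equiv M F G \<longleftrightarrow>
     (\<forall>n p. tct_pol M F n p \<longrightarrow> (\<exists>q. tct_pol M G n q \<and> agree_on M n p q)) \<and>
     (\<forall>n p. tct_pol M G n p \<longrightarrow> (\<exists>q. tct_pol M F n q \<and> agree_on M n p q))"

definition tct_con :: "'a set \<Rightarrow> 'a ops \<Rightarrow> ('a \<times> 'a) set \<Rightarrow> bool" where
  "tct_con A F \<theta> \<longleftrightarrow> equiv A \<theta> \<and>
     (\<forall>(n, f) \<in> F. \<forall>xs \<in> tuples A n. \<forall>ys \<in> tuples A n.
        list_all2 (\<lambda>x y. (x, y) \<in> \<theta>) xs ys \<longrightarrow> (f xs, f ys) \<in> \<theta>)"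

definition con_join :: "'a set \<Rightarrow> 'a ops \<Rightarrow> ('a \<times> 'a) set \<Rightarrow> ('a \<times> 'a) set \<Rightarrow> ('a \<times> 'a) set" where
  "con_join A F \<gamma> \<delta> = \<Inter>{\<phi>. tct_con A F \<phi> \<and> \<gamma> \<union> \<delta> \<subseteq> \<phi>}"

definition con_covers :: "'a set \<Rightarrow> 'a ops \<Rightarrow> ('a \<times> 'a) set \<Rightarrow> ('a \<times> 'a) set \<Rightarrow> bool" where
  "con_covers A F \<alpha> \<beta> \<longleftrightarrow> tct_con A F \<alpha> \<and> tct_con A F \<beta> \<and> \<alpha> \<subset> \<beta> \<and>
     \<not> (\<exists>\<phi>. tct_con A F \<phi> \<and> \<alpha> \<subset> \<phi> \<and> \<phi> \<subset> \<beta>)"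

definition restr :: "('a \<times> 'a) set \<Rightarrow> 'a set \<Rightarrow> ('a \<times> 'a) set" where
  "restr \<theta> U = \<theta> \<inter> (U \<times> U)"

definition idem_image :: "'a set \<Rightarrow> 'a ops \<Rightarrow> 'a set \<Rightarrow> bool" where
  "idem_image A F U \<longleftrightarrow> (\<exists>p. tct_pol A F 1 p \<and> (\<forall>x \<in> A. p [p [x]] = p [x]) \<and>
      U = (\<lambda>x. p [x]) ` A)"

definition minimal_set :: "'a set \<Rightarrow> 'a ops \<Rightarrow> ('a \<times> 'a) set \<Rightarrow> ('a \<times> 'a) set \<Rightarrow> 'a set \<Rightarrow> bool" where
  "minimal_set A F \<alpha> \<beta> U \<longleftrightarrow> idem_image A F U \<and> restr \<alpha> U \<noteq> restr \<beta> U \<and>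
     (\<forall>V. idem_image A F V \<and> restr \<alpha> V \<noteq> restr \<beta> V \<and> V \<subseteq> U \<longrightarrow> V = U)"

definition is_trace :: "('a \<times> 'a) set \<Rightarrow> ('a \<times> 'a) set \<Rightarrow> 'a set \<Rightarrow> 'a set \<Rightarrow> bool" where
  "is_trace \<alpha> \<beta> U N \<longleftrightarrow> (\<exists>x \<in> U. N = restr \<beta> U `` {x}) \<and>
     \<not> (\<exists>x \<in> U. N = restr \<alpha> U `` {x})"

definition body :: "('a \<times> 'a) set \<Rightarrow> ('a \<times> 'a) set \<Rightarrow> 'a set \<Rightarrow> 'a set" where
  "body \<alpha> \<beta> U = \<Union>{N. is_trace \<alpha> \<beta> U N}"

definition tail :: "('a \<times> 'a) set \<Rightarrow> ('a \<times> 'a) set \<Rightarrow> 'a set \<Rightarrow> 'a set" where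
  "tail \<alpha> \<beta> U = U - body \<alpha> \<beta> U"

definition tr_cls :: "('a \<times> 'a) set \<Rightarrow> 'a set \<Rightarrow> 'a \<Rightarrow> 'a set" where
  "tr_cls \<alpha> N x = restr \<alpha> N `` {x}"

definition min_carrier :: "('a \<times> 'a) set \<Rightarrow> 'a set \<Rightarrow> 'a set set" where
  "min_carrier \<alpha> N = tr_cls \<alpha> N ` N"

definition min_ops :: "'a set \<Rightarrow> 'a ops \<Rightarrow> ('a \<times> 'a) set \<Rightarrow> 'a set \<Rightarrow> 'a set ops" where
  "min_ops A F \<alpha> N = {(n, g). \<exists>p. tct_pol A F n p \<and> (\<forall>xs \<in> tuples N n. p xs \<in> N) \<and>
      (\<forall>xs \<in> tuples N n. g (map (tr_cls \<alpha> N) xs) = tr_cls \<alpha> N (p xs))}"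

definition meet2 :: "'b \<Rightarrow> 'b \<Rightarrow> 'b list \<Rightarrow> 'b" where
  "meet2 a b xs = (if xs ! 0 = b \<and> xs ! 1 = b then b else a)"
definition join2 :: "'b \<Rightarrow> 'b \<Rightarrow> 'b list \<Rightarrow> 'b" where
  "join2 a b xs = (if xs ! 0 = a \<and> xs ! 1 = a then a else b)"
definition compl2 :: "'b \<Rightarrow> 'b \<Rightarrow> 'b list \<Rightarrow> 'b" where
  "compl2 a b xs = (if xs ! 0 = a then b else a)"

definition vs_ops :: "('s, 'm) ring_scheme \<Rightarrow> ('s, 'b) module \<Rightarrow> 'b ops" where
  "vs_ops R V = {(2, \<lambda>xs. xs ! 0 \<oplus>\<^bsub>V\<^esub> xs ! 1), (1, \<lambda>xs. \<ominus>\<^bsub>V\<^esub> (xs ! 0)),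
                 (0, \<lambda>_. \<zero>\<^bsub>V\<^esub>)} \<union> {(1, \<lambda>xs. r \<odot>\<^bsub>V\<^esub> (xs ! 0)) | r. r \<in> carrier R}"

text \<open>Type (1..5) of a minimal algebra (M, G), following Hobby--McKenzie:
  1 = polynomially equivalent to a G-set (essentially unary),
  2 = polynomially equivalent to a vector space over a finite field,
  3 = polynomially equivalent to the 2-element Boolean algebra,
  4 = polynomially equivalent to the 2-element lattice,
  5 = polynomially equivalent to the 2-element semilattice.\<close>
definition minalg_type :: "'b set \<Rightarrow> 'b ops \<Rightarrow> nat \<Rightarrow> bool" where
  "minalg_type M G i \<longleftrightarrow>
     (i = 1 \<and> (\<exists>H. (\<forall>(n, h) \<in> H. n = 1 \<and> bij_betw (\<lambda>x. h [x]) M M) \<and> poly_equiv M G H)) \<or>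
     (i = 2 \<and> (\<exists>(R :: ('b \<Rightarrow> 'b) ring) (V :: ('b \<Rightarrow> 'b, 'b) module).
         field R \<and> finite (carrier R) \<and> module R V \<and> carrier V = M \<and>
         poly_equiv M G (vs_ops R V))) \<or>
     (i = 3 \<and> (\<exists>a b. a \<noteq> b \<and> M = {a, b} \<and>
         poly_equiv M G {(2, meet2 a b), (2, join2 a b), (1, compl2 a b)})) \<or>
     (i = 4 \<and> (\<exists>a b. a \<noteq> b \<and> M = {a, b} \<and>
         poly_equiv M G {(2, meet2 a b), (2, join2 a b)})) \<or>
     (i = 5 \<and> (\<exists>a b. a \<noteq> b \<and> M = {a, b} \<and> poly_equiv M G {(2, meet2 a b)}))"

text \<open>typ(alpha, beta) = i: the minimal algebra (A|N)/(alpha|N) on a trace N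
  of an (alpha,beta)-minimal set has type i (this is independent of the
  choice of U and N by tame congruence theory).\<close>
definition tct_type :: "'a set \<Rightarrow> 'a ops \<Rightarrow> ('a \<times> 'a) set \<Rightarrow> ('a \<times> 'a) set \<Rightarrow> nat \<Rightarrow> bool" where
  "tct_type A F \<alpha> \<beta> i \<longleftrightarrow> con_covers A F \<alpha> \<beta> \<and>
     (\<exists>U N. minimal_set A F \<alpha> \<beta> U \<and> is_trace \<alpha> \<beta> U N \<and>
        minalg_type (min_carrier \<alpha> N) (min_ops A F \<alpha> N) i)"

definition sq_ops :: "'a ops \<Rightarrow> ('a \<times> 'a) ops" where
  "sq_ops F = {(n, \<lambda>ps. (f (map fst ps), f (map snd ps))) | n f. (n, f) \<in> F}"

definition subalg_sq :: "'a set \<Rightarrow> 'a ops \<Rightarrow> ('a \<times> 'a) set \<Rightarrow> bool" where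
  "subalg_sq A F S \<longleftrightarrow> S \<noteq> {} \<and> S \<subseteq> A \<times> A \<and>
     (\<forall>(n, g) \<in> sq_ops F. \<forall>ps \<in> tuples S n. g ps \<in> S)"

definition pentagon_of_type :: "'b set \<Rightarrow> 'b ops \<Rightarrow> ('b \<times> 'b) set \<Rightarrow> ('b \<times> 'b) set \<Rightarrow> ('b \<times> 'b) set \<Rightarrow> nat \<Rightarrow> bool" where
  "pentagon_of_type B G \<gamma> \<delta> \<theta> i \<longleftrightarrow> tct_con B G \<gamma> \<and> tct_con B G \<delta> \<and> tct_con B G \<theta> \<and>
     \<delta> \<subset> \<theta> \<and> \<theta> \<subseteq> con_join B G \<gamma> \<delta> \<and> \<gamma> \<inter> \<theta> \<subseteq> \<delta> \<and>
     con_covers B G \<delta> \<theta> \<and> tct_type B G \<delta> \<theta> i"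

end

theory Submission
  imports Defs "HOL-Algebra.Weak_Morphisms"
begin

text \<open>Choose a minimal set \<open>U\<close> with a trace \<open>N\<close> witnessing the type, a pair \<open>(a, b)\<close> in \<open>N\<close> that
  is not in \<open>\<alpha>\<close>, and \<open>t\<close> in the tail of \<open>U\<close>. Let \<open>S\<close> be the subalgebra of the square generated by the
  diagonal, \<open>(a, t)\<close> and \<open>(b, t)\<close>. Let \<open>\<delta>\<close> be the largest congruence below \<open>\<beta> \<times> \<beta>\<close> which on the
  \<open>\<beta> \<times> \<beta>\<close>-saturated set \<open>S \<inter> \<beta>\<close> lies below \<open>\<alpha>\<close> in the first coordinate, \<open>\<theta>\<close> its cover
  generated by \<open>((a, a), (b, b))\<close>, and \<open>\<gamma>\<close> the kernel of the first projection. The first projection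
  identifies a trace of a \<open>\<langle>\<delta>, \<theta>\<rangle>\<close>-minimal set, modulo \<open>\<delta>\<close>, with \<open>N\<close> modulo \<open>\<alpha>\<close>, so
  the type is preserved. The triple is a pentagon as soon as \<open>((a, t), (b, t)) \<in> \<delta>\<close>. Otherwise there is a
  ternary polynomial \<open>f\<close> with \<open>f(x, a, b) = x\<close> on \<open>U\<close> and \<open>f(t, t, t) \<in> N\<close>. In each of the five types
  it yields a unary polynomial that does not collapse the trace but maps \<open>t\<close> into \<open>N\<close>; such a polynomial
  permutes \<open>U\<close> and hence preserves the tail, a contradiction.\<close>

section \<open>Polynomials and congruences\<close>

text \<open>Since t lies in no trace, (a, t) and (b, t) lie outside \<beta>. There \<delta> is not
  bounded by \<alpha>, so it may join these two pairs although (a, b) \<notin> \<alpha>; a pair of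
  this kind is what puts \<theta> below the join of \<gamma> and \<delta>. The condition on the meet
  comes for free, because \<delta> contains all pairs with \<alpha>-related first and
  \<beta>-related second coordinates. Origin of f: a unary polynomial of S is a ternary polynomial
  of A whose last two arguments are (a, b) in the first coordinate and (t, t) in the second. If it
  moves (a, t) into \<beta> and separates the first coordinates, then, after composition with a map
  onto U, the map sending x to f(x, a, b) permutes U; its inverse normalises it to the identity, and
  f(t, t, t) falls into N. The first unary candidate is f(x, x, x). It must collapse a and b, which
  together with f(x, a, b) = x already refutes types 1, 4 and 5. Types 2 and 3 need polynomials for
  the last two arguments that are constant on N and return t at t, both modulo \<alpha>.\<close>

lemma tuples_1: "xs \<in> tuples A (Suc 0) \<longleftrightarrow> (\<exists>x\<in>A. xs = [x])"
  by (auto simp: tuples_def length_Suc_conv)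

lemma tuples_2: "xs \<in> tuples A 2 \<longleftrightarrow> (\<exists>x\<in>A. \<exists>y\<in>A. xs = [x, y])"
  by (auto simp: tuples_def length_Suc_conv numeral_2_eq_2)

lemma ball_tuples_1: "(\<forall>xs\<in>tuples A (Suc 0). Q xs) \<longleftrightarrow> (\<forall>x\<in>A. Q [x])"
  by (fastforce simp: tuples_1)

lemma ball_tuples_2: "(\<forall>xs\<in>tuples A 2. Q xs) \<longleftrightarrow> (\<forall>x\<in>A. \<forall>y\<in>A. Q [x, y])"
  by (fastforce simp: tuples_2)

lemma tuples_3: "xs \<in> tuples A 3 \<longleftrightarrow> (\<exists>x\<in>A. \<exists>y\<in>A. \<exists>z\<in>A. xs = [x, y, z])"
  by (auto simp: tuples_def length_Suc_conv numeral_3_eq_3)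

lemma tuples_map: "xs \<in> tuples A n \<Longrightarrow> f ` A \<subseteq> B \<Longrightarrow> map f xs \<in> tuples B n"
  by (auto simp: tuples_def)

lemma tct_pol_closed:
  assumes "is_algebra A F" "tct_pol A F n p" "xs \<in> tuples A n"
  shows "p xs \<in> A"
  using assms(2,3)
proof induction
  case (proj i n) then show ?case by (auto simp: tuples_def)
next
  case (const c n) then show ?case by simp
next
  case (comp k f ps n)
  then have "map (\<lambda>p. p xs) ps \<in> tuples A k" by (auto simp: tuples_def)
  then show ?case using assms(1) comp by (fastforce simp: is_algebra_def)
qed

lemma tct_pol_cong:
  assumes "is_algebra A F" "tct_con A F \<theta>" "tct_pol A F n p"
    and "xs \<in> tuples A n" "ys \<in> tuples A n" "list_all2 (\<lambda>x y. (x, y) \<in> \<theta>) xs ys"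
  shows "(p xs, p ys) \<in> \<theta>"
  using assms(3-5)
proof induction
  case (proj i n) then show ?case using assms(6) by (auto simp: tuples_def list_all2_conv_all_nth)
next
  case (const c n) then show ?case using assms(2)
    by (auto simp: tct_con_def equiv_def refl_on_def)
next
  case (comp k f ps n)
  have "map (\<lambda>p. p xs) ps \<in> tuples A k" "map (\<lambda>p. p ys) ps \<in> tuples A k"
    using comp tct_pol_closed[OF assms(1)] by (auto simp: tuples_def)
  moreover have "list_all2 (\<lambda>x y. (x, y) \<in> \<theta>) (map (\<lambda>p. p xs) ps) (map (\<lambda>p. p ys) ps)"
    using comp by (auto simp: list_all2_conv_all_nth)
  ultimately show ?case using assms(2) comp(1) by (fastforce simp: tct_con_def)
qed

lemma tct_pol_comp:
  assumes "tct_pol A F k p" "length qs = k" "\<forall>q\<in>set qs. tct_pol A F n q"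
  shows "tct_pol A F n (\<lambda>xs. p (map (\<lambda>q. q xs) qs))"
  using assms(1,2)
proof induction
  case (proj i k)
  then have "(\<lambda>xs. map (\<lambda>q. q xs) qs ! i) = qs ! i" by auto
  then show ?case using proj assms(3) by auto
next
  case (const c k) then show ?case by (auto intro: tct_pol.const)
next
  case (comp l f ps k)
  have "tct_pol A F n (\<lambda>xs. f (map (\<lambda>p. p xs) (map (\<lambda>p xs. p (map (\<lambda>q. q xs) qs)) ps)))"
    using comp by (intro tct_pol.comp) auto
  then show ?case by (simp add: comp_def)
qed

text \<open>Agreement with a unary polynomial is asked on \<open>A\<close> only, so that iterates
  and composites of ordinary functions qualify without one-element lists.\<close>

definition upol :: "'a set \<Rightarrow> 'a ops \<Rightarrow> ('a \<Rightarrow> 'a) \<Rightarrow> bool" where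
  "upol A F f \<longleftrightarrow> (\<exists>p. tct_pol A F 1 p \<and> (\<forall>x\<in>A. f x = p [x]))"

lemma upol_subst:
  assumes "tct_pol A F (length gs) p" "\<forall>g\<in>set gs. upol A F g"
  shows "upol A F (\<lambda>x. p (map (\<lambda>g. g x) gs))"
proof -
  have "\<forall>g\<in>set gs. \<exists>q. tct_pol A F 1 q \<and> (\<forall>x\<in>A. g x = q [x])"
    using assms(2) by (simp add: upol_def)
  then obtain Q where Q: "\<forall>g\<in>set gs. tct_pol A F 1 (Q g) \<and> (\<forall>x\<in>A. g x = Q g [x])"
    by metis
  have "tct_pol A F 1 (\<lambda>xs. p (map (\<lambda>q. q xs) (map Q gs)))"
    using Q assms(1) by (intro tct_pol_comp) auto
  moreover have "\<forall>x\<in>A. p (map (\<lambda>g. g x) gs) = p (map (\<lambda>q. q [x]) (map Q gs))"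
    using Q by (auto intro!: arg_cong[where f=p])
  ultimately show ?thesis unfolding upol_def by blast
qed

lemma upol_id: "upol A F (\<lambda>x. x)"
  unfolding upol_def by (rule exI[of _ "\<lambda>xs. xs ! 0"]) (auto intro: tct_pol.proj)

lemma upol_const: "c \<in> A \<Longrightarrow> upol A F (\<lambda>_. c)"
  unfolding upol_def by (rule exI[of _ "\<lambda>_. c"]) (auto intro: tct_pol.const)

lemma upol_cong: "upol A F f \<Longrightarrow> (\<And>x. x \<in> A \<Longrightarrow> f x = g x) \<Longrightarrow> upol A F g"
  unfolding upol_def by metis

lemma upol_closed: "is_algebra A F \<Longrightarrow> upol A F f \<Longrightarrow> x \<in> A \<Longrightarrow> f x \<in> A"
  unfolding upol_def using tct_pol_closed[of A F 1 _ "[x]"] by (auto simp: tuples_1)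

lemma upol_comp:
  assumes "is_algebra A F" "upol A F f" "upol A F g"
  shows "upol A F (\<lambda>x. f (g x))"
proof -
  obtain p where p: "tct_pol A F 1 p" "\<forall>x\<in>A. f x = p [x]" using assms(2) by (auto simp: upol_def)
  have "upol A F (\<lambda>x. p (map (\<lambda>g. g x) [g]))" using p assms(3) by (intro upol_subst) auto
  then show ?thesis by (rule upol_cong) (use p upol_closed[OF assms(1,3)] in auto)
qed

lemma upol_funpow: "is_algebra A F \<Longrightarrow> upol A F f \<Longrightarrow> upol A F (f ^^ k)"
proof (induction k)
  case 0 then show ?case using upol_id[of A F] by (simp add: id_def)
next
  case (Suc k) then show ?case using upol_comp[of A F f "f ^^ k"] by (simp add: comp_def)
qed

lemma upol_con:
  assumes "is_algebra A F" "tct_con A F \<theta>" "upol A F f" "(x, y) \<in> \<theta>"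
  shows "(f x, f y) \<in> \<theta>"
proof -
  have "x \<in> A" "y \<in> A" using assms(2,4) by (auto simp: tct_con_def equiv_def refl_on_def)
  moreover obtain p where p: "tct_pol A F 1 p" "\<forall>x\<in>A. f x = p [x]"
    using assms(3) by (auto simp: upol_def)
  ultimately show ?thesis using tct_pol_cong[OF assms(1,2) p(1), of "[x]" "[y]"] assms(4)
    by (auto simp: tuples_1)
qed

text \<open>Change the arguments of a basic operation one coordinate at a time.\<close>

lemma tct_con_upolI:
  assumes alg: "is_algebra A F" and eq: "equiv A \<theta>"
    and up: "\<And>f x y. upol A F f \<Longrightarrow> (x, y) \<in> \<theta> \<Longrightarrow> (f x, f y) \<in> \<theta>"
  shows "tct_con A F \<theta>"
proof -
  have "(f xs, f ys) \<in> \<theta>"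
    if f: "(n, f) \<in> F" and xs: "xs \<in> tuples A n" and ys: "ys \<in> tuples A n"
      and rel: "list_all2 (\<lambda>x y. (x, y) \<in> \<theta>) xs ys" for n f xs ys
  proof -
    have len: "length xs = n" "length ys = n" using xs ys by (auto simp: tuples_def)
    have "(f xs, f (take k ys @ drop k xs)) \<in> \<theta>" if "k \<le> n" for k
      using that
    proof (induction k)
      case 0
      have "f xs \<in> A" using alg f xs by (fastforce simp: is_algebra_def)
      then show ?case using eq by (auto simp: equiv_def refl_on_def)
    next
      case (Suc k)
      let ?gs = "map (\<lambda>c _. c) (take k ys) @ [\<lambda>z. z] @ map (\<lambda>c _. c) (drop (Suc k) xs)"
      have "tct_pol A F n (\<lambda>xs. f (map (\<lambda>p. p xs) (map (\<lambda>i xs. xs ! i) [0..<n])))"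
        using f by (intro tct_pol.comp) (auto intro: tct_pol.proj)
      moreover have "length ?gs = n" using len Suc.prems by auto
      ultimately have P: "tct_pol A F (length ?gs) (\<lambda>xs. f (map (\<lambda>i. xs ! i) [0..<n]))"
        by (simp add: comp_def)
      have "set (take k ys) \<subseteq> A" "set (drop (Suc k) xs) \<subseteq> A"
        using xs ys set_take_subset[of k ys] set_drop_subset[of "Suc k" xs]
        by (auto simp: tuples_def)
      then have "\<forall>g\<in>set ?gs. upol A F g" by (auto intro: upol_id upol_const)
      then have u: "upol A F (\<lambda>z. f (map (\<lambda>i. map (\<lambda>g. g z) ?gs ! i) [0..<n]))"
        by (rule upol_subst[OF P])
      have e: "map (\<lambda>i. map (\<lambda>g. g z) ?gs ! i) [0..<n] = take k ys @ [z] @ drop (Suc k) xs" for z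
      proof -
        have "map (\<lambda>i. map (\<lambda>g. g z) ?gs ! i) [0..<n] = map (\<lambda>g. g z) ?gs"
          using \<open>length ?gs = n\<close> by (metis length_map map_nth)
        then show ?thesis by (simp add: comp_def)
      qed
      have r: "(xs ! k, ys ! k) \<in> \<theta>" using rel Suc.prems len by (auto simp: list_all2_conv_all_nth)
      have "(f (take k ys @ [xs ! k] @ drop (Suc k) xs), f (take k ys @ [ys ! k] @ drop (Suc k) xs)) \<in> \<theta>"
        using up[OF u r] unfolding e .
      moreover have "take k ys @ [xs ! k] @ drop (Suc k) xs = take k ys @ drop k xs"
        using Suc.prems len by (simp add: Cons_nth_drop_Suc)
      moreover have "take k ys @ [ys ! k] @ drop (Suc k) xs = take (Suc k) ys @ drop (Suc k) xs"
        using Suc.prems len by (simp add: take_Suc_conv_app_nth)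
      moreover have "trans \<theta>" using eq by (simp add: equiv_def)
      ultimately show ?case using Suc transD by (metis Suc_leD)
    qed
    from this[of n] show ?thesis using len by simp
  qed
  then show ?thesis using eq unfolding tct_con_def by blast
qed

lemma tct_con_Inter:
  assumes "\<And>\<phi>. \<phi> \<in> X \<Longrightarrow> tct_con A F \<phi>" "X \<noteq> {}" 
  shows "tct_con A F (\<Inter>X)"
proof -
  have "equiv A (\<Inter>X)"
  proof (rule equivI)
    have "\<phi> \<subseteq> A \<times> A \<and> refl_on A \<phi> \<and> sym \<phi> \<and> trans \<phi>" if "\<phi> \<in> X" for \<phi>
      using assms(1)[OF that] by (simp add: tct_con_def equiv_def)
    then show "\<Inter>X \<subseteq> A \<times> A" "refl_on A (\<Inter>X)" "sym (\<Inter>X)" "trans (\<Inter>X)"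
      using assms(2) by (blast, simp add: refl_on_def, meson InterE InterI symD symI, meson InterE InterI transD transI)
  qed
  moreover have "list_all2 (\<lambda>x y. (x, y) \<in> \<Inter>X) xs ys \<Longrightarrow> \<phi> \<in> X \<Longrightarrow> list_all2 (\<lambda>x y. (x, y) \<in> \<phi>) xs ys"
    for xs ys \<phi> by (auto elim: list_all2_mono)
  ultimately show ?thesis using assms unfolding tct_con_def by blast
qed

text \<open>The orbit of \<open>x\<close> becomes periodic before step \<open>card S\<close>, with a
  period of at most \<open>card S\<close>. The factorial is a multiple of every such period and lies
  past every such preperiod, so one exponent serves all \<open>x\<close>.\<close>

lemma funpow_fact_idem:
  assumes "finite S" "f ` S \<subseteq> S" "x \<in> S"
  shows "(f ^^ fact (card S)) ((f ^^ fact (card S)) x) = (f ^^ fact (card S)) x"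
proof -
  have inS: "(f ^^ k) x \<in> S" for k using assms by (induction k) auto
  have "\<not> inj_on (\<lambda>k. (f ^^ k) x) {0..card S}"
  proof
    assume "inj_on (\<lambda>k. (f ^^ k) x) {0..card S}"
    then have "card {0..card S} \<le> card S" using inS assms(1) by (intro card_inj_on_le) auto
    then show False by simp
  qed
  then obtain i j where ij: "i < j" "j \<le> card S" "(f ^^ i) x = (f ^^ j) x"
    by (force simp: inj_on_def nat_neq_iff)
  define d where "d = j - i"
  have per: "(f ^^ (m + d)) x = (f ^^ m) x" if "m \<ge> i" for m
  proof -
    have "(f ^^ (m + d)) x = (f ^^ ((m - i) + j)) x" using that ij d_def by simp
    also have "\<dots> = (f ^^ (m - i)) ((f ^^ i) x)" using ij by (simp add: funpow_add)
    also have "\<dots> = (f ^^ m) x" using that by (metis comp_apply funpow_add le_add_diff_inverse2)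
    finally show ?thesis .
  qed
  have per': "(f ^^ (m + d * c)) x = (f ^^ m) x" if "m \<ge> i" for m c
  proof (induction c)
    case (Suc c)
    then show ?case using per[of "m + d * c"] that by (simp add: ac_simps)
  qed simp
  have "d dvd fact (card S)" using ij d_def by (intro dvd_fact) auto
  then obtain c where c: "fact (card S) = d * c" by auto
  have "i \<le> fact (card S)" using ij fact_ge_self[of "card S"] by linarith
  then show ?thesis using per'[of "fact (card S)" c] c by (simp add: funpow_add)
qed

text \<open>An injective idempotent map is the identity. Hence a permutation given by a polynomial
  has a polynomial inverse, its power \<open>fact (card S) - 1\<close>.\<close>

lemma funpow_fact_perm:
  assumes "finite S" "bij_betw f S S" "x \<in> S"
  shows "(f ^^ fact (card S)) x = x"
proof -
  have "bij_betw (f ^^ fact (card S)) S S" using assms(2) by (rule bij_betw_funpow)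
  then have "inj_on (f ^^ fact (card S)) S" "(f ^^ fact (card S)) x \<in> S"
    using assms(3) by (auto simp: bij_betw_def)
  moreover have "f ` S \<subseteq> S" using assms by (auto simp: bij_betw_def)
  ultimately show ?thesis using funpow_fact_idem[OF assms(1) _ assms(3)] assms(3) 
    by (auto simp: inj_on_def)
qed

section \<open>Minimal sets\<close>

lemma tct_con_sub: "tct_con A F \<theta> \<Longrightarrow> (x, y) \<in> \<theta> \<Longrightarrow> x \<in> A \<and> y \<in> A"
  by (auto simp: tct_con_def equiv_def)

lemma tct_con_refl: "tct_con A F \<theta> \<Longrightarrow> x \<in> A \<Longrightarrow> (x, x) \<in> \<theta>"
  by (auto simp: tct_con_def equiv_def refl_on_def)

lemma tct_con_sym: "tct_con A F \<theta> \<Longrightarrow> (x, y) \<in> \<theta> \<Longrightarrow> (y, x) \<in> \<theta>"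
  by (auto simp: tct_con_def equiv_def dest: symD)

lemma tct_con_trans: "tct_con A F \<theta> \<Longrightarrow> (x, y) \<in> \<theta> \<Longrightarrow> (y, z) \<in> \<theta> \<Longrightarrow> (x, z) \<in> \<theta>"
  unfolding tct_con_def equiv_def by (meson transD)

text \<open>\<phi> \<inter> \<beta> is a congruence strictly above \<alpha>, so it cannot be
  strictly below \<beta>.\<close>

lemma con_covers_least:
  assumes "con_covers A F \<alpha> \<beta>" "tct_con A F \<phi>" "\<alpha> \<subseteq> \<phi>" "(x, y) \<in> \<phi>" "(x, y) \<in> \<beta>" "(x, y) \<notin> \<alpha>"
  shows "\<beta> \<subseteq> \<phi>"
proof -
  have "tct_con A F (\<phi> \<inter> \<beta>)"
    using tct_con_Inter[of "{\<phi>, \<beta>}" A F] assms(1,2) by (auto simp: con_covers_def)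
  moreover have "\<alpha> \<subset> \<phi> \<inter> \<beta>" using assms by (auto simp: con_covers_def)
  ultimately have "\<not> \<phi> \<inter> \<beta> \<subset> \<beta>" using assms(1) by (auto simp: con_covers_def)
  then show ?thesis by blast
qed

locale prime_quotient =
  fixes A :: "'a set" and F :: "'a ops" and \<alpha> \<beta> :: "('a \<times> 'a) set"
  assumes fin_alg: "finite_algebra A F" and cov: "con_covers A F \<alpha> \<beta>"
begin

lemma alg: "is_algebra A F" and finA: "finite A"
  using fin_alg by (auto simp: finite_algebra_def)

lemma con_\<alpha>: "tct_con A F \<alpha>" and con_\<beta>: "tct_con A F \<beta>" and \<alpha>\<beta>: "\<alpha> \<subseteq> \<beta>"
  using cov by (auto simp: con_covers_def)

lemmas \<alpha>_refl = tct_con_refl[OF con_\<alpha>] and \<alpha>_sym = tct_con_sym[OF con_\<alpha>]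
  and \<alpha>_trans = tct_con_trans[OF con_\<alpha>] and \<alpha>_pol = upol_con[OF alg con_\<alpha>]
  and \<beta>_refl = tct_con_refl[OF con_\<beta>] and \<beta>_sym = tct_con_sym[OF con_\<beta>]
  and \<beta>_trans = tct_con_trans[OF con_\<beta>] and \<beta>_pol = upol_con[OF alg con_\<beta>]
  and \<beta>_sub = tct_con_sub[OF con_\<beta>] and upol_in = upol_closed[OF alg]
  and upol_o = upol_comp[OF alg]

text \<open>The pairs of \<open>\<beta>\<close> that no polynomial \<open>f \<circ> g\<close> separates modulo \<open>\<alpha>\<close> form a congruence
  in \<open>[\<alpha>, \<beta>]\<close>, so it is \<open>\<alpha>\<close> as soon as \<open>f\<close> itself separates some pair.\<close>

lemma separation:
  assumes f: "upol A F f" and xy: "(x, y) \<in> \<beta>" "(f x, f y) \<notin> \<alpha>"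
    and uv: "(u, v) \<in> \<beta>" "(u, v) \<notin> \<alpha>"
  shows "\<exists>g. upol A F g \<and> (f (g u), f (g v)) \<notin> \<alpha>"
proof (rule ccontr)
  assume neg: "\<not> ?thesis"
  define \<phi> where "\<phi> = {(u, v) \<in> \<beta>. \<forall>g. upol A F g \<longrightarrow> (f (g u), f (g v)) \<in> \<alpha>}"
  have "tct_con A F \<phi>"
  proof (rule tct_con_upolI[OF alg])
    show "equiv A \<phi>"
    proof (rule equivI)
      show "\<phi> \<subseteq> A \<times> A" using \<beta>_sub by (auto simp: \<phi>_def)
      show "refl_on A \<phi>" using \<beta>_refl \<alpha>_refl upol_in f by (auto simp: \<phi>_def refl_on_def)
      show "sym \<phi>" using \<beta>_sym \<alpha>_sym by (auto simp: \<phi>_def sym_def)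
      show "trans \<phi>" unfolding trans_def \<phi>_def using \<beta>_trans \<alpha>_trans by blast
    qed
    show "(h x, h y) \<in> \<phi>" if "upol A F h" "(x, y) \<in> \<phi>" for h x y
    proof -
      have "(h x, h y) \<in> \<beta>" using that \<beta>_pol by (auto simp: \<phi>_def)
      moreover have "(f (g (h x)), f (g (h y))) \<in> \<alpha>" if "upol A F g" for g
        using upol_o[OF that \<open>upol A F h\<close>] \<open>(x, y) \<in> \<phi>\<close> unfolding \<phi>_def by blast
      ultimately show ?thesis by (simp add: \<phi>_def)
    qed
  qed
  moreover have "\<alpha> \<subseteq> \<phi>" using \<alpha>\<beta> \<alpha>_pol f by (auto simp: \<phi>_def)
  moreover have "(u, v) \<in> \<phi>" using neg uv by (auto simp: \<phi>_def)
  ultimately have "\<beta> \<subseteq> \<phi>" using con_covers_least[OF cov] uv by blast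
  then have "(x, y) \<in> \<phi>" using xy by auto
  then show False using xy(2) upol_id[of A F] by (auto simp: \<phi>_def)
qed

end

locale min_set = prime_quotient +
  fixes U :: "'a set"
  assumes minU: "minimal_set A F \<alpha> \<beta> U"
begin

lemma retraction: "\<exists>e. upol A F e \<and> e ` A = U \<and> (\<forall>x\<in>U. e x = x)"
proof -
  obtain p where "tct_pol A F 1 p" "\<forall>x \<in> A. p [p [x]] = p [x]" "U = (\<lambda>x. p [x]) ` A"
    using minU by (auto simp: minimal_set_def idem_image_def)
  then show ?thesis by (intro exI[of _ "\<lambda>x. p [x]"]) (auto simp: upol_def)
qed

definition e where "e = (SOME e. upol A F e \<and> e ` A = U \<and> (\<forall>x\<in>U. e x = x))"

lemma e: "upol A F e" "e ` A = U" "x \<in> U \<Longrightarrow> e x = x" "x \<in> A \<Longrightarrow> e x \<in> U"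
proof -
  have e: "upol A F e \<and> e ` A = U \<and> (\<forall>x\<in>U. e x = x)"
    unfolding e_def by (rule someI_ex[OF retraction])
  then show "upol A F e" "e ` A = U" "x \<in> U \<Longrightarrow> e x = x" by simp_all
  then show "x \<in> A \<Longrightarrow> e x \<in> U" using imageI[of x A e] by simp
qed

lemma UA: "U \<subseteq> A" using e(2) upol_in[OF e(1)] by (metis image_subsetI)

lemma finU: "finite U" using UA finA finite_subset by blast

lemma U_pair: "\<exists>x y. x \<in> U \<and> y \<in> U \<and> (x, y) \<in> \<beta> \<and> (x, y) \<notin> \<alpha>"
proof -
  have "restr \<alpha> U \<noteq> restr \<beta> U" using minU unfolding minimal_set_def by blast
  then show ?thesis using \<alpha>\<beta> unfolding restr_def by blast
qed

text \<open>Minimality of \<open>U\<close> compares images of idempotent polynomials only, and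
  \<open>f\<close> need not be idempotent. The remedy: a smallest image \<open>W\<close>, inside the
  range of \<open>f\<close>, of any separating polynomial turns out to be the image of an idempotent
  one.\<close>

lemma image_eq:
  assumes f: "upol A F f" "f ` A \<subseteq> U" and xy: "(x, y) \<in> \<beta>" "(f x, f y) \<notin> \<alpha>"
  shows "f ` A = U"
proof -
  define X where "X = {W. W \<subseteq> f ` A \<and> (\<exists>h x y. upol A F h \<and> W = h ` A \<and> (x, y) \<in> \<beta> \<and> (h x, h y) \<notin> \<alpha>)}"
  have "X \<subseteq> Pow A" using f(2) UA unfolding X_def by blast
  then have "finite X" using finA by (meson finite_Pow_iff finite_subset)
  moreover have "f ` A \<in> X" using f xy by (auto simp: X_def)
  ultimately obtain W where W: "W \<in> X" "\<And>W'. W' \<in> X \<Longrightarrow> W' \<subseteq> W \<Longrightarrow> W' = W"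
    using finite_has_minimal[of X] by blast
  then obtain h x y where h: "upol A F h" "W = h ` A" "(x, y) \<in> \<beta>" "(h x, h y) \<notin> \<alpha>" and Wf: "W \<subseteq> f ` A"
    by (auto simp: X_def)
  have hxy: "(h x, h y) \<in> \<beta>" using \<beta>_pol h by blast
  \<comment> \<open>\<open>separation\<close> is applied to the pair (h x, h y) inside
    \<open>W\<close>, so that h \<circ> g still separates points of \<open>W\<close>. By the choice
    of \<open>W\<close> it then permutes \<open>W\<close>, and a power of it is a retraction onto
    \<open>W\<close>.\<close>
  obtain g where g: "upol A F g" "(h (g (h x)), h (g (h y))) \<notin> \<alpha>"
    using separation[OF h(1,3,4) hxy h(4)] by blast
  have WA: "W \<subseteq> A" using h upol_in by blast
  let ?k = "\<lambda>x. h (g x)"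
  have k: "upol A F ?k" using upol_o h g by blast
  have kW: "?k ` W = W"
  proof (rule W(2))
    have "upol A F (\<lambda>x. ?k (h x))" using upol_o[OF k h(1)] .
    moreover have "?k ` W = (\<lambda>x. ?k (h x)) ` A" using h by auto
    moreover show "?k ` W \<subseteq> W" using g h upol_in by blast
    ultimately show "?k ` W \<in> X" using g h(3) Wf unfolding X_def by blast
  qed
  have fW: "finite W" using WA finA finite_subset by blast
  then have bij: "bij_betw ?k W W" using kW by (simp add: bij_betw_def eq_card_imp_inj_on)
  define n :: nat where "n = fact (card W)"
  have idW: "(?k ^^ n) x = x" if "x \<in> W" for x
    using funpow_fact_perm[OF fW bij that] by (simp add: n_def)
  have "n > 0" by (simp add: n_def)
  have inW: "(?k ^^ n) x \<in> W" if "x \<in> A" for x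
  proof -
    have "(?k ^^ (n - 1)) x \<in> A" using upol_closed[OF alg upol_funpow[OF alg k]] that by blast
    then have "?k ((?k ^^ (n - 1)) x) \<in> W" using g h upol_in by blast
    moreover have "?k ^^ n = ?k ^^ Suc (n - 1)" using \<open>n > 0\<close> by simp
    ultimately show ?thesis by simp
  qed
  obtain p where p: "tct_pol A F 1 p" "\<forall>x\<in>A. (?k ^^ n) x = p [x]"
    using upol_funpow[OF alg k] unfolding upol_def by blast
  have "idem_image A F W" unfolding idem_image_def
  proof (intro exI conjI)
    show "tct_pol A F 1 p" by (rule p)
    have inW': "p [x] \<in> W" if "x \<in> A" for x using p inW that by auto
    moreover have idW': "p [x] = x" if "x \<in> W" for x using p(2) idW[OF that] that WA by (metis subsetD)
    ultimately show "\<forall>x\<in>A. p [p [x]] = p [x]" by blast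
    show "W = (\<lambda>x. p [x]) ` A"
    proof
      show "W \<subseteq> (\<lambda>x. p [x]) ` A"
      proof
        fix x assume "x \<in> W"
        then show "x \<in> (\<lambda>x. p [x]) ` A" using idW'[of x] WA by (intro image_eqI[of _ _ x]) auto
      qed
    qed (use inW' in blast)
  qed
  moreover have "restr \<alpha> W \<noteq> restr \<beta> W" 
  proof -
    have "(h x, h y) \<in> restr \<beta> W" "(h x, h y) \<notin> restr \<alpha> W" using hxy h \<beta>_sub by (auto simp: restr_def)
    then show ?thesis by blast
  qed
  ultimately have "W = U" using minU Wf f unfolding minimal_set_def by blast
  then show ?thesis using Wf f by auto
qed

text \<open>\<open>e\<close> fixes, hence separates, the pair from \<open>U_pair\<close>; so
  \<open>separation\<close> supplies e \<circ> g separating (u, v), and \<open>image_eq\<close>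
  computes its range.\<close>

lemma separation_U:
  assumes "(u, v) \<in> \<beta>" "(u, v) \<notin> \<alpha>"
  shows "\<exists>f. upol A F f \<and> f ` A = U \<and> (f u, f v) \<notin> \<alpha>"
proof -
  obtain x y where xy: "x \<in> U" "y \<in> U" "(x, y) \<in> \<beta>" "(x, y) \<notin> \<alpha>" using U_pair by blast
  then have "(e x, e y) \<notin> \<alpha>" using e(3) by simp
  then obtain g where g: "upol A F g" "(e (g u), e (g v)) \<notin> \<alpha>"
    using separation[OF e(1) xy(3) _ assms] by blast
  have u: "upol A F (\<lambda>x. e (g x))" using upol_o e(1) g(1) .
  have "(\<lambda>x. e (g x)) ` A \<subseteq> U" using e g upol_in by blast
  from image_eq[OF u this assms(1) g(2)] show ?thesis using u g by blast
qed

text \<open>By \<open>image_eq\<close> the map permutes \<open>U\<close>. Its inverse is the power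
  with exponent \<open>fact (card U) - 1\<close>, precomposed with \<open>e\<close> to bring all of
  \<open>A\<close> into \<open>U\<close>.\<close>

lemma inverse_pol:
  assumes f: "upol A F f" "f ` U \<subseteq> U" and xy: "x \<in> U" "y \<in> U" "(x, y) \<in> \<beta>" "(f x, f y) \<notin> \<alpha>"
  shows "\<exists>f'. upol A F f' \<and> f' ` A \<subseteq> U \<and> (\<forall>x\<in>U. f' (f x) = x \<and> f (f' x) = x)"
proof -
  have u: "upol A F (\<lambda>x. f (e x))" using upol_o f(1) e(1) .
  have "(\<lambda>x. f (e x)) ` A = U"
    using image_eq[OF u _ xy(3)] e f(2) xy by (force simp: image_subset_iff)
  then have fU: "f ` U = U" using e(2) by (auto simp: image_image[symmetric])
  then have bij: "bij_betw f U U" using finU by (simp add: bij_betw_def eq_card_imp_inj_on)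
  define n :: nat where "n = fact (card U) - 1"
  have n: "fact (card U) = Suc n" unfolding n_def
    by (metis Suc_pred' fact_gt_zero)
  let ?f = "\<lambda>x. (f ^^ n) (e x)"
  have "upol A F ?f" using upol_o[OF upol_funpow[OF alg f(1)] e(1)] .
  moreover have "(f ^^ m) x \<in> U" if "x \<in> U" for m x using that f(2) by (induction m) auto
  then have "?f ` A \<subseteq> U" using e by blast
  moreover have "?f (f x) = x \<and> f (?f x) = x" if "x \<in> U" for x
    using funpow_fact_perm[OF finU bij that] that e(3) fU unfolding n
    by (metis comp_apply funpow.simps(2) funpow_Suc_right imageI)
  ultimately show ?thesis by blast
qed

lemma body_iff: "x \<in> body \<alpha> \<beta> U \<longleftrightarrow> x \<in> U \<and> (\<exists>y\<in>U. (x, y) \<in> \<beta> \<and> (x, y) \<notin> \<alpha>)"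
proof
  assume "x \<in> body \<alpha> \<beta> U"
  then obtain N z where N: "x \<in> N" "z \<in> U" "N = restr \<beta> U `` {z}"
    "\<not> (\<exists>x \<in> U. N = restr \<alpha> U `` {x})"
    by (auto simp: body_def is_trace_def)
  then have x: "x \<in> U" "(z, x) \<in> \<beta>" by (auto simp: restr_def)
  have "N \<noteq> restr \<alpha> U `` {x}" using N x by blast
  moreover have "restr \<alpha> U `` {x} \<subseteq> N"
    unfolding N(3) restr_def using N(2) x \<alpha>\<beta> \<beta>_trans[OF x(2)] by blast
  ultimately obtain y where "y \<in> N" "y \<notin> restr \<alpha> U `` {x}" by auto
  moreover have "y \<in> U" "(x, y) \<in> \<beta>" 
    using \<open>y \<in> N\<close> x(1) \<beta>_trans[OF \<beta>_sym[OF x(2)]] unfolding N(3) restr_def by blast+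
  ultimately show "x \<in> U \<and> (\<exists>y\<in>U. (x, y) \<in> \<beta> \<and> (x, y) \<notin> \<alpha>)" using x by (auto simp: restr_def)
next
  assume "x \<in> U \<and> (\<exists>y\<in>U. (x, y) \<in> \<beta> \<and> (x, y) \<notin> \<alpha>)"
  then obtain y where x: "x \<in> U" and y: "y \<in> U" "(x, y) \<in> \<beta>" "(x, y) \<notin> \<alpha>" by blast
  have x': "x \<in> restr \<beta> U `` {x}" "y \<in> restr \<beta> U `` {x}"
    using x y \<beta>_refl UA by (auto simp: restr_def)
  have "\<not> (\<exists>z \<in> U. restr \<beta> U `` {x} = restr \<alpha> U `` {z})"
  proof
    assume "\<exists>z \<in> U. restr \<beta> U `` {x} = restr \<alpha> U `` {z}"
    then obtain z where "(z, x) \<in> \<alpha>" "(z, y) \<in> \<alpha>" using x' by (auto simp: restr_def)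
    then show False using y \<alpha>_sym \<alpha>_trans by blast
  qed
  then have "is_trace \<alpha> \<beta> U (restr \<beta> U `` {x})" using x unfolding is_trace_def by blast
  then show "x \<in> body \<alpha> \<beta> U" using x' by (auto simp: body_def)
qed

lemma tail_iff: "t \<in> tail \<alpha> \<beta> U \<longleftrightarrow> t \<in> U \<and> (\<forall>y\<in>U. (t, y) \<in> \<beta> \<longrightarrow> (t, y) \<in> \<alpha>)"
  using body_iff by (auto simp: tail_def)

end

text \<open>The type may be witnessed on a minimal set other than the given one, so the tail has to
  move along. A separating polynomial \<open>f\<close> maps \<open>U\<close> onto \<open>V\<close>
  and has a polynomial left inverse on \<open>U\<close>; a \<beta>-neighbour of \<open>f t\<close>
  in \<open>V\<close> thus pulls back to a \<beta>-neighbour of \<open>t\<close> in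
  \<open>U\<close>, which is \<alpha>-related to \<open>t\<close>.\<close>

lemma tail_nonempty_transfer:
  assumes "min_set A F \<alpha> \<beta> U" "min_set A F \<alpha> \<beta> V" "tail \<alpha> \<beta> U \<noteq> {}"
  shows "tail \<alpha> \<beta> V \<noteq> {}"
proof -
  interpret U: min_set A F \<alpha> \<beta> U by fact
  interpret V: min_set A F \<alpha> \<beta> V by fact
  obtain x y where xy: "x \<in> U" "y \<in> U" "(x, y) \<in> \<beta>" "(x, y) \<notin> \<alpha>" using U.U_pair by blast
  obtain f where f: "upol A F f" "f ` A = V" "(f x, f y) \<notin> \<alpha>"
    using V.separation_U[OF xy(3,4)] by blast
  have fxy: "(f x, f y) \<in> \<beta>" using U.\<beta>_pol f xy by blast
  obtain g where g: "upol A F g" "g ` A = U" "(g (f x), g (f y)) \<notin> \<alpha>"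
    using U.separation_U[OF fxy f(3)] by blast
  have gf: "upol A F (\<lambda>x. g (f x))" using U.upol_o f g by blast
  have "(\<lambda>x. g (f x)) ` U \<subseteq> U" using f g U.UA V.UA by blast
  then obtain h where h: "upol A F h" "h ` A \<subseteq> U" "\<forall>x\<in>U. h (g (f x)) = x"
    using U.inverse_pol[OF gf _ xy(1-3) g(3)] by metis
  have fe: "upol A F (\<lambda>x. f (U.e x))" using U.upol_o f(1) U.e(1) .
  have "(\<lambda>x. f (U.e x)) ` A = V"
    using V.image_eq[OF fe _ xy(3)] f U.e(3,4) U.UA xy by (force simp: image_subset_iff)
  then have fU: "f ` U = V" using U.e(2) by (auto simp: image_image[symmetric])
  obtain t where t: "t \<in> tail \<alpha> \<beta> U" using assms(3) by auto
  have "f t \<in> tail \<alpha> \<beta> V" unfolding V.tail_iff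
  proof (intro conjI ballI impI)
    show "f t \<in> V" using t fU U.tail_iff by blast
    fix y assume "y \<in> V" and y: "(f t, y) \<in> \<beta>"
    then obtain z where z: "z \<in> U" "y = f z" using fU by blast
    have "(h (g (f t)), h (g (f z))) \<in> \<beta>" 
      using y z U.\<beta>_pol[OF h(1) U.\<beta>_pol[OF g(1)]] by simp
    then have "(t, z) \<in> \<beta>" using h z t U.tail_iff by simp
    then have "(t, z) \<in> \<alpha>" using t z U.tail_iff by blast
    then show "(f t, y) \<in> \<alpha>" using z U.\<alpha>_pol f by blast
  qed
  then show ?thesis by auto
qed

locale trace_pair = min_set +
  fixes N :: "'a set" and a b :: 'a
  assumes N: "is_trace \<alpha> \<beta> U N" and aN: "a \<in> N" and bN: "b \<in> N" and ab: "(a, b) \<notin> \<alpha>"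
begin

lemma N_def: "N = {y \<in> U. (a, y) \<in> \<beta>}"
proof -
  obtain x where x: "x \<in> U" "N = restr \<beta> U `` {x}" 
    using conjunct1[OF N[unfolded is_trace_def]] by (rule bexE)
  then have "(x, a) \<in> \<beta>" using aN by (auto simp: restr_def)
  then have "(a, y) \<in> \<beta> \<longleftrightarrow> (x, y) \<in> \<beta>" for y
    using \<beta>_trans[of x a y] \<beta>_trans[of a x y] \<beta>_sym[of x a] by blast
  then show ?thesis using x by (auto simp: restr_def)
qed

lemma NU: "x \<in> N \<Longrightarrow> x \<in> U" and NA: "x \<in> N \<Longrightarrow> x \<in> A" and N\<beta>: "x \<in> N \<Longrightarrow> y \<in> N \<Longrightarrow> (x, y) \<in> \<beta>"
proof -
  show U: "x \<in> U" if "x \<in> N" for x using that by (simp add: N_def)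
  then show "x \<in> A" if "x \<in> N" for x using that UA by blast
  show "(x, y) \<in> \<beta>" if "x \<in> N" "y \<in> N" for x y
    using that \<beta>_trans[OF \<beta>_sym] unfolding N_def by blast
qed

lemma N_closed: "x \<in> N \<Longrightarrow> y \<in> U \<Longrightarrow> (x, y) \<in> \<beta> \<Longrightarrow> y \<in> N"
  using \<beta>_trans unfolding N_def by blast

lemmas aU = NU[OF aN] and bU = NU[OF bN] and aA = NA[OF aN] and bA = NA[OF bN] and ab\<beta> = N\<beta>[OF aN bN]

end

section \<open>Subpowers containing the diagonal\<close>

lemma sq_ops_iff: "(n, g) \<in> sq_ops F \<longleftrightarrow>
    (\<exists>f. (n, f) \<in> F \<and> g = (\<lambda>ps. (f (map fst ps), f (map snd ps))))"
  by (auto simp: sq_ops_def)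

text \<open>A constant \<open>c\<close> of \<open>A\<close> becomes the constant
  \<open>(c, c)\<close>; this is where \<open>S\<close> has to contain the diagonal.\<close>

lemma sq_pol_diag:
  assumes "tct_pol A F n f" "\<And>x. x \<in> A \<Longrightarrow> (x, x) \<in> S"
  shows "\<exists>P. tct_pol S (sq_ops F) n P \<and>
    (\<forall>ps. length ps = n \<longrightarrow> P ps = (f (map fst ps), f (map snd ps)))"
  using assms(1)
proof induction
  case (proj i n)
  then show ?case by (intro exI[of _ "\<lambda>ps. ps ! i"]) (auto intro: tct_pol.proj)
next
  case (const c n)
  then show ?case using assms(2) by (intro exI[of _ "\<lambda>_. (c, c)"]) (auto intro: tct_pol.const)
next
  case (comp k f ps n)
  then obtain Q where Q: "\<forall>p\<in>set ps. tct_pol S (sq_ops F) n (Q p) \<and>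
      (\<forall>xs. length xs = n \<longrightarrow> Q p xs = (p (map fst xs), p (map snd xs)))" by metis
  let ?g = "\<lambda>ps. (f (map fst ps), f (map snd ps))"
  have "tct_pol S (sq_ops F) n (\<lambda>xs. ?g (map (\<lambda>p. p xs) (map Q ps)))"
    using comp Q by (intro tct_pol.comp[of k ?g]) (auto simp: sq_ops_iff)
  moreover have "?g (map (\<lambda>p. p xs) (map Q ps)) =
      (f (map (\<lambda>p. p (map fst xs)) ps), f (map (\<lambda>p. p (map snd xs)) ps))" if "length xs = n" for xs
    using that Q by (auto intro!: arg_cong[where f=f])
  ultimately show ?case by (intro exI[of _ "\<lambda>xs. ?g (map (\<lambda>p. p xs) (map Q ps))"]) blast
qed

text \<open>The constants of a polynomial of \<open>S\<close> may differ in the two coordinates, so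
  each coordinate is a polynomial of \<open>A\<close> of its own.\<close>

lemma sq_pol_fst:
  assumes "tct_pol S (sq_ops F) n P" "S \<subseteq> A \<times> A"
  shows "\<exists>f. tct_pol A F n f \<and> (\<forall>ps. length ps = n \<longrightarrow> fst (P ps) = f (map fst ps))"
  using assms(1)
proof induction
  case (proj i n)
  then show ?case by (intro exI[of _ "\<lambda>ps. ps ! i"]) (auto intro: tct_pol.proj)
next
  case (const c n)
  then show ?case using assms(2) by (intro exI[of _ "\<lambda>_. fst c"]) (auto intro!: tct_pol.const)
next
  case (comp k g ps n)
  then obtain Q where Q: "\<forall>p\<in>set ps. tct_pol A F n (Q p) \<and>
      (\<forall>xs. length xs = n \<longrightarrow> fst (p xs) = Q p (map fst xs))" by metis
  obtain f where f: "(k, f) \<in> F" "g = (\<lambda>ps. (f (map fst ps), f (map snd ps)))"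
    using comp(1) by (auto simp: sq_ops_iff)
  have "tct_pol A F n (\<lambda>xs. f (map (\<lambda>p. p xs) (map Q ps)))"
    using comp f Q by (intro tct_pol.comp) auto
  moreover have "fst (g (map (\<lambda>p. p xs) ps)) = f (map (\<lambda>p. p (map fst xs)) (map Q ps))" if "length xs = n" for xs
    using that Q f by (auto intro!: arg_cong[where f=f])
  ultimately show ?case by (intro exI[of _ "\<lambda>xs. f (map (\<lambda>p. p xs) (map Q ps))"]) blast
qed

lemma sq_pol_snd:
  assumes "tct_pol S (sq_ops F) n P" "S \<subseteq> A \<times> A"
  shows "\<exists>f. tct_pol A F n f \<and> (\<forall>ps. length ps = n \<longrightarrow> snd (P ps) = f (map snd ps))"
  using assms(1)
proof induction
  case (proj i n)
  then show ?case by (intro exI[of _ "\<lambda>ps. ps ! i"]) (auto intro: tct_pol.proj)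
next
  case (const c n)
  then show ?case using assms(2) by (intro exI[of _ "\<lambda>_. snd c"]) (auto intro!: tct_pol.const)
next
  case (comp k g ps n)
  then obtain Q where Q: "\<forall>p\<in>set ps. tct_pol A F n (Q p) \<and>
      (\<forall>xs. length xs = n \<longrightarrow> snd (p xs) = Q p (map snd xs))" by metis
  obtain f where f: "(k, f) \<in> F" "g = (\<lambda>ps. (f (map fst ps), f (map snd ps)))"
    using comp(1) by (auto simp: sq_ops_iff)
  have "tct_pol A F n (\<lambda>xs. f (map (\<lambda>p. p xs) (map Q ps)))"
    using comp f Q by (intro tct_pol.comp) auto
  moreover have "snd (g (map (\<lambda>p. p xs) ps)) = f (map (\<lambda>p. p (map snd xs)) (map Q ps))" if "length xs = n" for xs
    using that Q f by (auto intro!: arg_cong[where f=f])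
  ultimately show ?case by (intro exI[of _ "\<lambda>xs. f (map (\<lambda>p. p xs) (map Q ps))"]) blast
qed

locale diagonal_subpower = trace_pair +
  fixes S :: "('a \<times> 'a) set"
  assumes S: "subalg_sq A F S" and diag: "x \<in> A \<Longrightarrow> (x, x) \<in> S"
begin

abbreviation "SF \<equiv> sq_ops F"

lemma SA: "S \<subseteq> A \<times> A" using S by (simp add: subalg_sq_def)

lemma S_fst: "p \<in> S \<Longrightarrow> fst p \<in> A" and S_snd: "p \<in> S \<Longrightarrow> snd p \<in> A" using SA by auto

lemma finS: "finite S" using SA finA by (meson finite_SigmaI finite_subset)

lemma algS: "is_algebra S SF" using S by (simp add: subalg_sq_def is_algebra_def)

lemmas SP_in = upol_closed[OF algS] and SP_o = upol_comp[OF algS]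

lemma SP_fst:
  assumes "upol S SF P" shows "\<exists>f. upol A F f \<and> (\<forall>p\<in>S. fst (P p) = f (fst p))"
proof -
  obtain Q where Q: "tct_pol S SF 1 Q" "\<forall>p\<in>S. P p = Q [p]" using assms by (auto simp: upol_def)
  then obtain f where "tct_pol A F 1 f" "\<forall>ps. length ps = 1 \<longrightarrow> fst (Q ps) = f (map fst ps)"
    using sq_pol_fst SA by blast
  then show ?thesis using Q by (intro exI[of _ "\<lambda>x. f [x]"]) (auto simp: upol_def)
qed

lemma SP_snd:
  assumes "upol S SF P" shows "\<exists>f. upol A F f \<and> (\<forall>p\<in>S. snd (P p) = f (snd p))"
proof -
  obtain Q where Q: "tct_pol S SF 1 Q" "\<forall>p\<in>S. P p = Q [p]" using assms by (auto simp: upol_def)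
  then obtain f where "tct_pol A F 1 f" "\<forall>ps. length ps = 1 \<longrightarrow> snd (Q ps) = f (map snd ps)"
    using sq_pol_snd SA by blast
  then show ?thesis using Q by (intro exI[of _ "\<lambda>x. f [x]"]) (auto simp: upol_def)
qed

lemma SP_diag:
  assumes "upol A F f" shows "upol S SF (\<lambda>p. (f (fst p), f (snd p)))"
proof -
  obtain q where q: "tct_pol A F 1 q" "\<forall>x\<in>A. f x = q [x]" using assms by (auto simp: upol_def)
  then obtain P where P: "tct_pol S SF 1 P" "\<forall>ps. length ps = 1 \<longrightarrow> P ps = (q (map fst ps), q (map snd ps))"
    using sq_pol_diag[OF q(1) diag] by blast
  show ?thesis unfolding upol_def
    by (rule exI[of _ P]) (use P q S_fst S_snd in auto)
qed

lemma SP_fst_con: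
  "upol S SF P \<Longrightarrow> p \<in> S \<Longrightarrow> q \<in> S \<Longrightarrow> tct_con A F \<phi> \<Longrightarrow> (fst p, fst q) \<in> \<phi> \<Longrightarrow> (fst (P p), fst (P q)) \<in> \<phi>"
proof -
  assume P: "upol S SF P" "p \<in> S" "q \<in> S" "tct_con A F \<phi>" "(fst p, fst q) \<in> \<phi>"
  obtain f where "upol A F f" "\<forall>p\<in>S. fst (P p) = f (fst p)" using SP_fst[OF P(1)] by blast
  then show ?thesis using upol_con[OF alg P(4) _ P(5), of f] P(2,3) by simp
qed

lemma SP_snd_con:
  "upol S SF P \<Longrightarrow> p \<in> S \<Longrightarrow> q \<in> S \<Longrightarrow> tct_con A F \<phi> \<Longrightarrow> (snd p, snd q) \<in> \<phi> \<Longrightarrow> (snd (P p), snd (P q)) \<in> \<phi>"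
proof -
  assume P: "upol S SF P" "p \<in> S" "q \<in> S" "tct_con A F \<phi>" "(snd p, snd q) \<in> \<phi>"
  obtain f where "upol A F f" "\<forall>p\<in>S. snd (P p) = f (snd p)" using SP_snd[OF P(1)] by blast
  then show ?thesis using upol_con[OF alg P(4) _ P(5), of f] P(2,3) by simp
qed

text \<open>\<open>\<delta>\<close> is the largest congruence of \<open>S\<close> below \<open>\<beta> \<times> \<beta>\<close> that on \<open>S \<inter> \<beta>\<close>, which is a union of
  \<open>\<beta> \<times> \<beta>\<close>-classes, is contained in the congruence induced by \<open>\<alpha>\<close> on the first coordinate.\<close>

definition \<delta> where "\<delta> = {(p, q). p \<in> S \<and> q \<in> S \<and> (fst p, fst q) \<in> \<beta> \<and> (snd p, snd q) \<in> \<beta> \<and>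
   (\<forall>P. upol S SF P \<longrightarrow> P p \<in> \<beta> \<longrightarrow> (fst (P p), fst (P q)) \<in> \<alpha>)}"

definition \<gamma> where "\<gamma> = {(p, q). p \<in> S \<and> q \<in> S \<and> fst p = fst q}"

text \<open>\<open>con_join\<close> intersects the congruences above a relation, so it accepts a
  single pair as an argument and yields the congruence generated by \<delta> and that pair.\<close>

definition \<theta> where "\<theta> = con_join S SF \<delta> {((a, a), (b, b))}"

text \<open>By this saturation the condition \<open>P p \<in> \<beta>\<close> in \<delta> can be
  tested at either member of a pair; symmetry and transitivity of \<delta> rest on it.\<close>

lemma \<beta>_transport:
  assumes "(fst p, fst q) \<in> \<beta>" "(snd p, snd q) \<in> \<beta>" shows "p \<in> \<beta> \<longleftrightarrow> q \<in> \<beta>"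
proof -
  have "(fst p, snd p) \<in> \<beta> \<longleftrightarrow> (fst q, snd q) \<in> \<beta>"
    using \<beta>_trans[OF \<beta>_sym[OF assms(1)]] \<beta>_trans[OF assms(1)]
      \<beta>_trans[OF _ assms(2)] \<beta>_trans[OF _ \<beta>_sym[OF assms(2)]] by blast
  then show ?thesis by simp
qed

lemma con_\<gamma>: "tct_con S SF \<gamma>"
proof (rule tct_con_upolI[OF algS])
  show "equiv S \<gamma>" by (rule equivI) (auto simp: \<gamma>_def refl_on_def sym_def trans_def)
  show "(P p, P q) \<in> \<gamma>" if "upol S SF P" "(p, q) \<in> \<gamma>" for P p q
    using SP_fst[OF that(1)] that(2) SP_in[OF that(1)] by (auto simp: \<gamma>_def)
qed

lemma con_\<beta>\<beta>: "tct_con S SF {(p, q). p \<in> S \<and> q \<in> S \<and> (fst p, fst q) \<in> \<beta> \<and> (snd p, snd q) \<in> \<beta>}" (is "tct_con S SF ?\<phi>")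
proof (rule tct_con_upolI[OF algS])
  show "equiv S ?\<phi>"
  proof (rule equivI)
    show "refl_on S ?\<phi>" using \<beta>_refl S_fst S_snd by (auto simp: refl_on_def)
    show "sym ?\<phi>" using \<beta>_sym by (auto simp: sym_def)
    show "trans ?\<phi>" unfolding trans_def using \<beta>_trans by blast
  qed auto
  show "(P p, P q) \<in> ?\<phi>" if "upol S SF P" "(p, q) \<in> ?\<phi>" for P p q
    using that(2) SP_fst_con[OF that(1) _ _ con_\<beta>] SP_snd_con[OF that(1) _ _ con_\<beta>] SP_in[OF that(1)]
    by simp
qed

lemma con_\<delta>: "tct_con S SF \<delta>"
proof (rule tct_con_upolI[OF algS])
  have "(P q \<in> \<beta>) = (P p \<in> \<beta>)" if "(p, q) \<in> \<delta>" "upol S SF P" for p q P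
    using \<beta>_transport[of "P p" "P q"] that(1) SP_fst_con[OF that(2) _ _ con_\<beta>]
      SP_snd_con[OF that(2) _ _ con_\<beta>] by (simp add: \<delta>_def)
  note tr = this
  show "equiv S \<delta>"
  proof (rule equivI)
    show "\<delta> \<subseteq> S \<times> S" by (auto simp: \<delta>_def)
    show "refl_on S \<delta>" 
      using \<beta>_refl \<alpha>_refl[OF S_fst[OF SP_in]] S_fst S_snd unfolding \<delta>_def refl_on_def by blast
    show "sym \<delta>"
    proof (rule symI)
      fix p q assume pq: "(p, q) \<in> \<delta>"
      then show "(q, p) \<in> \<delta>" using tr[OF pq] \<beta>_sym \<alpha>_sym unfolding \<delta>_def by blast
    qed
    show "trans \<delta>"
    proof (rule transI)
      fix p q r assume pq: "(p, q) \<in> \<delta>" and qr: "(q, r) \<in> \<delta>"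
      have "(fst (P p), fst (P r)) \<in> \<alpha>" if "upol S SF P" "P p \<in> \<beta>" for P
        using tr[OF pq that(1)] pq qr that \<alpha>_trans unfolding \<delta>_def by blast
      then show "(p, r) \<in> \<delta>" using pq qr \<beta>_trans unfolding \<delta>_def by blast
    qed
  qed
  show "(Q p, Q q) \<in> \<delta>" if Q: "upol S SF Q" and pq: "(p, q) \<in> \<delta>" for Q p q
  proof -
    have "(fst (P (Q p)), fst (P (Q q))) \<in> \<alpha>" if "upol S SF P" "P (Q p) \<in> \<beta>" for P
      using SP_o[OF that(1) Q] pq that unfolding \<delta>_def by blast
    then show ?thesis
      using pq SP_fst_con[OF Q _ _ con_\<beta>] SP_snd_con[OF Q _ _ con_\<beta>] SP_in[OF Q] by (simp add: \<delta>_def)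
  qed
qed

text \<open>The first coordinate of a polynomial of \<open>S\<close> respects \<alpha>. These pairs
  make \<delta> large enough to absorb \<gamma> \<inter> \<theta>, whose members agree in the first
  coordinate.\<close>

lemma \<delta>_contains: "p \<in> S \<Longrightarrow> q \<in> S \<Longrightarrow> (fst p, fst q) \<in> \<alpha> \<Longrightarrow> (snd p, snd q) \<in> \<beta> \<Longrightarrow> (p, q) \<in> \<delta>"
  using SP_fst_con[OF _ _ _ con_\<alpha>] \<alpha>\<beta> unfolding \<delta>_def by blast

lemma \<delta>_on_\<beta>: "(p, q) \<in> \<delta> \<Longrightarrow> p \<in> \<beta> \<Longrightarrow> (fst p, fst q) \<in> \<alpha>"
  unfolding \<delta>_def using upol_id[of S SF] by blast

lemma con_\<theta>: "tct_con S SF \<theta>" and \<delta>\<theta>: "\<delta> \<subseteq> \<theta>" and ab\<theta>: "((a, a), (b, b)) \<in> \<theta>"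
  and \<theta>_sub: "(p, q) \<in> \<theta> \<Longrightarrow> p \<in> S \<and> q \<in> S \<and> (fst p, fst q) \<in> \<beta> \<and> (snd p, snd q) \<in> \<beta>"
  and \<theta>_least: "tct_con S SF \<psi> \<Longrightarrow> \<delta> \<subseteq> \<psi> \<Longrightarrow> ((a, a), (b, b)) \<in> \<psi> \<Longrightarrow> \<theta> \<subseteq> \<psi>"
proof -
  let ?\<phi> = "{(p, q). p \<in> S \<and> q \<in> S \<and> (fst p, fst q) \<in> \<beta> \<and> (snd p, snd q) \<in> \<beta>}"
  have \<phi>: "?\<phi> \<in> {\<phi>. tct_con S SF \<phi> \<and> \<delta> \<union> {((a, a), (b, b))} \<subseteq> \<phi>}"
    using con_\<beta>\<beta> diag aA bA ab\<beta> by (auto simp: \<delta>_def)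
  show "tct_con S SF \<theta>" unfolding \<theta>_def con_join_def
    by (rule tct_con_Inter) (use \<phi> in blast)+
  show "\<delta> \<subseteq> \<theta>" "((a, a), (b, b)) \<in> \<theta>" by (auto simp: \<theta>_def con_join_def)
  have "\<theta> \<subseteq> ?\<phi>" unfolding \<theta>_def con_join_def using \<phi> by blast
  then show "(p, q) \<in> \<theta> \<Longrightarrow> p \<in> S \<and> q \<in> S \<and> (fst p, fst q) \<in> \<beta> \<and> (snd p, snd q) \<in> \<beta>" by blast
  show "tct_con S SF \<psi> \<Longrightarrow> \<delta> \<subseteq> \<psi> \<Longrightarrow> ((a, a), (b, b)) \<in> \<psi> \<Longrightarrow> \<theta> \<subseteq> \<psi>"
    unfolding \<theta>_def con_join_def by blast
qed

lemma con_diag_preimage: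
  assumes "tct_con S SF \<psi>" shows "tct_con A F {(x, y). x \<in> A \<and> y \<in> A \<and> ((x, x), (y, y)) \<in> \<psi>}" (is "tct_con A F ?\<phi>")
proof (rule tct_con_upolI[OF alg])
  show "equiv A ?\<phi>"
  proof (rule equivI)
    show "refl_on A ?\<phi>" using tct_con_refl[OF assms] diag by (auto simp: refl_on_def)
    show "sym ?\<phi>" using tct_con_sym[OF assms] by (auto simp: sym_def)
    show "trans ?\<phi>" unfolding trans_def using tct_con_trans[OF assms] by blast
  qed auto
  show "(f x, f y) \<in> ?\<phi>" if "upol A F f" "(x, y) \<in> ?\<phi>" for f x y
    using upol_con[OF algS assms SP_diag[OF that(1)], of "(x, x)" "(y, y)"] that(2) upol_in[OF that(1)]
    by simp
qed

text \<open>Pulling \<psi> back along the diagonal embedding gives a congruence of \<open>A\<close>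
  above \<alpha> that contains (x, y); since \<beta> covers \<alpha>, it contains \<beta>.\<close>

lemma con_above_\<delta>:
  assumes \<psi>: "tct_con S SF \<psi>" "\<delta> \<subseteq> \<psi>" and xy: "((x, x), (y, y)) \<in> \<psi>" "(x, y) \<in> \<beta>" "(x, y) \<notin> \<alpha>"
  shows "\<theta> \<subseteq> \<psi>" and "(u, v) \<in> \<beta> \<Longrightarrow> ((u, u), (v, v)) \<in> \<psi>"
proof -
  let ?\<phi> = "{(x, y). x \<in> A \<and> y \<in> A \<and> ((x, x), (y, y)) \<in> \<psi>}"
  have "\<alpha> \<subseteq> ?\<phi>"
  proof safe
    fix u v assume "(u, v) \<in> \<alpha>"
    then show "u \<in> A" "v \<in> A" using \<beta>_sub \<alpha>\<beta> by blast+
    then show "((u, u), (v, v)) \<in> \<psi>" using \<psi>(2) \<delta>_contains[of "(u,u)" "(v,v)"] diag \<open>(u, v) \<in> \<alpha>\<close> \<alpha>\<beta> by auto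
  qed
  then have "\<beta> \<subseteq> ?\<phi>"
    by (rule con_covers_least[OF cov con_diag_preimage[OF \<psi>(1)] _ _ xy(2,3)]) (use xy \<beta>_sub in auto)
  then show "(u, v) \<in> \<beta> \<Longrightarrow> ((u, u), (v, v)) \<in> \<psi>" for u v by blast
  then show "\<theta> \<subseteq> \<psi>" using \<theta>_least[OF \<psi>] ab\<beta> by blast
qed

lemma \<theta>_diag: "(u, v) \<in> \<beta> \<Longrightarrow> ((u, u), (v, v)) \<in> \<theta>"
  using con_above_\<delta>(2)[OF con_\<theta> \<delta>\<theta> ab\<theta> ab\<beta> ab] .

text \<open>Inside S \<inter> \<beta> every element may be replaced by a diagonal one, which brings
  congruences above \<delta> into the reach of \<open>con_above_\<delta>\<close>.\<close>

lemma \<delta>_diag: "p \<in> S \<Longrightarrow> p \<in> \<beta> \<Longrightarrow> (p, (fst p, fst p)) \<in> \<delta>"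
  using \<delta>_contains[of p "(fst p, fst p)"] diag S_fst[of p] \<alpha>_refl \<beta>_sym[of "fst p" "snd p"] by simp

lemma \<theta>_on_\<beta>:
  assumes "p \<in> S" "q \<in> S" "p \<in> \<beta>" "q \<in> \<beta>" "(fst p, fst q) \<in> \<beta>" shows "(p, q) \<in> \<theta>"
  using \<delta>_diag[OF assms(1,3)] \<delta>_diag[OF assms(2,4)] \<theta>_diag[OF assms(5)] \<delta>\<theta>
    tct_con_trans[OF con_\<theta>] tct_con_sym[OF con_\<theta>] by blast

text \<open>A pair of \<theta> outside \<delta> is exposed by some \<open>P\<close> inside S
  \<inter> \<beta>. There \<open>\<delta>_diag\<close> turns its image into a pair of diagonal
  elements over a pair of \<beta> outside \<alpha>, and such a pair generates \<theta> over
  \<delta>.\<close>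

lemma \<delta>_covered: "con_covers S SF \<delta> \<theta>"
proof -
  have "((a, a), (b, b)) \<notin> \<delta>" using \<delta>_on_\<beta>[of "(a, a)" "(b, b)"] ab \<beta>_refl aA by auto
  then have "\<delta> \<subset> \<theta>" using \<delta>\<theta> ab\<theta> by blast
  moreover have "\<theta> \<subseteq> \<psi>" if \<psi>: "tct_con S SF \<psi>" "\<delta> \<subset> \<psi>" "\<psi> \<subset> \<theta>" for \<psi>
  proof -
    obtain p q where pq: "(p, q) \<in> \<psi>" "(p, q) \<notin> \<delta>" using \<psi> by auto
    then have pq': "p \<in> S" "q \<in> S" "(fst p, fst q) \<in> \<beta>" "(snd p, snd q) \<in> \<beta>" using \<theta>_sub[of p q] \<psi> by auto
    then obtain P where P: "upol S SF P" "P p \<in> \<beta>" "(fst (P p), fst (P q)) \<notin> \<alpha>"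
      using pq(2) unfolding \<delta>_def by blast
    have in_S: "P p \<in> S" "P q \<in> S" using SP_in[OF P(1)] pq' by auto
    have b: "(fst (P p), fst (P q)) \<in> \<beta>" "(snd (P p), snd (P q)) \<in> \<beta>"
      using SP_fst_con[OF P(1) _ _ con_\<beta>] SP_snd_con[OF P(1) _ _ con_\<beta>] pq' by auto
    then have "P q \<in> \<beta>" using \<beta>_transport P by blast
    then have "(P p, (fst (P p), fst (P p))) \<in> \<psi>" "(P q, (fst (P q), fst (P q))) \<in> \<psi>" "(P p, P q) \<in> \<psi>"
      using \<delta>_diag[of "P p"] \<delta>_diag[of "P q"] in_S P(2) \<psi>(2) upol_con[OF algS \<psi>(1) P(1) pq(1)] by blast+
    then have "((fst (P p), fst (P p)), (fst (P q), fst (P q))) \<in> \<psi>"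
      using tct_con_trans[OF \<psi>(1)] tct_con_sym[OF \<psi>(1)] by blast
    then show ?thesis using con_above_\<delta>(1)[OF \<psi>(1) _ _ b(1) P(3)] \<psi>(2) by blast
  qed
  ultimately show ?thesis using con_\<delta> con_\<theta> unfolding con_covers_def by blast
qed

lemma \<gamma>_meet: "\<gamma> \<inter> \<theta> \<subseteq> \<delta>"
proof clarify
  fix x y z w assume *: "((x, y), (z, w)) \<in> \<gamma>" "((x, y), (z, w)) \<in> \<theta>"
  then show "((x, y), (z, w)) \<in> \<delta>"
    using \<theta>_sub[OF *(2)] \<delta>_contains[of "(x, y)" "(z, w)"] \<alpha>_refl S_fst[of "(x, y)"] by (simp add: \<gamma>_def)
qed

text \<open>\<gamma> links every element of \<open>S\<close> to the diagonal element with the same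
  first coordinate, so the join contains the diagonal pair over (fst p, fst q).\<close>

lemma \<gamma>_join:
  assumes "(p, q) \<in> \<delta>" "(fst p, fst q) \<notin> \<alpha>"
  shows "\<theta> \<subseteq> con_join S SF \<gamma> \<delta>"
  unfolding con_join_def
proof (rule Inter_greatest, clarify)
  fix \<psi> x y z w assume \<psi>: "tct_con S SF \<psi>" "\<gamma> \<union> \<delta> \<subseteq> \<psi>" and xy: "((x, y), (z, w)) \<in> \<theta>"
  have pq: "p \<in> S" "q \<in> S" "(fst p, fst q) \<in> \<beta>" using assms by (auto simp: \<delta>_def)
  then have "((fst p, fst p), p) \<in> \<psi>" "(q, (fst q, fst q)) \<in> \<psi>" "(p, q) \<in> \<psi>"
    using \<psi>(2) diag[OF S_fst, of p] diag[OF S_fst, of q] assms by (auto simp: \<gamma>_def)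
  then have "((fst p, fst p), (fst q, fst q)) \<in> \<psi>" using tct_con_trans[OF \<psi>(1)] by blast
  then have "\<theta> \<subseteq> \<psi>" using con_above_\<delta>(1)[OF \<psi>(1) _ _ pq(3) assms(2)] \<psi>(2) by blast
  then show "((x, y), (z, w)) \<in> \<psi>" using xy by blast
qed

end

section \<open>A minimal set of \<delta> and \<theta> lying over \<open>U\<close>\<close>

context diagonal_subpower
begin

lemma prime_quotient_S: "prime_quotient S SF \<delta> \<theta>"
  using algS finS \<delta>_covered by unfold_locales (auto simp: finite_algebra_def)

text \<open>First coordinates in \<open>U\<close> are kept so that the image of \<open>P\<close>
  projects onto \<open>U\<close>; N \<times> N is preserved so that the image has a trace projecting
  onto \<open>N\<close>.\<close>

definition good where
  "good P \<longleftrightarrow> upol S SF P \<and> (\<forall>p\<in>S. P (P p) = P p) \<and> P ` S \<subseteq> U \<times> U \<and>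
    (\<forall>p\<in>S. fst p \<in> U \<longrightarrow> fst (P p) = fst p) \<and> (\<forall>p\<in>S. p \<in> N \<times> N \<longrightarrow> P p \<in> N \<times> N)"

lemma good_exists: "\<exists>P. good P"
proof -
  have "upol S SF (\<lambda>p. (e (fst p), e (snd p)))" by (rule SP_diag[OF e(1)])
  moreover have "e x \<in> N" if "x \<in> N" for x using that e(3) NU by simp
  ultimately show ?thesis unfolding good_def
    by (intro exI[of _ "\<lambda>p. (e (fst p), e (snd p))"]) (use e S_fst S_snd in force)
qed

text \<open>The good polynomial is built to factor through \<open>Q\<close>, which bounds the size of its image.\<close>

lemma good_factors:
  assumes Q: "upol S SF Q" "\<And>p. p \<in> S \<Longrightarrow> Q (Q p) = Q p" "Q ` S \<subseteq> U \<times> U"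
    and pq: "p \<in> Q ` S" "q \<in> Q ` S" "(p, q) \<in> \<theta>" "(p, q) \<notin> \<delta>"
  shows "\<exists>P. good P \<and> card (P ` S) \<le> card (Q ` S)"
proof -
  interpret S: prime_quotient S SF \<delta> \<theta> by (rule prime_quotient_S)
  have Qfix: "Q p = p" "Q q = q" using pq Q(2) by auto
  let ?a = "(a, a)" and ?b = "(b, b)"
  have aS: "?a \<in> S" "?b \<in> S" using diag aA bA by auto
  have ab\<delta>: "(?a, ?b) \<notin> \<delta>" using \<delta>_on_\<beta>[of ?a ?b] \<beta>_refl[OF aA] ab by auto
  \<comment> \<open>\<open>Q\<close> separates (p, q) modulo \<delta>, so by
    \<open>separation\<close> in \<open>S\<close> some \<open>G\<close> makes it separate the images
    of (a, a) and (b, b).\<close>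
  obtain G where G: "upol S SF G" "(Q (G ?a), Q (G ?b)) \<notin> \<delta>"
    using S.separation[OF Q(1) pq(3) _ ab\<theta> ab\<delta>] Qfix pq(4) by auto
  define J where "J = (\<lambda>p. Q (G p))"
  have J: "upol S SF J" "(J ?a, J ?b) \<notin> \<delta>" using SP_o[OF Q(1) G(1)] G by (auto simp: J_def)
  have JS: "J p \<in> Q ` S" if "p \<in> S" for p using SP_in[OF G(1) that] by (auto simp: J_def)
  have J\<theta>: "(J ?a, J ?b) \<in> \<theta>" using upol_con[OF algS con_\<theta> J(1) ab\<theta>] .
  \<comment> \<open>By the definition of \<delta>, \<open>R\<close> brings the pair into S \<inter>
    \<beta> with first coordinates not \<alpha>-related; \<open>h\<close> will move the coordinates
    into \<open>U\<close> and keep this.\<close>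
  then obtain R where R: "upol S SF R" "R (J ?a) \<in> \<beta>" "(fst (R (J ?a)), fst (R (J ?b))) \<notin> \<alpha>"
    using J(2) \<theta>_sub[OF J\<theta>] unfolding \<delta>_def by blast
  have RJ: "R (J ?a) \<in> S" "R (J ?b) \<in> S" using SP_in[OF R(1)] SP_in[OF J(1)] aS by auto
  have RJ\<beta>: "(fst (R (J ?a)), fst (R (J ?b))) \<in> \<beta>"
    using SP_fst_con[OF R(1) _ _ con_\<beta>] \<theta>_sub[OF J\<theta>] by blast
  obtain h where h: "upol A F h" "h ` A = U" "(h (fst (R (J ?a))), h (fst (R (J ?b)))) \<notin> \<alpha>"
    using separation_U[OF RJ\<beta> R(3)] by blast
  let ?h = "\<lambda>p. (h (fst p), h (snd p))"
  define K where "K = (\<lambda>p. ?h (R (J p)))"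
  have K: "upol S SF K" unfolding K_def using SP_o[OF SP_diag[OF h(1)] SP_o[OF R(1) J(1)]] .
  have KU: "K p \<in> U \<times> U" if "p \<in> S" for p
  proof -
    have "R (J p) \<in> S" using that SP_in[OF R(1)] SP_in[OF J(1)] by auto
    then show ?thesis using S_fst[of "R (J p)"] S_snd[of "R (J p)"] h(2) by (auto simp: K_def)
  qed
  have Ka: "K ?a \<in> \<beta>" using \<beta>_pol[OF h(1)] R(2) by (cases "R (J ?a)") (auto simp: K_def)
  obtain k where k: "upol A F k" "\<forall>p\<in>S. fst (K p) = k (fst p)" using SP_fst[OF K] by blast
  have kU: "k ` U \<subseteq> U"
  proof
    fix y assume "y \<in> k ` U"
    then obtain x where "x \<in> U" "y = k x" by auto
    then show "y \<in> U" using k(2) diag[of x] KU[of "(x, x)"] UA by fastforce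
  qed
  have kab: "(k a, k b) \<notin> \<alpha>" using k(2) aS h(3) by (auto simp: K_def)
  \<comment> \<open>The first coordinate \<open>k\<close> of \<open>K\<close> permutes
    \<open>U\<close>; applying its inverse to both coordinates makes \<open>L\<close> fix first
    coordinates in \<open>U\<close>.\<close>
  obtain k' where k': "upol A F k'" "k' ` A \<subseteq> U" "\<forall>x\<in>U. k' (k x) = x \<and> k (k' x) = x"
    using inverse_pol[OF k(1) kU aU bU ab\<beta> kab] by blast
  let ?k' = "\<lambda>p. (k' (fst p), k' (snd p))"
  define L where "L = (\<lambda>p. ?k' (K p))"
  have L: "upol S SF L" unfolding L_def using SP_o[OF SP_diag[OF k'(1)] K] .
  have LU: "L p \<in> U \<times> U" if "p \<in> S" for p
    using k'(2) KU[OF that] UA by (auto simp: L_def mem_Times_iff image_subset_iff)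
  have Lfst: "fst (L p) = fst p" if "p \<in> S" "fst p \<in> U" for p using that k' k by (simp add: L_def)
  have La: "L ?a \<in> \<beta>" using \<beta>_pol[OF k'(1)] Ka by (cases "K ?a") (auto simp: L_def)
  \<comment> \<open>\<open>L (a, a)\<close> is a pair of \<beta> with first coordinate
    \<open>a\<close>, so its second coordinate is \<beta>-related to \<open>a\<close>; the same
    follows for the second coordinates of all values of \<open>L\<close> on N \<times> N.\<close>
  have LN: "L p \<in> N \<times> N" if p: "p \<in> S" "p \<in> N \<times> N" for p
  proof -
    have f: "fst (L p) \<in> N" using Lfst[OF p(1)] p(2) NU by auto
    have "fst (L ?a) = a" using Lfst[OF aS(1)] aU by simp
    then have "(a, snd (L ?a)) \<in> \<beta>" using La by (metis prod.collapse)
    moreover have "(snd (L ?a), snd (L p)) \<in> \<beta>"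
      using SP_snd_con[OF L aS(1) p(1) con_\<beta>] p(2) N\<beta>[OF aN] by auto
    ultimately have "snd (L p) \<in> N" using N_closed[OF aN] \<beta>_trans LU[OF p(1)] by (metis mem_Times_iff)
    then show ?thesis using f by (simp add: mem_Times_iff)
  qed
  define m where "m = (fact (card S) - 1 :: nat)"
  have m: "fact (card S) = Suc m" unfolding m_def by (metis Suc_pred' fact_gt_zero)
  define P where "P = L ^^ Suc m"
  have LS: "L ` S \<subseteq> S" using SP_in[OF L] by blast
  have iter: "(L ^^ j) p \<in> S \<and> (fst p \<in> U \<longrightarrow> fst ((L ^^ j) p) = fst p) \<and> (p \<in> N \<times> N \<longrightarrow> (L ^^ j) p \<in> N \<times> N)"
    if "p \<in> S" for j p
  proof (induction j)
    case (Suc j)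
    then show ?case
      using Lfst[of "(L ^^ j) p"] LN[of "(L ^^ j) p"] SP_in[OF L, of "(L ^^ j) p"] by simp
  qed (use that in simp)
  have "good P" unfolding good_def
  proof (intro conjI ballI impI)
    show "upol S SF P" unfolding P_def by (rule upol_funpow[OF algS L])
    show "P (P p) = P p" if "p \<in> S" for p
      using funpow_fact_idem[OF finS LS that] unfolding P_def m .
    have "P p \<in> U \<times> U" if "p \<in> S" for p
      using LU[of "(L ^^ m) p"] iter[OF that, of m] by (simp add: P_def)
    then show "P ` S \<subseteq> U \<times> U" by blast
    show "fst (P p) = fst p" if "p \<in> S" "fst p \<in> U" for p using iter[OF that(1)] that unfolding P_def by blast
    show "P p \<in> N \<times> N" if "p \<in> S" "p \<in> N \<times> N" for p using iter[OF that(1)] that unfolding P_def by blast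
  qed
  moreover have "card (P ` S) \<le> card (Q ` S)"
  proof -
    \<comment> \<open>The power of \<open>L\<close> is regrouped so that \<open>J\<close>, with
      values in the image of \<open>Q\<close>, is applied first.\<close>
    let ?X = "\<lambda>p. (L ^^ m) (?k' (?h (R p)))"
    have "P p = ?X (J p)" for p by (simp add: P_def L_def K_def funpow_Suc_right del: funpow.simps)
    then have "P ` S \<subseteq> ?X ` (Q ` S)" using JS by force
    then show ?thesis using finS by (meson card_image_le card_mono finite_imageI le_trans)
  qed
  ultimately show ?thesis by blast
qed

text \<open>Take a good \<open>P\<close> with an image of least size. An idempotent image inside it
  that still separates \<delta> from \<theta> yields, by \<open>good_factors\<close>, a good
  polynomial with an image at most as large, hence it is the whole image.\<close>

lemma good_minimal_set: "\<exists>P. good P \<and> minimal_set S SF \<delta> \<theta> (P ` S)"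
proof -
  obtain P where P: "good P" and least: "\<And>Q. good Q \<Longrightarrow> card (P ` S) \<le> card (Q ` S)"
    using ex_has_least_nat[of good _ "\<lambda>P. card (P ` S)"] good_exists by blast
  have upol_P: "upol S SF P" and idem: "\<And>p. p \<in> S \<Longrightarrow> P (P p) = P p" and PU: "P ` S \<subseteq> U \<times> U"
    using P by (auto simp: good_def)
  have "minimal_set S SF \<delta> \<theta> (P ` S)"
    unfolding minimal_set_def
  proof (intro conjI allI impI)
    obtain p where p: "tct_pol S SF 1 p" "\<forall>x\<in>S. P x = p [x]" using upol_P by (auto simp: upol_def)
    then show "idem_image S SF (P ` S)"
      unfolding idem_image_def using idem SP_in[OF upol_P] by (intro exI[of _ p]) auto
    have S: "(a, a) \<in> S" "(b, b) \<in> S" using diag aA bA by auto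
    then have "P (a, a) \<in> N \<times> N" "fst (P (a, a)) = a" "fst (P (b, b)) = b"
      using P aN bN aU bU by (auto simp: good_def)
    then have "(P (a, a), P (b, b)) \<notin> \<delta>"
      using \<delta>_on_\<beta>[of "P (a, a)" "P (b, b)"] N\<beta> ab by (metis mem_Times_iff prod.collapse)
    moreover have "(P (a, a), P (b, b)) \<in> \<theta>" using upol_con[OF algS con_\<theta> upol_P ab\<theta>] .
    ultimately show "restr \<delta> (P ` S) \<noteq> restr \<theta> (P ` S)" using S by (auto simp: restr_def)
  next
    fix W assume W: "idem_image S SF W \<and> restr \<delta> W \<noteq> restr \<theta> W \<and> W \<subseteq> P ` S"
    then obtain w where w: "tct_pol S SF 1 w" "\<forall>x\<in>S. w [w [x]] = w [x]" "W = (\<lambda>x. w [x]) ` S"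
      unfolding idem_image_def by blast
    let ?Q = "\<lambda>x. w [x]"
    have Q: "upol S SF ?Q" using w by (auto simp: upol_def)
    obtain p q where pq: "p \<in> W" "q \<in> W" "(p, q) \<in> \<theta>" "(p, q) \<notin> \<delta>"
      using W \<delta>\<theta> unfolding restr_def by blast
    have "?Q ` S \<subseteq> U \<times> U" using W w PU by blast
    then obtain R where "good R" "card (R ` S) \<le> card W"
      using good_factors[OF Q _ _ _ _ pq(3,4)] w pq by blast
    then have "card (P ` S) \<le> card W" using least le_trans by blast
    then show "W = P ` S" using W finS by (meson card_seteq finite_imageI)
  qed
  then show ?thesis using P by blast
qed

end

section \<open>Transport of the type along a bijection\<close>

text \<open>Operations carry no symbols here, so a counterpart is any operation of the same arity
  that agrees along \<phi> on lists over \<open>M\<close>.\<close>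

definition ops_map :: "('b \<Rightarrow> 'c) \<Rightarrow> 'b set \<Rightarrow> 'b ops \<Rightarrow> 'c ops \<Rightarrow> bool" where
  "ops_map \<phi> M G G' \<longleftrightarrow> (\<forall>(n, g) \<in> G. \<exists>g'. (n, g') \<in> G' \<and>
     (\<forall>xs \<in> tuples M n. g xs \<in> M \<and> \<phi> (g xs) = g' (map \<phi> xs)))"

lemma ops_mapD:
  "ops_map \<phi> M G G' \<Longrightarrow> (n, g) \<in> G \<Longrightarrow>
    \<exists>g'. (n, g') \<in> G' \<and> (\<forall>xs \<in> tuples M n. g xs \<in> M \<and> \<phi> (g xs) = g' (map \<phi> xs))"
  unfolding ops_map_def by blast

lemma tct_pol_ops_map:
  assumes G: "ops_map \<phi> M G G'" and \<phi>: "\<phi> ` M \<subseteq> M'" and p: "tct_pol M G n p"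
  shows "\<exists>p'. tct_pol M' G' n p' \<and> (\<forall>xs \<in> tuples M n. p xs \<in> M \<and> \<phi> (p xs) = p' (map \<phi> xs))"
  using p
proof induction
  case (proj i n)
  then show ?case by (intro exI[of _ "\<lambda>xs. xs ! i"]) (auto simp: tuples_def intro: tct_pol.proj)
next
  case (const c n)
  then show ?case using \<phi> by (intro exI[of _ "\<lambda>_. \<phi> c"]) (auto intro: tct_pol.const)
next
  case (comp k f ps n)
  obtain f' where f': "(k, f') \<in> G'" "\<forall>xs \<in> tuples M k. f xs \<in> M \<and> \<phi> (f xs) = f' (map \<phi> xs)"
    using ops_mapD[OF G comp(1)] by blast
  obtain Q where Q: "\<forall>p\<in>set ps. tct_pol M' G' n (Q p) \<and>
      (\<forall>xs\<in>tuples M n. p xs \<in> M \<and> \<phi> (p xs) = Q p (map \<phi> xs))"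
    using comp(3) by metis
  have "tct_pol M' G' n (\<lambda>xs. f' (map (\<lambda>p. p xs) (map Q ps)))"
    using comp f' Q by (intro tct_pol.comp) auto
  moreover have "f (map (\<lambda>p. p xs) ps) \<in> M \<and>
      \<phi> (f (map (\<lambda>p. p xs) ps)) = f' (map (\<lambda>p. p (map \<phi> xs)) (map Q ps))" if "xs \<in> tuples M n" for xs
  proof -
    have "map (\<lambda>p. p xs) ps \<in> tuples M k" using Q comp(2) that by (auto simp: tuples_def)
    moreover have "map \<phi> (map (\<lambda>p. p xs) ps) = map (\<lambda>p. p (map \<phi> xs)) (map Q ps)"
      using Q that by auto
    ultimately show ?thesis using f'(2) by metis
  qed
  ultimately show ?case by (intro exI[of _ "\<lambda>xs. f' (map (\<lambda>p. p xs) (map Q ps))"]) blast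
qed

text \<open>The two correspondences of operations need not be inverse to each other, since
  operations may differ outside lists over the carriers.\<close>

definition ops_iso :: "('b \<Rightarrow> 'c) \<Rightarrow> ('c \<Rightarrow> 'b) \<Rightarrow> 'b set \<Rightarrow> 'b ops \<Rightarrow> 'c set \<Rightarrow> 'c ops \<Rightarrow> bool" where
  "ops_iso \<phi> \<psi> M G M' G' \<longleftrightarrow> ops_map \<phi> M G G' \<and> ops_map \<psi> M' G' G"

locale set_bij =
  fixes \<phi> :: "'b \<Rightarrow> 'c" and \<psi> :: "'c \<Rightarrow> 'b" and M :: "'b set" and M' :: "'c set"
  assumes \<phi>: "x \<in> M \<Longrightarrow> \<phi> x \<in> M'" and \<psi>: "y \<in> M' \<Longrightarrow> \<psi> y \<in> M"
    and \<psi>\<phi>: "x \<in> M \<Longrightarrow> \<psi> (\<phi> x) = x" and \<phi>\<psi>: "y \<in> M' \<Longrightarrow> \<phi> (\<psi> y) = y"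
begin

text \<open>Carry \<open>p'\<close> to \<open>M\<close> by \<psi>, replace it there by a polynomial
  over \<open>H\<close>, and carry that back by \<phi>.\<close>

lemma pol_transfer:
  assumes "ops_map \<psi> M' G' G" "ops_map \<phi> M H H'"
    and eq: "\<And>n p. tct_pol M G n p \<Longrightarrow> \<exists>q. tct_pol M H n q \<and> agree_on M n p q"
    and p': "tct_pol M' G' n p'"
  shows "\<exists>q. tct_pol M' H' n q \<and> agree_on M' n p' q"
proof -
  have im: "\<phi> ` M \<subseteq> M'" "\<psi> ` M' \<subseteq> M" using \<phi> \<psi> by auto
  obtain p where p: "tct_pol M G n p" "\<forall>xs \<in> tuples M' n. p' xs \<in> M' \<and> \<psi> (p' xs) = p (map \<psi> xs)"
    using tct_pol_ops_map[OF assms(1) im(2) p'] by blast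
  obtain q where q: "tct_pol M H n q" "agree_on M n p q" using eq p by blast
  obtain q' where q': "tct_pol M' H' n q'" "\<forall>xs \<in> tuples M n. q xs \<in> M \<and> \<phi> (q xs) = q' (map \<phi> xs)"
    using tct_pol_ops_map[OF assms(2) im(1) q(1)] by blast
  have "p' ys = q' ys" if ys: "ys \<in> tuples M' n" for ys
  proof -
    have t: "map \<psi> ys \<in> tuples M n" using tuples_map[OF ys im(2)] .
    have "map \<phi> (map \<psi> ys) = ys" using ys \<phi>\<psi> by (auto simp: tuples_def intro!: map_idI)
    then have "q' ys = \<phi> (q (map \<psi> ys))" using q' t by metis
    also have "\<dots> = \<phi> (p (map \<psi> ys))" using q(2) t by (simp add: agree_on_def)
    also have "\<dots> = p' ys" using p(2) ys \<phi>\<psi> by metis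
    finally show ?thesis by simp
  qed
  then show ?thesis using q' by (auto simp: agree_on_def)
qed

lemma image_\<phi>: "\<phi> ` M = M'"
proof
  show "M' \<subseteq> \<phi> ` M" using \<psi> \<phi>\<psi> by (metis image_eqI subsetI)
qed (use \<phi> in blast)

lemma poly_equiv_transfer:
  assumes "ops_iso \<phi> \<psi> M G M' G'" "ops_iso \<phi> \<psi> M H M' H'" "poly_equiv M G H"
  shows "poly_equiv M' G' H'"
  unfolding poly_equiv_def
proof (intro conjI allI impI)
  show "\<exists>q. tct_pol M' H' n q \<and> agree_on M' n p q" if "tct_pol M' G' n p" for n p
    by (rule pol_transfer[OF _ _ _ that]) (use assms in \<open>auto simp: ops_iso_def poly_equiv_def\<close>)
  show "\<exists>q. tct_pol M' G' n q \<and> agree_on M' n p q" if "tct_pol M' H' n p" for n p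
    by (rule pol_transfer[OF _ _ _ that]) (use assms in \<open>auto simp: ops_iso_def poly_equiv_def\<close>)
qed

lemma ops_iso_unary:
  assumes "\<forall>(n, h) \<in> H. n = 1 \<and> bij_betw (\<lambda>x. h [x]) M M"
  defines "H' \<equiv> {(1, \<lambda>ys. \<phi> (h (map \<psi> ys))) | h. (1, h) \<in> H}"
  shows "ops_iso \<phi> \<psi> M H M' H'" and "\<forall>(n, h) \<in> H'. n = 1 \<and> bij_betw (\<lambda>x. h [x]) M' M'"
proof -
  have H: "h [x] \<in> M" if "(1, h) \<in> H" "x \<in> M" for h x
    using assms(1) that by (fastforce simp: bij_betw_def)
  have H1: "n = 1" if "(n, h) \<in> H" for n h using assms(1) that by blast
  show "ops_iso \<phi> \<psi> M H M' H'"
    unfolding ops_iso_def ops_map_def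
  proof (intro conjI ballI, clarify)
    fix n h assume h: "(n, h) \<in> H"
    then have n: "n = 1" by (rule H1)
    show "\<exists>g'. (n, g') \<in> H' \<and> (\<forall>xs\<in>tuples M n. h xs \<in> M \<and> \<phi> (h xs) = g' (map \<phi> xs))"
      by (rule exI[of _ "\<lambda>ys. \<phi> (h (map \<psi> ys))"])
        (use h n H in \<open>auto simp: H'_def tuples_1 \<psi>\<phi>\<close>)
  next
    fix x assume "x \<in> H'"
    then obtain h where h: "x = (1, \<lambda>ys. \<phi> (h (map \<psi> ys)))" "(1, h) \<in> H" by (auto simp: H'_def)
    show "case x of (n, g) \<Rightarrow> \<exists>g'. (n, g') \<in> H \<and> (\<forall>xs\<in>tuples M' n. g xs \<in> M' \<and> \<psi> (g xs) = g' (map \<psi> xs))"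
      unfolding h(1) prod.case
      by (rule exI[of _ h]) (use h H in \<open>auto simp: tuples_1 \<psi>\<phi> \<phi> \<psi>\<close>)
  qed
  have "bij_betw (\<lambda>y. \<phi> (h [\<psi> y])) M' M'" if "(1, h) \<in> H" for h
  proof -
    have "bij_betw \<psi> M' M" "bij_betw \<phi> M M'"
      by (rule bij_betw_byWitness[where f'=\<phi>], auto simp: \<phi> \<psi> \<phi>\<psi> \<psi>\<phi>)
        (rule bij_betw_byWitness[where f'=\<psi>], auto simp: \<phi> \<psi> \<phi>\<psi> \<psi>\<phi>)
    moreover have "bij_betw (\<lambda>x. h [x]) M M" using assms(1) that by blast
    ultimately have "bij_betw (\<phi> \<circ> ((\<lambda>x. h [x]) \<circ> \<psi>)) M' M'" by (blast intro: bij_betw_trans)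
    then show ?thesis by (simp add: comp_def)
  qed
  then show "\<forall>(n, h) \<in> H'. n = 1 \<and> bij_betw (\<lambda>x. h [x]) M' M'" by (auto simp: H'_def)
qed

lemma ops_iso_two:
  assumes "M = {a, b}" "a \<noteq> b"
  shows "ops_iso \<phi> \<psi> M {(2, meet2 a b), (2, join2 a b), (1, compl2 a b)}
      M' {(2, meet2 (\<phi> a) (\<phi> b)), (2, join2 (\<phi> a) (\<phi> b)), (1, compl2 (\<phi> a) (\<phi> b))}"
    and "ops_iso \<phi> \<psi> M {(2, meet2 a b), (2, join2 a b)}
      M' {(2, meet2 (\<phi> a) (\<phi> b)), (2, join2 (\<phi> a) (\<phi> b))}"
    and "ops_iso \<phi> \<psi> M {(2, meet2 a b)} M' {(2, meet2 (\<phi> a) (\<phi> b))}"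
    and "M' = {\<phi> a, \<phi> b}" and "\<phi> a \<noteq> \<phi> b"
proof -
  have in_M: "a \<in> M" "b \<in> M" using assms by auto
  show M': "M' = {\<phi> a, \<phi> b}" using image_\<phi> assms(1) by auto
  show neq: "\<phi> a \<noteq> \<phi> b" using \<psi>\<phi> in_M assms(2) by metis
  have meet: "\<forall>xs\<in>tuples M 2. meet2 a b xs \<in> M \<and> \<phi> (meet2 a b xs) = meet2 (\<phi> a) (\<phi> b) (map \<phi> xs)"
    "\<forall>xs\<in>tuples M' 2. meet2 (\<phi> a) (\<phi> b) xs \<in> M' \<and> \<psi> (meet2 (\<phi> a) (\<phi> b) xs) = meet2 a b (map \<psi> xs)"
    using neq assms \<psi>\<phi>[OF in_M(1)] \<psi>\<phi>[OF in_M(2)] by (simp_all add: ball_tuples_2 M' meet2_def)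
  have join: "\<forall>xs\<in>tuples M 2. join2 a b xs \<in> M \<and> \<phi> (join2 a b xs) = join2 (\<phi> a) (\<phi> b) (map \<phi> xs)"
    "\<forall>xs\<in>tuples M' 2. join2 (\<phi> a) (\<phi> b) xs \<in> M' \<and> \<psi> (join2 (\<phi> a) (\<phi> b) xs) = join2 a b (map \<psi> xs)"
    using neq assms \<psi>\<phi>[OF in_M(1)] \<psi>\<phi>[OF in_M(2)] by (simp_all add: ball_tuples_2 M' join2_def)
  have compl: "\<forall>xs\<in>tuples M 1. compl2 a b xs \<in> M \<and> \<phi> (compl2 a b xs) = compl2 (\<phi> a) (\<phi> b) (map \<phi> xs)"
    "\<forall>xs\<in>tuples M' 1. compl2 (\<phi> a) (\<phi> b) xs \<in> M' \<and> \<psi> (compl2 (\<phi> a) (\<phi> b) xs) = compl2 a b (map \<psi> xs)"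
    using neq assms \<psi>\<phi>[OF in_M(1)] \<psi>\<phi>[OF in_M(2)] by (simp_all add: ball_tuples_1 M' compl2_def)
  show "ops_iso \<phi> \<psi> M {(2, meet2 a b), (2, join2 a b), (1, compl2 a b)}
      M' {(2, meet2 (\<phi> a) (\<phi> b)), (2, join2 (\<phi> a) (\<phi> b)), (1, compl2 (\<phi> a) (\<phi> b))}"
    "ops_iso \<phi> \<psi> M {(2, meet2 a b), (2, join2 a b)}
      M' {(2, meet2 (\<phi> a) (\<phi> b)), (2, join2 (\<phi> a) (\<phi> b))}"
    "ops_iso \<phi> \<psi> M {(2, meet2 a b)} M' {(2, meet2 (\<phi> a) (\<phi> b))}"
    unfolding ops_iso_def ops_map_def using meet join compl by blast+
qed

end

text \<open>A module record extends a ring record, so \<open>mult\<close> and \<open>one\<close>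
  must be filled with something although vectors carry no product.\<close>

definition transport_module :: "('s \<Rightarrow> 't) \<Rightarrow> ('b \<Rightarrow> 'c) \<Rightarrow> ('c \<Rightarrow> 'b) \<Rightarrow> 's ring \<Rightarrow> ('s, 'b) module \<Rightarrow> ('t, 'c) module" where
  "transport_module \<iota> \<phi> \<psi> R V = \<lparr>carrier = \<phi> ` carrier V, mult = (\<lambda>x y. x), one = \<phi> \<zero>\<^bsub>V\<^esub>,
     zero = \<phi> \<zero>\<^bsub>V\<^esub>, add = (\<lambda>x y. \<phi> (\<psi> x \<oplus>\<^bsub>V\<^esub> \<psi> y)),
     smult = (\<lambda>r x. \<phi> (inv_into (carrier R) \<iota> r \<odot>\<^bsub>V\<^esub> \<psi> x))\<rparr>"

lemma (in set_bij) vector_space_transfer: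
  fixes R :: "'s ring" and V :: "('s, 'b) module" and \<iota> :: "'s \<Rightarrow> 't"
  assumes "field R" "module R V" "carrier V = M" and \<iota>: "inj_on \<iota> (carrier R)"
  defines "R' \<equiv> image_ring \<iota> R" and "V' \<equiv> transport_module \<iota> \<phi> \<psi> R V"
  shows "field R'" "module R' V'" "carrier V' = M'" "carrier R' = \<iota> ` carrier R"
    "ops_iso \<phi> \<psi> M (vs_ops R V) M' (vs_ops R' V')"
proof -
  interpret R: field R by fact
  interpret V: module R V by fact
  let ?\<kappa> = "inv_into (carrier R) \<iota>"
  have \<kappa>: "?\<kappa> (\<iota> r) = r" if "r \<in> carrier R" for r using \<iota> that by simp
  have cV[simp]: "carrier V = M" by fact
  show fR': "field R'" unfolding R'_def by (rule R.inj_imp_image_ring_is_field[OF \<iota>])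
  show cR': "carrier R' = \<iota> ` carrier R" unfolding R'_def by (rule image_ring_carrier)
  have hom: "\<iota> \<in> ring_hom R R'"
    using inj_imp_image_ring_iso[OF \<iota>] unfolding R'_def ring_iso_def by blast
  have add_R': "\<iota> r \<oplus>\<^bsub>R'\<^esub> \<iota> s = \<iota> (r \<oplus>\<^bsub>R\<^esub> s)" if "r \<in> carrier R" "s \<in> carrier R" for r s
    using ring_hom_add[OF hom that] by simp
  have mult_R': "\<iota> r \<otimes>\<^bsub>R'\<^esub> \<iota> s = \<iota> (r \<otimes>\<^bsub>R\<^esub> s)" if "r \<in> carrier R" "s \<in> carrier R" for r s
    using ring_hom_mult[OF hom that] by simp
  have one_R': "\<one>\<^bsub>R'\<^esub> = \<iota> \<one>\<^bsub>R\<^esub>" using ring_hom_one[OF hom] by simp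
  show cV': "carrier V' = M'" using image_\<phi> by (simp add: V'_def transport_module_def)
  have add_V': "x \<oplus>\<^bsub>V'\<^esub> y = \<phi> (\<psi> x \<oplus>\<^bsub>V\<^esub> \<psi> y)" for x y by (simp add: V'_def transport_module_def)
  have zero_V': "\<zero>\<^bsub>V'\<^esub> = \<phi> \<zero>\<^bsub>V\<^esub>" by (simp add: V'_def transport_module_def)
  have smult_V': "\<iota> r \<odot>\<^bsub>V'\<^esub> x = \<phi> (r \<odot>\<^bsub>V\<^esub> \<psi> x)" if "r \<in> carrier R" for r x
    using \<kappa>[OF that] by (simp add: V'_def transport_module_def)
  have cl: "x \<in> M \<Longrightarrow> y \<in> M \<Longrightarrow> x \<oplus>\<^bsub>V\<^esub> y \<in> M" "x \<in> M \<Longrightarrow> \<ominus>\<^bsub>V\<^esub> x \<in> M" for x y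
    using V.M.add.m_closed[of x y] V.M.a_inv_closed[of x] by auto
  have z: "\<zero>\<^bsub>V\<^esub> \<in> M" using V.M.zero_closed by simp
  have scl: "r \<odot>\<^bsub>V\<^esub> x \<in> M" if "r \<in> carrier R" "x \<in> M" for r x using V.smult_closed[of r x] that by simp
  have grp: "abelian_group V'"
  proof (rule abelian_groupI, unfold cV' add_V' zero_V')
    show "\<phi> (\<psi> x \<oplus>\<^bsub>V\<^esub> \<psi> y) \<in> M'" if "x \<in> M'" "y \<in> M'" for x y using that by (simp add: cl \<phi> \<psi>)
    show "\<phi> \<zero>\<^bsub>V\<^esub> \<in> M'" using z \<phi> by simp
    show "\<phi> (\<psi> (\<phi> (\<psi> x \<oplus>\<^bsub>V\<^esub> \<psi> y)) \<oplus>\<^bsub>V\<^esub> \<psi> w) = \<phi> (\<psi> x \<oplus>\<^bsub>V\<^esub> \<psi> (\<phi> (\<psi> y \<oplus>\<^bsub>V\<^esub> \<psi> w)))"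
      if "x \<in> M'" "y \<in> M'" "w \<in> M'" for x y w
      using that V.M.a_assoc[of "\<psi> x" "\<psi> y" "\<psi> w"] by (simp add: cl \<psi> \<psi>\<phi>)
    show "\<phi> (\<psi> x \<oplus>\<^bsub>V\<^esub> \<psi> y) = \<phi> (\<psi> y \<oplus>\<^bsub>V\<^esub> \<psi> x)" if "x \<in> M'" "y \<in> M'" for x y
      using that V.M.a_comm[of "\<psi> x" "\<psi> y"] by (simp add: \<psi>)
    show "\<phi> (\<psi> (\<phi> \<zero>\<^bsub>V\<^esub>) \<oplus>\<^bsub>V\<^esub> \<psi> x) = x" if "x \<in> M'" for x
      using that V.M.l_zero[of "\<psi> x"] z by (simp add: \<psi> \<psi>\<phi> \<phi>\<psi>)
    show "\<exists>y\<in>M'. \<phi> (\<psi> y \<oplus>\<^bsub>V\<^esub> \<psi> x) = \<phi> \<zero>\<^bsub>V\<^esub>" if "x \<in> M'" for x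
      using that V.M.l_neg[of "\<psi> x"] cl by (intro bexI[of _ "\<phi> (\<ominus>\<^bsub>V\<^esub> \<psi> x)"]) (simp_all add: \<psi> \<psi>\<phi> \<phi>)
  qed
  have neg_V': "\<ominus>\<^bsub>V'\<^esub> x = \<phi> (\<ominus>\<^bsub>V\<^esub> \<psi> x)" if "x \<in> M'" for x
  proof -
    interpret V': abelian_group V' by (rule grp)
    show ?thesis
      using that V.M.l_neg[of "\<psi> x"] cl
      by (intro V'.minus_equality) (simp_all add: cV' add_V' zero_V' \<psi> \<psi>\<phi> \<phi>)
  qed
  show "module R' V'"
  proof (rule moduleI)
    show "cring R'" using fR' by (rule fieldE(1))
    show "abelian_group V'" by (rule grp)
  qed (auto simp: cR' cV' add_R' mult_R' one_R' smult_V' add_V' scl cl \<phi> \<psi> \<psi>\<phi> \<phi>\<psi>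
      V.smult_l_distr V.smult_r_distr V.smult_assoc1 V.smult_one)
  show "ops_iso \<phi> \<psi> M (vs_ops R V) M' (vs_ops R' V')"
    unfolding ops_iso_def
  proof
    show "ops_map \<phi> M (vs_ops R V) (vs_ops R' V')" unfolding ops_map_def
    proof (clarify)
      fix n g assume g: "(n, g) \<in> vs_ops R V"
      have sm: "\<And>r. r \<in> carrier R \<Longrightarrow> (1, \<lambda>xs. \<iota> r \<odot>\<^bsub>V'\<^esub> (xs ! 0)) \<in> vs_ops R' V'"
        by (auto simp: vs_ops_def cR')
      have oth: "(2, \<lambda>xs. xs ! 0 \<oplus>\<^bsub>V'\<^esub> xs ! 1) \<in> vs_ops R' V'" "(1, \<lambda>xs. \<ominus>\<^bsub>V'\<^esub> (xs ! 0)) \<in> vs_ops R' V'"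
        "(0, \<lambda>_. \<zero>\<^bsub>V'\<^esub>) \<in> vs_ops R' V'" by (auto simp: vs_ops_def)
      from g consider (a) "n = 2" "g = (\<lambda>xs. xs ! 0 \<oplus>\<^bsub>V\<^esub> xs ! 1)" | (m) "n = 1" "g = (\<lambda>xs. \<ominus>\<^bsub>V\<^esub> (xs ! 0))"
        | (z) "n = 0" "g = (\<lambda>_. \<zero>\<^bsub>V\<^esub>)" | (s) r where "r \<in> carrier R" "n = 1" "g = (\<lambda>xs. r \<odot>\<^bsub>V\<^esub> (xs ! 0))"
        by (auto simp: vs_ops_def)
      then show "\<exists>g'. (n, g') \<in> vs_ops R' V' \<and> (\<forall>xs\<in>tuples M n. g xs \<in> M \<and> \<phi> (g xs) = g' (map \<phi> xs))"
      proof cases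
        case a then show ?thesis using oth(1) by (intro exI[of _ "\<lambda>xs. xs ! 0 \<oplus>\<^bsub>V'\<^esub> xs ! 1"])
            (auto simp: tuples_2 cl add_V' \<psi>\<phi>)
      next
        case m then show ?thesis using oth(2) by (intro exI[of _ "\<lambda>xs. \<ominus>\<^bsub>V'\<^esub> (xs ! 0)"])
            (auto simp: tuples_1 cl neg_V' \<psi>\<phi> \<phi>)
      next
        case z then show ?thesis using oth(3) \<open>\<zero>\<^bsub>V\<^esub> \<in> M\<close> by (intro exI[of _ "\<lambda>_. \<zero>\<^bsub>V'\<^esub>"])
            (auto simp: zero_V')
      next
        case (s r) then show ?thesis using sm[of r] by (intro exI[of _ "\<lambda>xs. \<iota> r \<odot>\<^bsub>V'\<^esub> (xs ! 0)"])
            (auto simp: tuples_1 scl smult_V' \<psi>\<phi>)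
      qed
    qed
    show "ops_map \<psi> M' (vs_ops R' V') (vs_ops R V)" unfolding ops_map_def
    proof (clarify)
      fix n g assume g: "(n, g) \<in> vs_ops R' V'"
      have sm: "\<And>r. r \<in> carrier R \<Longrightarrow> (1, \<lambda>xs. r \<odot>\<^bsub>V\<^esub> (xs ! 0)) \<in> vs_ops R V"
        by (auto simp: vs_ops_def)
      have oth: "(2, \<lambda>xs. xs ! 0 \<oplus>\<^bsub>V\<^esub> xs ! 1) \<in> vs_ops R V" "(1, \<lambda>xs. \<ominus>\<^bsub>V\<^esub> (xs ! 0)) \<in> vs_ops R V"
        "(0, \<lambda>_. \<zero>\<^bsub>V\<^esub>) \<in> vs_ops R V" by (auto simp: vs_ops_def)
      from g consider (a) "n = 2" "g = (\<lambda>xs. xs ! 0 \<oplus>\<^bsub>V'\<^esub> xs ! 1)" | (m) "n = 1" "g = (\<lambda>xs. \<ominus>\<^bsub>V'\<^esub> (xs ! 0))"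
        | (z) "n = 0" "g = (\<lambda>_. \<zero>\<^bsub>V'\<^esub>)" | (s) r where "r \<in> carrier R" "n = 1" "g = (\<lambda>xs. \<iota> r \<odot>\<^bsub>V'\<^esub> (xs ! 0))"
        by (auto simp: vs_ops_def cR')
      then show "\<exists>g'. (n, g') \<in> vs_ops R V \<and> (\<forall>xs\<in>tuples M' n. g xs \<in> M' \<and> \<psi> (g xs) = g' (map \<psi> xs))"
      proof cases
        case a then show ?thesis using oth(1) by (intro exI[of _ "\<lambda>xs. xs ! 0 \<oplus>\<^bsub>V\<^esub> xs ! 1"])
            (auto simp: tuples_2 cl add_V' \<psi>\<phi> \<phi> \<psi>)
      next
        case m then show ?thesis using oth(2) by (intro exI[of _ "\<lambda>xs. \<ominus>\<^bsub>V\<^esub> (xs ! 0)"])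
            (auto simp: tuples_1 cl neg_V' \<psi>\<phi> \<phi> \<psi>)
      next
        case z then show ?thesis using oth(3) \<open>\<zero>\<^bsub>V\<^esub> \<in> M\<close> by (intro exI[of _ "\<lambda>_. \<zero>\<^bsub>V\<^esub>"])
            (auto simp: zero_V' \<psi>\<phi> \<phi>)
      next
        case (s r) then show ?thesis using sm[of r] by (intro exI[of _ "\<lambda>xs. r \<odot>\<^bsub>V\<^esub> (xs ! 0)"])
            (auto simp: tuples_1 scl smult_V' \<psi>\<phi> \<phi> \<psi>)
      qed
    qed
  qed
qed

text \<open>The injection \<open>j\<close> only serves to move the scalars, which live in \<open>'b \<Rightarrow> 'b\<close>, to \<open>'c \<Rightarrow> 'c\<close>.\<close>

lemma (in set_bij) minalg_type_transfer:
  fixes j :: "'b \<Rightarrow> 'c"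
  assumes iso: "ops_iso \<phi> \<psi> M G M' G'" and j: "inj j" and type: "minalg_type M G i"
  shows "minalg_type M' G' i"
proof -
  note pe = poly_equiv_transfer[OF iso]
  from type consider
      (1) H where "i = 1" "\<forall>(n, h) \<in> H. n = 1 \<and> bij_betw (\<lambda>x. h [x]) M M" "poly_equiv M G H"
    | (2) R V where "i = 2" "field (R :: ('b \<Rightarrow> 'b) ring)" "finite (carrier R)"
        "module R (V :: ('b \<Rightarrow> 'b, 'b) module)" "carrier V = M" "poly_equiv M G (vs_ops R V)"
    | (3) a b where "i = 3" "a \<noteq> b" "M = {a, b}"
        "poly_equiv M G {(2, meet2 a b), (2, join2 a b), (1, compl2 a b)}"
    | (4) a b where "i = 4" "a \<noteq> b" "M = {a, b}" "poly_equiv M G {(2, meet2 a b), (2, join2 a b)}"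
    | (5) a b where "i = 5" "a \<noteq> b" "M = {a, b}" "poly_equiv M G {(2, meet2 a b)}"
    unfolding minalg_type_def by blast
  then show ?thesis
  proof cases
    case 1
    show ?thesis unfolding minalg_type_def
      by (intro disjI1 conjI exI) (rule 1(1), rule ops_iso_unary(2)[OF 1(2)],
        rule pe[OF ops_iso_unary(1)[OF 1(2)] 1(3)])
  next
    case 2
    \<comment> \<open>Conjugation by \<open>j\<close>: the value of \<iota> h at \<open>j x\<close>
      is \<open>j (h x)\<close>, which determines \<open>h\<close>.\<close>
    define \<iota> where "\<iota> = (\<lambda>(h :: 'b \<Rightarrow> 'b) y. j (h (inv_into UNIV j y)))"
    have "inj \<iota>"
    proof (rule injI, rule ext)
      fix h h' x assume "\<iota> h = \<iota> h'"
      then have "\<iota> h (j x) = \<iota> h' (j x)" by simp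
      then show "h x = h' x" using j by (simp add: \<iota>_def inj_eq)
    qed
    then have \<iota>: "inj_on \<iota> (carrier R)" by (rule inj_on_subset) simp
    note vt = vector_space_transfer[OF 2(2,4,5) \<iota>]
    have "finite (carrier (image_ring \<iota> R))" using vt(4) 2(3) by simp
    show ?thesis unfolding minalg_type_def
      by (rule disjI2, rule disjI1, intro conjI exI)
        (rule 2(1), rule vt(1), fact, rule vt(2), rule vt(3), rule pe[OF vt(5) 2(6)])
  next
    case 3
    note two = ops_iso_two[OF 3(3,2)]
    show ?thesis using two(4,5) pe[OF two(1) 3(4)] 3(1) unfolding minalg_type_def by blast
  next
    case 4
    note two = ops_iso_two[OF 4(3,2)]
    show ?thesis using two(4,5) pe[OF two(2) 4(4)] 4(1) unfolding minalg_type_def by blast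
  next
    case 5
    note two = ops_iso_two[OF 5(3,2)]
    show ?thesis using two(4,5) pe[OF two(3) 5(4)] 5(1) unfolding minalg_type_def by blast
  qed
qed

lemma min_carrier_tuples:
  assumes "Cs \<in> tuples (min_carrier \<alpha> N) n"
  shows "\<exists>xs \<in> tuples N n. Cs = map (tr_cls \<alpha> N) xs"
proof -
  have "\<forall>C \<in> set Cs. \<exists>x \<in> N. C = tr_cls \<alpha> N x" using assms by (auto simp: tuples_def min_carrier_def)
  then obtain r where r: "\<forall>C \<in> set Cs. r C \<in> N \<and> C = tr_cls \<alpha> N (r C)" by metis
  then have "map (tr_cls \<alpha> N) (map r Cs) = Cs" by (auto intro: map_idI)
  moreover have "map r Cs \<in> tuples N n" using r assms by (auto simp: tuples_def)
  ultimately show ?thesis by metis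
qed

section \<open>The type of the quotient of \<delta> and \<theta>\<close>

context diagonal_subpower
begin

text \<open>The trace \<open>M\<close> lies in N \<times> N and so inside \<beta>, where \<delta> is
  just \<alpha> read on first coordinates; x \<mapsto> P (x, x) is a section of the first projection
  from \<open>M\<close> to \<open>N\<close>. Operations of \<open>M\<close> descend to their first
  coordinates, and operations of \<open>N\<close> lift to both coordinates followed by
  \<open>P\<close>.\<close>

lemma tct_type_S:
  assumes type: "minalg_type (min_carrier \<alpha> N) (min_ops A F \<alpha> N) i"
  shows "tct_type S SF \<delta> \<theta> i"
proof -
  obtain P where good: "good P" and min: "minimal_set S SF \<delta> \<theta> (P ` S)" using good_minimal_set by blast
  define M where "M = P ` S \<inter> N \<times> N"
  have upol_P: "upol S SF P" and P_fst: "\<And>p. p \<in> S \<Longrightarrow> fst p \<in> U \<Longrightarrow> fst (P p) = fst p"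
    and P_N: "\<And>p. p \<in> S \<Longrightarrow> p \<in> N \<times> N \<Longrightarrow> P p \<in> N \<times> N" and PU: "P ` S \<subseteq> U \<times> U"
    using good unfolding good_def by blast+
  have VS: "P ` S \<subseteq> S" using SP_in[OF upol_P] by blast
  have P_M: "P p \<in> M" if "p \<in> S" "p \<in> N \<times> N" for p using P_N[OF that] that unfolding M_def by blast
  have diag_M: "P (x, x) \<in> M" "fst (P (x, x)) = x" if "x \<in> N" for x
    using P_M[of "(x, x)"] P_fst[of "(x, x)"] that diag[of x] NA NU by auto
  have M: "p \<in> S" "fst p \<in> N" "snd p \<in> N" "p \<in> \<beta>" if "p \<in> M" for p
    using that VS N\<beta>[of "fst p" "snd p"] unfolding M_def by (cases p; auto)+
  have M\<theta>: "(p, q) \<in> \<theta>" if "p \<in> M" "q \<in> M" for p q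
    using \<theta>_on_\<beta> M N\<beta> that by simp
  have M\<delta>: "(p, q) \<in> \<delta> \<longleftrightarrow> (fst p, fst q) \<in> \<alpha>" if "p \<in> M" "q \<in> M" for p q
    using \<delta>_on_\<beta>[of p q] \<delta>_contains[of p q] M N\<beta> that by auto
  have trace: "is_trace \<delta> \<theta> (P ` S) M" unfolding is_trace_def
  proof
    have aV: "P (a, a) \<in> P ` S" using diag aA by blast
    have "M = restr \<theta> (P ` S) `` {P (a, a)}"
    proof
      show "M \<subseteq> restr \<theta> (P ` S) `` {P (a, a)}"
        using M\<theta>[OF diag_M(1)[OF aN]] aV by (auto simp: restr_def M_def)
      show "restr \<theta> (P ` S) `` {P (a, a)} \<subseteq> M"
      proof
        fix p assume "p \<in> restr \<theta> (P ` S) `` {P (a, a)}"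
        then have p: "p \<in> P ` S" "(P (a, a), p) \<in> \<theta>" by (auto simp: restr_def)
        have "fst p \<in> N" "snd p \<in> N"
          using \<theta>_sub[OF p(2)] N_closed M(2,3)[OF diag_M(1)[OF aN]] p(1) PU by auto
        then show "p \<in> M" using p(1) by (simp add: M_def mem_Times_iff)
      qed
    qed
    then show "\<exists>x\<in>P ` S. M = restr \<theta> (P ` S) `` {x}" using aV by blast
    show "\<not> (\<exists>x\<in>P ` S. M = restr \<delta> (P ` S) `` {x})"
    proof
      assume "\<exists>x\<in>P ` S. M = restr \<delta> (P ` S) `` {x}"
      then obtain x where "M = restr \<delta> (P ` S) `` {x}" by blast
      then have "(x, P (a, a)) \<in> \<delta>" "(x, P (b, b)) \<in> \<delta>"
        using diag_M(1)[OF aN] diag_M(1)[OF bN] by (auto simp: restr_def)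
      then have "(P (a, a), P (b, b)) \<in> \<delta>"
        using tct_con_trans[OF con_\<delta>] tct_con_sym[OF con_\<delta>] by blast
      then show False using M\<delta> diag_M aN bN ab by simp
    qed
  qed
  define \<phi> where "\<phi> = (\<lambda>C. {p \<in> M. fst p \<in> C})"
  define \<psi> where "\<psi> = (\<lambda>D :: ('a \<times> 'a) set. fst ` D)"
  have cls: "tr_cls \<alpha> N x = {y \<in> N. (x, y) \<in> \<alpha>}" if "x \<in> N" for x
    using that by (auto simp: tr_cls_def restr_def)
  have cls': "tr_cls \<delta> M p = {q \<in> M. (fst p, fst q) \<in> \<alpha>}" if "p \<in> M" for p
    unfolding tr_cls_def restr_def using that M\<delta>[OF that] by blast
  have \<phi>_cls: "\<phi> (tr_cls \<alpha> N (fst p)) = tr_cls \<delta> M p" if "p \<in> M" for p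
    using cls[OF M(2)[OF that]] cls'[OF that] M(2) by (auto simp: \<phi>_def)
  have \<psi>_cls: "\<psi> (tr_cls \<delta> M p) = tr_cls \<alpha> N (fst p)" if "p \<in> M" for p
  proof
    show "\<psi> (tr_cls \<delta> M p) \<subseteq> tr_cls \<alpha> N (fst p)"
      unfolding \<psi>_def cls[OF M(2)[OF that]] cls'[OF that] using M(2) by auto
    show "tr_cls \<alpha> N (fst p) \<subseteq> \<psi> (tr_cls \<delta> M p)"
    proof
      fix y assume "y \<in> tr_cls \<alpha> N (fst p)"
      then have "y \<in> N" "(fst p, y) \<in> \<alpha>" using cls[OF M(2)[OF that]] by auto
      then have "P (y, y) \<in> tr_cls \<delta> M p" using cls'[OF that] diag_M[of y] by simp
      then show "y \<in> \<psi> (tr_cls \<delta> M p)" using diag_M(2)[OF \<open>y \<in> N\<close>] unfolding \<psi>_def by force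
    qed
  qed
  interpret set_bij \<phi> \<psi> "min_carrier \<alpha> N" "min_carrier \<delta> M"
  proof
    have 1: "\<exists>p\<in>M. x = tr_cls \<alpha> N (fst p)" if x: "x \<in> min_carrier \<alpha> N" for x
    proof -
      obtain y where "y \<in> N" "x = tr_cls \<alpha> N y" using x by (auto simp: min_carrier_def)
      then show ?thesis using diag_M[of y] by (intro bexI[of _ "P (y, y)"]) simp_all
    qed
    show "\<phi> x \<in> min_carrier \<delta> M" if "x \<in> min_carrier \<alpha> N" for x
      using 1[OF that] \<phi>_cls by (auto simp: min_carrier_def)
    show "\<psi> y \<in> min_carrier \<alpha> N" if "y \<in> min_carrier \<delta> M" for y
      using that \<psi>_cls M(2) by (auto simp: min_carrier_def)
    show "\<psi> (\<phi> x) = x" if "x \<in> min_carrier \<alpha> N" for x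
      using 1[OF that] \<phi>_cls \<psi>_cls by auto
    show "\<phi> (\<psi> y) = y" if "y \<in> min_carrier \<delta> M" for y
      using that \<phi>_cls \<psi>_cls by (auto simp: min_carrier_def)
  qed
  obtain P0 where P0: "tct_pol S SF 1 P0" "\<forall>p\<in>S. P p = P0 [p]" using upol_P by (auto simp: upol_def)
  have "ops_map \<phi> (min_carrier \<alpha> N) (min_ops A F \<alpha> N) (min_ops S SF \<delta> M)"
    unfolding ops_map_def
  proof clarify
    fix n g assume g: "(n, g) \<in> min_ops A F \<alpha> N"
    then obtain p where p: "tct_pol A F n p" "\<forall>xs\<in>tuples N n. p xs \<in> N"
      "\<forall>xs\<in>tuples N n. g (map (tr_cls \<alpha> N) xs) = tr_cls \<alpha> N (p xs)"
      by (auto simp: min_ops_def)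
    obtain Q where Q: "tct_pol S SF n Q"
      "\<forall>ps. length ps = n \<longrightarrow> Q ps = (p (map fst ps), p (map snd ps))"
      using sq_pol_diag[OF p(1) diag] by blast
    define g' where "g' = (\<lambda>Ds. \<phi> (g (map \<psi> Ds)))"
    \<comment> \<open>The coordinatewise operation may leave the image of \<open>P\<close>; applying
      \<open>P\<close> afterwards brings it into \<open>M\<close> and keeps the first
      coordinate.\<close>
    have "tct_pol S SF n (\<lambda>xs. P0 (map (\<lambda>q. q xs) [Q]))" using P0 Q by (intro tct_pol_comp) auto
    then have PQ: "tct_pol S SF n (\<lambda>xs. P0 [Q xs])" by simp
    have *: "P0 [Q ps] \<in> M \<and> g' (map (tr_cls \<delta> M) ps) = tr_cls \<delta> M (P0 [Q ps])" if ps: "ps \<in> tuples M n" for ps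
    proof -
      have fs: "map fst ps \<in> tuples N n" "map snd ps \<in> tuples N n"
        using ps M by (auto intro!: tuples_map[OF ps])
      have "ps \<in> tuples S n" using ps M(1) by (auto simp: tuples_def)
      then have QS: "Q ps \<in> S" by (rule tct_pol_closed[OF algS Q(1)])
      have Qps: "Q ps = (p (map fst ps), p (map snd ps))" using Q(2) ps by (simp add: tuples_def)
      then have QN: "Q ps \<in> N \<times> N" using p(2) fs by simp
      have PM: "P0 [Q ps] \<in> M" using P_M[OF QS QN] P0(2) QS by simp
      have "fst (P0 [Q ps]) = p (map fst ps)" using P_fst[OF QS] QN NU P0(2) QS Qps by auto
      moreover have "map \<psi> (map (tr_cls \<delta> M) ps) = map (tr_cls \<alpha> N) (map fst ps)"
        using ps \<psi>_cls by (auto simp: tuples_def)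
      ultimately have "g' (map (tr_cls \<delta> M) ps) = tr_cls \<delta> M (P0 [Q ps])"
        using p(3) fs(1) \<phi>_cls[OF PM] unfolding g'_def by metis
      then show ?thesis using PM by blast
    qed
    have g': "(n, g') \<in> min_ops S SF \<delta> M" unfolding min_ops_def using PQ * by blast
    have "g Cs \<in> min_carrier \<alpha> N \<and> \<phi> (g Cs) = g' (map \<phi> Cs)" if Cs: "Cs \<in> tuples (min_carrier \<alpha> N) n" for Cs
    proof
      show "g Cs \<in> min_carrier \<alpha> N"
        using min_carrier_tuples[OF Cs] p(2,3) by (auto simp: min_carrier_def)
      have "map \<psi> (map \<phi> Cs) = Cs" using Cs \<psi>\<phi> by (auto simp: tuples_def intro!: map_idI)
      then show "\<phi> (g Cs) = g' (map \<phi> Cs)" unfolding g'_def by metis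
    qed
    then show "\<exists>g'. (n, g') \<in> min_ops S SF \<delta> M \<and>
        (\<forall>xs\<in>tuples (min_carrier \<alpha> N) n. g xs \<in> min_carrier \<alpha> N \<and> \<phi> (g xs) = g' (map \<phi> xs))"
      using g' by blast
  qed
  moreover have "ops_map \<psi> (min_carrier \<delta> M) (min_ops S SF \<delta> M) (min_ops A F \<alpha> N)"
    unfolding ops_map_def
  proof clarify
    fix n g' assume g': "(n, g') \<in> min_ops S SF \<delta> M"
    then obtain Q where Q: "tct_pol S SF n Q" "\<forall>ps\<in>tuples M n. Q ps \<in> M"
      "\<forall>ps\<in>tuples M n. g' (map (tr_cls \<delta> M) ps) = tr_cls \<delta> M (Q ps)"
      by (auto simp: min_ops_def)
    obtain f where f: "tct_pol A F n f" "\<forall>ps. length ps = n \<longrightarrow> fst (Q ps) = f (map fst ps)"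
      using sq_pol_fst[OF Q(1) SA] by blast
    define g where "g = (\<lambda>Cs. \<psi> (g' (map \<phi> Cs)))"
    have *: "f xs \<in> N \<and> g (map (tr_cls \<alpha> N) xs) = tr_cls \<alpha> N (f xs)" if xs: "xs \<in> tuples N n" for xs
    proof -
      define ps where "ps = map (\<lambda>x. P (x, x)) xs"
      have ps: "ps \<in> tuples M n" using xs diag_M by (auto simp: tuples_def ps_def)
      have fst_ps: "map fst ps = xs" using xs diag_M by (auto simp: tuples_def ps_def intro!: map_idI)
      have f_xs: "f xs = fst (Q ps)" using f(2) ps fst_ps by (auto simp: tuples_def)
      have "map (tr_cls \<delta> M) ps = map \<phi> (map (tr_cls \<alpha> N) (map fst ps))"
        using ps \<phi>_cls by (auto simp: tuples_def)
      then have "g (map (tr_cls \<alpha> N) xs) = \<psi> (g' (map (tr_cls \<delta> M) ps))"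
        unfolding g_def fst_ps by simp
      also have "\<dots> = tr_cls \<alpha> N (f xs)" using Q(2,3) ps \<psi>_cls f_xs by simp
      finally show ?thesis using f_xs Q(2) ps M(2) by simp
    qed
    have g: "(n, g) \<in> min_ops A F \<alpha> N" unfolding min_ops_def using f(1) * by blast
    have "g' Ds \<in> min_carrier \<delta> M \<and> \<psi> (g' Ds) = g (map \<psi> Ds)" if Ds: "Ds \<in> tuples (min_carrier \<delta> M) n" for Ds
    proof
      show "g' Ds \<in> min_carrier \<delta> M"
        using min_carrier_tuples[OF Ds] Q(2,3) by (auto simp: min_carrier_def)
      have "map \<phi> (map \<psi> Ds) = Ds" using Ds \<phi>\<psi> by (auto simp: tuples_def intro!: map_idI)
      then show "\<psi> (g' Ds) = g (map \<psi> Ds)" unfolding g_def by metis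
    qed
    then show "\<exists>g. (n, g) \<in> min_ops A F \<alpha> N \<and>
        (\<forall>xs\<in>tuples (min_carrier \<delta> M) n. g' xs \<in> min_carrier \<delta> M \<and> \<psi> (g' xs) = g (map \<psi> xs))"
      using g by blast
  qed
  ultimately have iso: "ops_iso \<phi> \<psi> (min_carrier \<alpha> N) (min_ops A F \<alpha> N) (min_carrier \<delta> M) (min_ops S SF \<delta> M)"
    by (simp add: ops_iso_def)
  \<comment> \<open>Elements of the two carriers are \<alpha>-classes and \<delta>-classes, so
    \<open>j\<close> must embed sets over \<open>A\<close> into sets of pairs; the diagonal copy
    does so.\<close>
  have "inj (\<lambda>X :: 'a set. (\<lambda>x. (x, x)) ` X)" by (rule injI) (auto simp: inj_image_eq_iff inj_on_def)
  from minalg_type_transfer[OF iso this type] show ?thesis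
    unfolding tct_type_def using \<delta>_covered min trace by blast
qed

lemma pentagon:
  assumes "minalg_type (min_carrier \<alpha> N) (min_ops A F \<alpha> N) i"
    and "(p, q) \<in> \<delta>" "(fst p, fst q) \<notin> \<alpha>"
  shows "pentagon_of_type S SF \<gamma> \<delta> \<theta> i"
  unfolding pentagon_of_type_def
  using con_\<gamma> con_\<delta> con_\<theta> \<delta>_covered \<gamma>_join[OF assms(2,3)] \<gamma>_meet tct_type_S[OF assms(1)]
  by (auto simp: con_covers_def)

end

section \<open>The induced algebra on a trace\<close>

context trace_pair
begin

abbreviation "c \<equiv> tr_cls \<alpha> N"
abbreviation "M \<equiv> min_carrier \<alpha> N"
abbreviation "G \<equiv> min_ops A F \<alpha> N"

lemma c_eq: "x \<in> N \<Longrightarrow> y \<in> N \<Longrightarrow> c x = c y \<longleftrightarrow> (x, y) \<in> \<alpha>"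
proof -
  assume xy: "x \<in> N" "y \<in> N"
  have *: "c z = {w \<in> N. (z, w) \<in> \<alpha>}" if "z \<in> N" for z using that by (auto simp: tr_cls_def restr_def)
  show "c x = c y \<longleftrightarrow> (x, y) \<in> \<alpha>"
  proof
    show "(x, y) \<in> \<alpha>" if "c x = c y"
    proof -
      have "y \<in> c y" using *[OF xy(2)] xy(2) \<alpha>_refl NA by simp
      then show ?thesis using that *[OF xy(1)] by blast
    qed
    show "c x = c y" if "(x, y) \<in> \<alpha>"
      unfolding *[OF xy(1)] *[OF xy(2)] using that \<alpha>_trans \<alpha>_sym by blast
  qed
qed

lemma c_in: "x \<in> N \<Longrightarrow> c x \<in> M" by (auto simp: min_carrier_def)

lemma N_sub: "N \<subseteq> A" using NA by blast

text \<open>The induced operation is computed on chosen representatives; as polynomials respect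
  \<alpha>, the choice does not change the resulting class.\<close>

lemma ex_induced_pol:
  assumes p: "tct_pol A F n p" "\<And>xs. xs \<in> tuples N n \<Longrightarrow> p xs \<in> N"
  shows "\<exists>h. tct_pol M G n h \<and> (\<forall>xs\<in>tuples N n. h (map c xs) = c (p xs))"
proof -
  define r where "r = (\<lambda>C. SOME x. x \<in> N \<and> C = c x)"
  have r: "r (c x) \<in> N" "(x, r (c x)) \<in> \<alpha>" if "x \<in> N" for x
  proof -
    have "r (c x) \<in> N \<and> c x = c (r (c x))" unfolding r_def by (rule someI[of _ x]) (use that in simp)
    then show "r (c x) \<in> N" "(x, r (c x)) \<in> \<alpha>" using c_eq[OF that] by auto
  qed
  define g where "g = (\<lambda>Cs. c (p (map r Cs)))"
  have g_eq: "g (map c xs) = c (p xs)" if xs: "xs \<in> tuples N n" for xs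
  proof -
    let ?ys = "map r (map c xs)"
    have ys: "?ys \<in> tuples N n" using xs r by (auto simp: tuples_def)
    have "list_all2 (\<lambda>x y. (x, y) \<in> \<alpha>) xs ?ys"
      using xs r(2) by (auto simp: list_all2_map2 list_all2_same tuples_def)
    then have "(p xs, p ?ys) \<in> \<alpha>"
      by (rule tct_pol_cong[OF alg con_\<alpha> p(1), rotated 2])
        (use xs ys N_sub in \<open>auto simp: tuples_def\<close>)
    then show ?thesis using c_eq[OF p(2)[OF xs] p(2)[OF ys]] unfolding g_def by simp
  qed
  then have "(n, g) \<in> G" using p by (auto simp: min_ops_def)
  then have "tct_pol M G n (\<lambda>xs. g (map (\<lambda>p. p xs) (map (\<lambda>i xs. xs ! i) [0..<n])))"
    by (intro tct_pol.comp) (auto intro: tct_pol.proj)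
  moreover have "g (map (\<lambda>p. p (map c xs)) (map (\<lambda>i xs. xs ! i) [0..<n])) = c (p xs)"
    if xs: "xs \<in> tuples N n" for xs
  proof -
    have "map (\<lambda>p. p (map c xs)) (map (\<lambda>i xs. xs ! i) [0..<n]) = map c xs"
      using xs map_nth[of "map c xs"] by (simp add: comp_def tuples_def)
    then show ?thesis using g_eq[OF xs] by simp
  qed
  ultimately show ?thesis
    by (intro exI[of _ "\<lambda>xs. g (map (\<lambda>p. p xs) (map (\<lambda>i xs. xs ! i) [0..<n]))"]) blast
qed

lemma induced_pol_lift:
  assumes "tct_pol M G n h"
  shows "\<exists>p. tct_pol A F n p \<and> (\<forall>xs\<in>tuples N n. p xs \<in> N \<and> h (map c xs) = c (p xs))"
  using assms
proof induction
  case (proj i n)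
  then show ?case by (intro exI[of _ "\<lambda>xs. xs ! i"]) (auto simp: tuples_def intro: tct_pol.proj)
next
  case (const C n)
  then obtain x where "x \<in> N" "C = c x" by (auto simp: min_carrier_def)
  then show ?case using NA by (intro exI[of _ "\<lambda>_. x"]) (auto intro: tct_pol.const)
next
  case (comp k f ps n)
  obtain f' where f': "tct_pol A F k f'" "\<forall>xs\<in>tuples N k. f' xs \<in> N"
    "\<forall>xs\<in>tuples N k. f (map c xs) = c (f' xs)"
    using comp(1) by (auto simp: min_ops_def)
  obtain Q where Q: "\<forall>p\<in>set ps. tct_pol A F n (Q p) \<and>
      (\<forall>xs\<in>tuples N n. Q p xs \<in> N \<and> p (map c xs) = c (Q p xs))"
    using comp(3) by metis
  have "tct_pol A F n (\<lambda>xs. f' (map (\<lambda>q. q xs) (map Q ps)))"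
    using comp(2) f'(1) Q by (intro tct_pol_comp) auto
  moreover have "f' (map (\<lambda>q. q xs) (map Q ps)) \<in> N \<and>
      f (map (\<lambda>p. p (map c xs)) ps) = c (f' (map (\<lambda>q. q xs) (map Q ps)))" if "xs \<in> tuples N n" for xs
  proof -
    have "map (\<lambda>q. q xs) (map Q ps) \<in> tuples N k" using Q comp(2) that by (auto simp: tuples_def)
    moreover have "map (\<lambda>p. p (map c xs)) ps = map c (map (\<lambda>q. q xs) (map Q ps))"
      using Q that by auto
    ultimately show ?thesis using f'(2,3) by metis
  qed
  ultimately show ?case by (intro exI[of _ "\<lambda>xs. f' (map (\<lambda>q. q xs) (map Q ps))"]) blast
qed

lemma pol_\<beta>_N:
  assumes "tct_pol A F n p" "xs \<in> tuples N n" "ys \<in> tuples N n" shows "(p xs, p ys) \<in> \<beta>"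
proof (rule tct_pol_cong[OF alg con_\<beta> assms(1)])
  show "list_all2 (\<lambda>x y. (x, y) \<in> \<beta>) xs ys"
    by (intro list_all2_all_nthI N\<beta>) (use assms(2,3) in \<open>auto simp: tuples_def\<close>)
qed (use assms N_sub in \<open>auto simp: tuples_def\<close>)

end

section \<open>Polynomials of unary algebras, two-element chains and vector spaces\<close>

lemma essentially_unary:
  assumes "tct_pol M H n h" "\<forall>(k, f) \<in> H. k = 1"
  shows "\<exists>\<phi>. (\<exists>i<n. \<forall>xs. h xs = \<phi> (xs ! i)) \<or> (\<forall>xs ys. h xs = h ys)"
  using assms(1)
proof induction
  case (comp k f ps n)
  then have "length ps = 1" using assms(2) by blast
  then obtain p where p: "ps = [p]" by (auto simp: length_Suc_conv)
  then consider \<phi> i where "i < n" "\<forall>xs. p xs = \<phi> (xs ! i)" | "\<forall>xs ys. p xs = p ys"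
    using comp(3) by auto
  then show ?case
  proof cases
    case 1 then show ?thesis using p by (intro exI[of _ "\<lambda>y. f [\<phi> y]"]) auto
  next
    case 2
    then have "\<forall>xs ys. f (map (\<lambda>p. p xs) ps) = f (map (\<lambda>p. p ys) ps)" using p by auto metis
    then show ?thesis by blast
  qed
next
  case (proj i n) then show ?case by (intro exI[of _ "\<lambda>x. x"]) blast
qed blast

text \<open>\<open>meet2 z u\<close> and \<open>join2 z u\<close> are meet and join of the chain z <
  u, hence monotone. The inclusion for \<open>H\<close> lets one statement serve types 4 and
  5.\<close>

lemma lattice_pol_mono:
  assumes "tct_pol {z, u} H n h" "H \<subseteq> {(2, meet2 z u), (2, join2 z u)}" "z \<noteq> u"
    and "length xs = n" "length ys = n" "\<And>i. i < n \<Longrightarrow> xs ! i = u \<Longrightarrow> ys ! i = u"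
    and "set xs \<subseteq> {z, u}" "set ys \<subseteq> {z, u}"
  shows "(h xs = u \<longrightarrow> h ys = u) \<and> h xs \<in> {z, u} \<and> h ys \<in> {z, u}"
  using assms(1,4-)
proof induction
  case (proj i n) then show ?case by (metis nth_mem subsetD)
next
  case (const d n) then show ?case by auto
next
  case (comp k f ps n)
  then have f: "f = meet2 z u \<or> f = join2 z u" "k = 2" using assms(2) by auto
  then obtain p q where pq: "ps = [p, q]" using comp(2) by (auto simp: length_Suc_conv numeral_2_eq_2)
  have "(p xs = u \<longrightarrow> p ys = u) \<and> p xs \<in> {z, u} \<and> p ys \<in> {z, u}"
    "(q xs = u \<longrightarrow> q ys = u) \<and> q xs \<in> {z, u} \<and> q ys \<in> {z, u}"
    using comp pq by auto
  then show ?case using f(1) pq assms(3) by (auto simp: meet2_def join2_def)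
qed

lemma lattice_pol_mono_3:
  assumes "tct_pol {z, u} H 3 h" "H \<subseteq> {(2, meet2 z u), (2, join2 z u)}" "z \<noteq> u"
    and "h [x1, x2, x3] = u" "x1 = u \<longrightarrow> y1 = u" "x2 = u \<longrightarrow> y2 = u" "x3 = u \<longrightarrow> y3 = u"
    and "{x1, x2, x3, y1, y2, y3} \<subseteq> {z, u}"
  shows "h [y1, y2, y3] = u"
proof -
  have i: "[x1, x2, x3] ! i = u \<Longrightarrow> [y1, y2, y3] ! i = u" if "i < 3" for i
    using that assms(5-7) by (auto simp: less_Suc_eq numeral_3_eq_3)
  have sub: "set [x1, x2, x3] \<subseteq> {z, u}" "set [y1, y2, y3] \<subseteq> {z, u}" using assms(8) by simp_all
  have "(h [x1, x2, x3] = u \<longrightarrow> h [y1, y2, y3] = u) \<and> h [x1, x2, x3] \<in> {z, u} \<and> h [y1, y2, y3] \<in> {z, u}"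
    by (rule lattice_pol_mono[OF assms(1-3)], simp, simp, rule i, assumption, assumption, rule sub, rule sub)
  then show ?thesis using assms(4) by blast
qed

text \<open>Affinity of the polynomials of a vector space, in a form free of subtraction and of
  coefficients.\<close>

lemma vector_space_pol_parallelogram:
  assumes "module R V" "tct_pol (carrier V) (vs_ops R V) n h"
    and "set ws \<subseteq> carrier V" "set xs \<subseteq> carrier V" "set ys \<subseteq> carrier V" "set zs \<subseteq> carrier V"
    and "length ws = n" "length xs = n" "length ys = n" "length zs = n"
    and "\<And>i. i < n \<Longrightarrow> ws ! i \<oplus>\<^bsub>V\<^esub> ys ! i = xs ! i \<oplus>\<^bsub>V\<^esub> zs ! i"
  shows "h ws \<oplus>\<^bsub>V\<^esub> h ys = h xs \<oplus>\<^bsub>V\<^esub> h zs \<and>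
    h ws \<in> carrier V \<and> h xs \<in> carrier V \<and> h ys \<in> carrier V \<and> h zs \<in> carrier V"
  using assms(2-)
proof induction
  case (proj i n)
  then have "zs ! i \<in> set zs" "ys ! i \<in> set ys" "xs ! i \<in> set xs" "ws ! i \<in> set ws" by simp_all
  then show ?case using proj by blast
next
  case (const d n) then show ?case by auto
next
  case (comp k f ps n)
  interpret module R V by fact
  have IH: "p ws \<oplus>\<^bsub>V\<^esub> p ys = p xs \<oplus>\<^bsub>V\<^esub> p zs" "p ws \<in> carrier V" "p xs \<in> carrier V"
    "p ys \<in> carrier V" "p zs \<in> carrier V" if "p \<in> set ps" for p
    using bspec[OF comp(3) that] comp.prems by auto
  from comp(1) consider (a) "k = 2" "f = (\<lambda>xs. xs ! 0 \<oplus>\<^bsub>V\<^esub> xs ! 1)" | (m) "k = 1" "f = (\<lambda>xs. \<ominus>\<^bsub>V\<^esub> (xs ! 0))"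
    | (z) "f = (\<lambda>_. \<zero>\<^bsub>V\<^esub>)" | (s) r where "r \<in> carrier R" "k = 1" "f = (\<lambda>xs. r \<odot>\<^bsub>V\<^esub> (xs ! 0))"
    by (auto simp: vs_ops_def)
  then show ?case
  proof cases
    case a
    then obtain p q where pq: "ps = [p, q]" using comp(2) by (auto simp: length_Suc_conv numeral_2_eq_2)
    note p = IH[of p] and q = IH[of q]
    have interchange: "(x \<oplus>\<^bsub>V\<^esub> x') \<oplus>\<^bsub>V\<^esub> (y \<oplus>\<^bsub>V\<^esub> y') = (x \<oplus>\<^bsub>V\<^esub> y) \<oplus>\<^bsub>V\<^esub> (x' \<oplus>\<^bsub>V\<^esub> y')"
      if "x \<in> carrier V" "x' \<in> carrier V" "y \<in> carrier V" "y' \<in> carrier V" for x x' y y'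
      using that by (simp add: M.a_ac)
    show ?thesis using p q pq a by (simp add: interchange)
  next
    case m
    then obtain p where pq: "ps = [p]" using comp(2) by (auto simp: length_Suc_conv)
    note p = IH[of p]
    have "\<ominus>\<^bsub>V\<^esub> p ws \<oplus>\<^bsub>V\<^esub> \<ominus>\<^bsub>V\<^esub> p ys = \<ominus>\<^bsub>V\<^esub> p xs \<oplus>\<^bsub>V\<^esub> \<ominus>\<^bsub>V\<^esub> p zs"
      using p pq by (simp flip: M.minus_add)
    then show ?thesis using p pq m by simp
  next
    case z then show ?thesis by simp
  next
    case (s r)
    then obtain p where pq: "ps = [p]" using comp(2) by (auto simp: length_Suc_conv)
    note p = IH[of p]
    have "r \<odot>\<^bsub>V\<^esub> p ws \<oplus>\<^bsub>V\<^esub> r \<odot>\<^bsub>V\<^esub> p ys = r \<odot>\<^bsub>V\<^esub> p xs \<oplus>\<^bsub>V\<^esub> r \<odot>\<^bsub>V\<^esub> p zs"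
      using p pq s(1) by (simp flip: smult_r_distr)
    then show ?thesis using p pq s by simp
  qed
qed

section \<open>Polynomials moving the tail into the trace\<close>

locale trace_tail = trace_pair +
  fixes t :: 'a
  assumes t: "t \<in> tail \<alpha> \<beta> U"
begin

lemma tU: "t \<in> U" and t_tail: "y \<in> U \<Longrightarrow> (t, y) \<in> \<beta> \<Longrightarrow> (t, y) \<in> \<alpha>"
  using t tail_iff by auto

lemma tA: "t \<in> A" using tU UA by blast

text \<open>If \<open>r t\<close> were in \<open>N\<close>, the polynomial inverse of
  \<open>r\<close> on \<open>U\<close> would carry \<open>N\<close>, which lies in one
  \<beta>-class, into the \<beta>-class of \<open>t\<close>. Within \<open>U\<close> that is a
  single \<alpha>-class, so applying \<open>r\<close> again would make \<open>a\<close> and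
  \<open>b\<close> \<alpha>-related.\<close>

lemma tail_not_to_trace:
  assumes r: "upol A F r" "r ` A \<subseteq> U" and xy: "x \<in> U" "y \<in> U" "(x, y) \<in> \<beta>" "(r x, r y) \<notin> \<alpha>"
  shows "r t \<notin> N"
proof
  assume rt: "r t \<in> N"
  have "r ` U \<subseteq> U" using r(2) UA by blast
  then obtain r' where r': "upol A F r'" "r' ` A \<subseteq> U" "\<forall>x\<in>U. r' (r x) = x \<and> r (r' x) = x"
    using inverse_pol[OF r(1) _ xy] by blast
  have *: "(t, r' z) \<in> \<alpha>" if "z \<in> N" for z
    using \<beta>_pol[OF r'(1) N\<beta>[OF rt that]] r' tU t_tail NA[OF that] by auto
  have "(r' a, r' b) \<in> \<alpha>" by (rule \<alpha>_trans[OF \<alpha>_sym[OF *[OF aN]] *[OF bN]])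
  then have "(r (r' a), r (r' b)) \<in> \<alpha>" by (rule \<alpha>_pol[OF r(1)])
  then show False using r'(3) aU bU ab by simp
qed

lemma pol_3_upol:
  assumes "tct_pol A F 3 f" "upol A F g" "upol A F h" "upol A F k"
  shows "upol A F (\<lambda>x. f [g x, h x, k x])"
  using upol_subst[of A F "[g, h, k]" f] assms by (simp add: numeral_3_eq_3)

lemma pol_2_upol:
  assumes "tct_pol A F 2 f" "upol A F g" "upol A F h"
  shows "upol A F (\<lambda>x. f [g x, h x])"
  using upol_subst[of A F "[g, h]" f] assms by (simp add: numeral_2_eq_2)

lemma pol_3_\<alpha>:
  assumes "tct_pol A F 3 f" "(x, x') \<in> \<alpha>" "(y, y') \<in> \<alpha>" "(z, z') \<in> \<alpha>"
  shows "(f [x, y, z], f [x', y', z']) \<in> \<alpha>"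
  by (rule tct_pol_cong[OF alg con_\<alpha> assms(1)]) (use assms(2-) tct_con_sub[OF con_\<alpha>] in \<open>auto simp: tuples_3\<close>)

text \<open>Iterating a meet operation in its second variable makes all its rows idempotent. The row
  of a tail element cannot be a permutation of \<open>U\<close>, so it collapses the trace.\<close>

lemma meet_to_bottom:
  assumes m: "tct_pol A F 2 m" and mN: "\<And>x y. x \<in> N \<Longrightarrow> y \<in> N \<Longrightarrow> m [x, y] \<in> N"
    and x01: "x0 \<in> N" "x1 \<in> N" "c x0 \<noteq> c x1" and Mx: "M = {c x0, c x1}"
    and meet: "\<And>x y. x \<in> N \<Longrightarrow> y \<in> N \<Longrightarrow> c (m [x, y]) = meet2 (c x0) (c x1) [c x, c y]"
  shows "\<exists>w. upol A F w \<and> (\<forall>x\<in>N. (w x, x0) \<in> \<alpha>) \<and> (w t, t) \<in> \<alpha>"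
proof -
  define row where "row = (\<lambda>x y. e (m [x, y]))"
  have rowU: "row x y \<in> U" if "x \<in> A" "y \<in> A" for x y
    using e(4) tct_pol_closed[OF alg m] that by (simp add: row_def tuples_2)
  have rowN: "row x y \<in> N \<and> c (row x y) = meet2 (c x0) (c x1) [c x, c y]" if "x \<in> N" "y \<in> N" for x y
    using mN[OF that] meet[OF that] e(3) NU by (simp add: row_def)
  have row_pol: "upol A F (\<lambda>x. row (g x) (h x))" if "upol A F g" "upol A F h" for g h
    unfolding row_def by (rule upol_o[OF e(1) pol_2_upol[OF m that]])
  have iter_pol: "upol A F (\<lambda>x. (row (g x) ^^ k) (h x))" if "upol A F g" "upol A F h" for g h k
    by (induction k) (use that row_pol in auto)
  have iter_N: "(row x ^^ Suc k) y \<in> N \<and> c ((row x ^^ Suc k) y) = meet2 (c x0) (c x1) [c x, c y]"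
    if "x \<in> N" "y \<in> N" for x y k
  proof (induction k)
    case 0 then show ?case using rowN that by simp
  next
    case (Suc k)
    have "c x \<in> {c x0, c x1}" "c y \<in> {c x0, c x1}" using c_in that Mx by auto
    then show ?case using Suc rowN[OF that(1), of "(row x ^^ Suc k) y"] by (auto simp: meet2_def)
  qed
  define k where "k = (fact (card U) - 1 :: nat)"
  have k: "fact (card U) = Suc k" unfolding k_def by (metis Suc_pred' fact_gt_zero)
  define m2 where "m2 = (\<lambda>x. row x ^^ Suc k)"
  have m2_pol: "upol A F (\<lambda>x. m2 (g x) (h x))" if "upol A F g" "upol A F h" for g h
    unfolding m2_def by (rule iter_pol[OF that])
  have iter_A: "(row x ^^ j) y \<in> A" if "x \<in> A" "y \<in> A" for x y j
    using that rowU UA by (induction j) auto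
  have m2U: "m2 x y \<in> U" if "x \<in> A" "y \<in> A" for x y
    using rowU[OF that(1) iter_A[OF that]] by (simp add: m2_def)
  have m2_idem: "m2 x (m2 x y) = m2 x y" if "x \<in> A" "y \<in> U" for x y
    unfolding m2_def k[symmetric] by (rule funpow_fact_idem[OF finU]) (use that rowU UA in auto)
  have m2N: "m2 x y \<in> N" "c (m2 x y) = meet2 (c x0) (c x1) [c x, c y]" if "x \<in> N" "y \<in> N" for x y
    using iter_N[OF that] by (auto simp: m2_def)
  have x01A: "x0 \<in> A" "x1 \<in> A" "x0 \<in> U" "x1 \<in> U" using x01 NA NU by auto
  define \<rho> where "\<rho> = (\<lambda>x. m2 x x1)"
  have \<rho>: "upol A F \<rho>" unfolding \<rho>_def by (rule m2_pol[OF upol_id upol_const[OF x01A(2)]])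
  have \<rho>U: "\<rho> ` U \<subseteq> U" using m2U UA x01A by (auto simp: \<rho>_def)
  have \<rho>N: "\<rho> x \<in> N" "(x, \<rho> x) \<in> \<alpha>" if "x \<in> N" for x
  proof -
    show "\<rho> x \<in> N" using m2N(1)[OF that x01(2)] by (simp add: \<rho>_def)
    have "c x \<in> {c x0, c x1}" using c_in that Mx by auto
    then have "c x = c (\<rho> x)" using m2N(2)[OF that x01(2)] x01(3) by (auto simp: \<rho>_def meet2_def)
    then show "(x, \<rho> x) \<in> \<alpha>" using c_eq[OF that \<open>\<rho> x \<in> N\<close>] by simp
  qed
  have x01\<alpha>: "(x0, x1) \<notin> \<alpha>" using x01 c_eq by simp
  then have "(\<rho> x0, \<rho> x1) \<notin> \<alpha>" using \<rho>N[OF x01(1)] \<rho>N[OF x01(2)] \<alpha>_trans \<alpha>_sym by blast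
  then obtain \<rho>' where \<rho>': "upol A F \<rho>'" "\<rho>' ` A \<subseteq> U" "\<forall>x\<in>U. \<rho>' (\<rho> x) = x \<and> \<rho> (\<rho>' x) = x"
    using inverse_pol[OF \<rho> \<rho>U x01A(3,4) N\<beta>[OF x01(1,2)]] by blast
  have \<rho>'N: "\<rho>' x \<in> N" if "x \<in> N" for x
  proof -
    have "(\<rho>' x, \<rho>' (\<rho> x)) \<in> \<alpha>" by (rule \<alpha>_pol[OF \<rho>'(1) \<rho>N(2)[OF that]])
    then have "(x, \<rho>' x) \<in> \<beta>" using \<rho>'(3) NU[OF that] \<alpha>\<beta> \<beta>_sym by auto
    then show ?thesis using N_closed[OF that] \<rho>'(2) NA[OF that] by blast
  qed
  define w where "w = (\<lambda>x. m2 (\<rho>' x) x0)"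
  have "upol A F w" unfolding w_def by (rule m2_pol[OF \<rho>'(1) upol_const[OF x01A(1)]])
  moreover have "(w x, x0) \<in> \<alpha>" if "x \<in> N" for x
  proof -
    have "c (w x) = c x0" using m2N(2)[OF \<rho>'N[OF that] x01(1)] x01(3) by (simp add: w_def meet2_def)
    then show ?thesis using c_eq[OF _ x01(1)] m2N(1)[OF \<rho>'N[OF that] x01(1)] by (simp add: w_def)
  qed
  moreover have "(w t, t) \<in> \<alpha>"
  proof (rule ccontr)
    assume neg: "(w t, t) \<notin> \<alpha>"
    \<comment> \<open>The row of \<open>s\<close> sends \<open>x1\<close> to \<open>t\<close>. If it
      separated \<open>x0\<close> from \<open>x1\<close>, it would be an idempotent permutation of
      \<open>U\<close>, so t = x1, an element of the trace.\<close>
    define s where "s = \<rho>' t"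
    have s: "s \<in> A" using \<rho>'(2) tA UA by (auto simp: s_def)
    have \<kappa>: "upol A F (m2 s)" using m2_pol[OF upol_const[OF s] upol_id] by simp
    have \<kappa>U: "m2 s ` U \<subseteq> U" using m2U s UA by auto
    have st: "m2 s x1 = t" using \<rho>'(3) tU by (simp add: s_def \<rho>_def)
    then have "(m2 s x0, m2 s x1) \<notin> \<alpha>" using neg by (simp add: w_def s_def)
    then obtain \<kappa>' where "\<forall>x\<in>U. \<kappa>' (m2 s x) = x"
      using inverse_pol[OF \<kappa> \<kappa>U x01A(3,4) N\<beta>[OF x01(1,2)]] by blast
    then have "m2 s x1 = x1" using m2_idem[OF s x01A(4)] x01A(4) m2U[OF s x01A(2)] by metis
    then have "(t, x0) \<in> \<alpha>" "t = x1" using st t_tail[OF x01A(3)] N\<beta>[OF x01(2,1)] by auto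
    then show False using x01\<alpha> \<alpha>_sym by blast
  qed
  ultimately show ?thesis by blast
qed

text \<open>\<open>f\<close> is the obstruction to \<open>((a, t), (b, t)) \<in> \<delta>\<close> for the subpower generated by the diagonal
  and the pairs \<open>(a, t)\<close> and \<open>(b, t)\<close>.\<close>

context
  fixes f
  assumes f: "tct_pol A F 3 f" and fU: "\<And>x y z. x \<in> A \<Longrightarrow> y \<in> A \<Longrightarrow> z \<in> A \<Longrightarrow> f [x, y, z] \<in> U"
    and fx: "\<And>x. x \<in> U \<Longrightarrow> f [x, a, b] = x" and ft: "f [t, t, t] \<in> N"
begin

lemma fN: "x \<in> N \<Longrightarrow> y \<in> N \<Longrightarrow> z \<in> N \<Longrightarrow> f [x, y, z] \<in> N"
proof -
  assume xyz: "x \<in> N" "y \<in> N" "z \<in> N"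
  have "(f [a, a, b], f [x, y, z]) \<in> \<beta>"
    by (rule pol_\<beta>_N[OF f]) (use xyz aN bN in \<open>auto simp: tuples_3\<close>)
  then show ?thesis using fx[OF aU] N_closed[OF aN] fU NA xyz by auto
qed

lemma upol_fU:
  assumes "upol A F g" "upol A F h" "upol A F k"
  shows "upol A F (\<lambda>x. f [g x, h x, k x])" "(\<lambda>x. f [g x, h x, k x]) ` A \<subseteq> U"
  using pol_3_upol[OF f assms] fU upol_in[OF assms(1)] upol_in[OF assms(2)] upol_in[OF assms(3)] by auto

text \<open>The map sending x to f(x, x, x) takes \<open>t\<close> into \<open>N\<close>, so it
  cannot separate \<open>a\<close> from \<open>b\<close>.\<close>

lemma f_diag: "(f [a, a, a], f [b, b, b]) \<in> \<alpha>"
  using tail_not_to_trace[OF upol_fU[OF upol_id upol_id upol_id] aU bU ab\<beta>] ft by blast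

lemma induced_f: 
  assumes "poly_equiv M G H"
  shows "\<exists>h. tct_pol M H 3 h \<and> (\<forall>x\<in>N. \<forall>y\<in>N. \<forall>z\<in>N. h [c x, c y, c z] = c (f [x, y, z]))"
proof -
  obtain h where h: "tct_pol M G 3 h" "\<forall>xs\<in>tuples N 3. h (map c xs) = c (f xs)"
    using ex_induced_pol[OF f] fN by (auto simp: tuples_3)
  obtain h' where h': "tct_pol M H 3 h'" "agree_on M 3 h h'"
    using assms h(1) unfolding poly_equiv_def by blast
  have "h' [c x, c y, c z] = c (f [x, y, z])" if "x \<in> N" "y \<in> N" "z \<in> N" for x y z
  proof -
    have "[c x, c y, c z] \<in> tuples M 3" "[x, y, z] \<in> tuples N 3" using that c_in by (auto simp: tuples_3)
    then show ?thesis using h(2) h'(2) by (force simp: agree_on_def)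
  qed
  then show ?thesis using h' by blast
qed

lemma c_ab: "c a \<noteq> c b" using c_eq aN bN ab by simp

text \<open>Types 1, 4 and 5 are refuted from these values alone.\<close>

lemma c_f:
  "c (f [a, a, b]) = c a" "c (f [b, a, b]) = c b" "c (f [a, a, a]) = c (f [b, b, b])"
  using fx aU bU c_eq f_diag fN aN bN by auto

text \<open>Dependence on the first variable alone would separate the diagonal values at
  \<open>a\<close> and \<open>b\<close>; in every other case the first two values of
  \<open>c_f\<close> would coincide.\<close>

lemma not_type_1:
  assumes H: "\<forall>(n, h) \<in> H. n = 1" and eq: "poly_equiv M G H" shows False
proof -
  obtain h where h: "tct_pol M H 3 h" "\<forall>x\<in>N. \<forall>y\<in>N. \<forall>z\<in>N. h [c x, c y, c z] = c (f [x, y, z])"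
    using induced_f[OF eq] by blast
  have h': "h [c a, c a, c b] = c a" "h [c b, c a, c b] = c b" "h [c a, c a, c a] = h [c b, c b, c b]"
    using h(2) aN bN c_f by simp_all
  obtain \<phi> where "(\<exists>i<3. \<forall>xs. h xs = \<phi> (xs ! i)) \<or> (\<forall>xs ys. h xs = h ys)"
    using essentially_unary[OF h(1) H] by blast
  then show False
  proof
    assume "\<exists>i<3. \<forall>xs. h xs = \<phi> (xs ! i)"
    then obtain i where "i < 3" and i: "\<forall>xs. h xs = \<phi> (xs ! i)" by blast
    then consider "i = 0" | "i = 1" | "i = 2" by linarith
    then show False using h' i c_ab by cases auto
  next
    assume "\<forall>xs ys. h xs = h ys" then show False using h' c_ab by metis
  qed
qed

text \<open>Whichever of \<open>c a\<close> and \<open>c b\<close> is the top u, one of the first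
  two values of \<open>c_f\<close> forces h(u, u, u) = u. The diagonal being constant, h(z, z, z) =
  u, so by monotonicity h is constantly u, against the other value.\<close>

lemma not_type_4_5:
  assumes "z \<noteq> u" "M = {z, u}" "H \<subseteq> {(2, meet2 z u), (2, join2 z u)}" and eq: "poly_equiv M G H"
  shows False
proof -
  obtain h where h: "tct_pol M H 3 h" "\<forall>x\<in>N. \<forall>y\<in>N. \<forall>z\<in>N. h [c x, c y, c z] = c (f [x, y, z])"
    using induced_f[OF eq] by blast
  have h': "h [c a, c a, c b] = c a" "h [c b, c a, c b] = c b" "h [c a, c a, c a] = h [c b, c b, c b]"
    using h(2) aN bN c_f by simp_all
  have mono: "h [x', y', z'] = u" if "h [x, y, z''] = u" "x = u \<longrightarrow> x' = u" "y = u \<longrightarrow> y' = u" "z'' = u \<longrightarrow> z' = u"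
    "{x, y, z'', x', y', z'} \<subseteq> {z, u}" for x y z'' x' y' z'
    by (rule lattice_pol_mono_3[OF h(1)[unfolded assms(2)] assms(3,1) that])
  have cM: "c a \<in> {z, u}" "c b \<in> {z, u}" using c_in aN bN assms(2) by auto
  then consider "c a = z" "c b = u" | "c a = u" "c b = z" using c_ab by auto
  then show False
  proof cases
    case 1
    then have "h [u, u, u] = u" using mono[of u z u u u u] h'(2) by simp
    then have "h [z, z, u] = u" using mono[of z z z z z u] h'(3) 1 by simp
    then show False using h'(1) 1 assms(1) by simp
  next
    case 2
    then have "h [u, u, u] = u" using mono[of u u z u u u] h'(1) by simp
    then have "h [z, u, z] = u" using mono[of z z z z u z] h'(3) 2 by simp
    then show False using h'(2) 2 assms(1) by simp
  qed
qed

text \<open>A Boolean algebra offers a meet for either order of its two elements, so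
  \<open>meet_to_bottom\<close> gives \<open>w0\<close> and \<open>w1\<close> that on
  \<open>N\<close> are \<open>a\<close> and \<open>b\<close>, and at \<open>t\<close> are
  \<open>t\<close>, modulo \<alpha>. Then f(x, w0 x, w1 x) is x on \<open>N\<close> but f(t, t, t)
  at \<open>t\<close>, again modulo \<alpha>.\<close>

lemma not_type_3:
  assumes "z \<noteq> u" "M = {z, u}"
    and eq: "poly_equiv M G {(2, meet2 z u), (2, join2 z u), (1, compl2 z u)}" (is "poly_equiv M G ?H")
  shows False
proof -
  have bottom: "\<exists>w. upol A F w \<and> (\<forall>x\<in>N. (w x, x0) \<in> \<alpha>) \<and> (w t, t) \<in> \<alpha>"
    if x01: "x0 \<in> N" "x1 \<in> N" "c x0 \<noteq> c x1" for x0 x1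
  proof -
    have zu: "c x0 = z \<and> c x1 = u \<or> c x0 = u \<and> c x1 = z"
      using c_in[OF x01(1)] c_in[OF x01(2)] x01(3) assms(2) by auto
    \<comment> \<open>The join of one order is the meet of the opposite one; this covers the case
      where \<open>x0\<close> represents \<open>u\<close>.\<close>
    have "join2 z u = meet2 u z" by (auto simp: join2_def meet2_def)
    then have "(2, meet2 (c x0) (c x1)) \<in> ?H" using zu by auto
    then have "tct_pol M ?H 2 (\<lambda>xs. meet2 (c x0) (c x1) (map (\<lambda>p. p xs) [\<lambda>xs. xs ! 0, \<lambda>xs. xs ! 1]))"
      by (intro tct_pol.comp) (auto intro: tct_pol.proj)
    then obtain h where h: "tct_pol M G 2 h"
      "agree_on M 2 (\<lambda>xs. meet2 (c x0) (c x1) (map (\<lambda>p. p xs) [\<lambda>xs. xs ! 0, \<lambda>xs. xs ! 1])) h"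
      using eq unfolding poly_equiv_def by blast
    obtain m where m: "tct_pol A F 2 m" "\<forall>xs\<in>tuples N 2. m xs \<in> N \<and> h (map c xs) = c (m xs)"
      using induced_pol_lift[OF h(1)] by blast
    have mN: "m [x, y] \<in> N" "c (m [x, y]) = meet2 (c x0) (c x1) [c x, c y]" if "x \<in> N" "y \<in> N" for x y
    proof -
      have "[x, y] \<in> tuples N 2" "[c x, c y] \<in> tuples M 2" using that c_in by (auto simp: tuples_2)
      then show "m [x, y] \<in> N" "c (m [x, y]) = meet2 (c x0) (c x1) [c x, c y]"
        using m(2) h(2) by (force simp: agree_on_def)+
    qed
    show ?thesis
      by (rule meet_to_bottom[OF m(1) mN(1) x01 _ mN(2)]) (use zu assms(2) in auto)
  qed
  obtain w0 where w0: "upol A F w0" "\<forall>x\<in>N. (w0 x, a) \<in> \<alpha>" "(w0 t, t) \<in> \<alpha>"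
    using bottom[OF aN bN c_ab] by blast
  obtain w1 where w1: "upol A F w1" "\<forall>x\<in>N. (w1 x, b) \<in> \<alpha>" "(w1 t, t) \<in> \<alpha>"
    using bottom[OF bN aN c_ab[symmetric]] by blast
  let ?r = "\<lambda>x. f [x, w0 x, w1 x]"
  have r: "(?r x, x) \<in> \<alpha>" if "x \<in> N" for x
  proof -
    have "(?r x, f [x, a, b]) \<in> \<alpha>" by (rule pol_3_\<alpha>[OF f]) (use that w0 w1 \<alpha>_refl NA in auto)
    then show ?thesis using fx NU that by simp
  qed
  have "(?r a, ?r b) \<notin> \<alpha>" using r[OF aN] r[OF bN] ab \<alpha>_sym \<alpha>_trans by blast
  then have "?r t \<notin> N"
    using tail_not_to_trace[OF upol_fU[OF upol_id w0(1) w1(1)] aU bU ab\<beta>] by blast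
  moreover have "(?r t, f [t, t, t]) \<in> \<alpha>"
    by (rule pol_3_\<alpha>[OF f]) (use w0 w1 \<alpha>_refl tA in auto)
  moreover have "?r t \<in> U" using fU upol_in[OF w0(1)] upol_in[OF w1(1)] tA by simp
  ultimately show False using N_closed[OF ft] \<alpha>\<beta> \<beta>_sym by blast
qed

text \<open>Affinity gives h(a, w, w) - h(b, w, w) = h(a, a, b) - h(b, a, b) = a - b on classes, so
  the first variable separates \<open>a\<close> from \<open>b\<close> for every \<open>w\<close> in
  \<open>N\<close>. Since h(a, a, a) = h(b, b, b), the last two variables jointly separate them
  too.\<close>

lemma not_type_2:
  assumes R: "module R V" "carrier V = M" and eq: "poly_equiv M G (vs_ops R V)"
  shows False
proof -
  interpret module R V by fact
  obtain h where h: "tct_pol M (vs_ops R V) 3 h" "\<forall>x\<in>N. \<forall>y\<in>N. \<forall>z\<in>N. h [c x, c y, c z] = c (f [x, y, z])"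
    using induced_f[OF eq] by blast
  have h': "h [c a, c a, c b] = c a" "h [c b, c a, c b] = c b" "h [c a, c a, c a] = h [c b, c b, c b]"
    using h(2) aN bN c_f by simp_all
  have cM: "c x \<in> carrier V" if "x \<in> N" for x using c_in that R(2) by simp
  have par: "h [c a, c w, c w] \<oplus>\<^bsub>V\<^esub> h [c b, c a, c b] = h [c a, c a, c b] \<oplus>\<^bsub>V\<^esub> h [c b, c w, c w]" if "w \<in> N" for w
    by (rule conjunct1[OF vector_space_pol_parallelogram[OF R(1), of 3 h]])
      (use h(1) R(2) cM[OF aN] cM[OF bN] cM[OF that] in \<open>auto simp: less_Suc_eq numeral_3_eq_3 M.a_comm\<close>)
  have hM: "h [c x, c y, c z] \<in> carrier V" if "x \<in> N" "y \<in> N" "z \<in> N" for x y z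
    using h(2) that cM fN by simp
  have sep: "h [c a, c w, c w] \<noteq> h [c b, c w, c w]" if "w \<in> N" for w
  proof
    assume "h [c a, c w, c w] = h [c b, c w, c w]"
    then have "h [c b, c w, c w] \<oplus>\<^bsub>V\<^esub> c b = h [c b, c w, c w] \<oplus>\<^bsub>V\<^esub> c a"
      using par[OF that] h' hM[OF bN that that] cM[OF aN] by (simp add: M.a_comm)
    then show False using c_ab cM[OF aN] cM[OF bN] hM[OF bN that that] by simp
  qed
  have sep_\<alpha>: "(f [a, w, w], f [b, w, w]) \<notin> \<alpha>" if "w \<in> N" for w
    using sep[OF that] h(2) that aN bN c_eq fN by simp
  have sep2_\<alpha>: "(f [a, a, a], f [a, b, b]) \<notin> \<alpha>"
    using sep[OF bN] h'(3) h(2) aN bN c_eq fN by metis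
  let ?s = "\<lambda>y. f [a, y, y]"
  have s: "upol A F ?s" "?s ` A \<subseteq> U" by (rule upol_fU[OF upol_const[OF aA] upol_id upol_id])+
  have "?s ` U \<subseteq> U" using s(2) UA by blast
  then obtain s' where s': "upol A F s'" "s' ` A \<subseteq> U" "\<forall>x\<in>U. s' (?s x) = x \<and> ?s (s' x) = x"
    using inverse_pol[OF s(1) _ aU bU ab\<beta> sep2_\<alpha>] by blast
  have s'N: "s' y \<in> N" if "y \<in> N" for y
  proof -
    have "(s' (?s a), s' y) \<in> \<beta>" using \<beta>_pol[OF s'(1) N\<beta>[OF fN[OF aN aN aN] that]] .
    then show ?thesis using s'(2,3) aU N_closed[OF aN] NA[OF that] by auto
  qed
  \<comment> \<open>Normalised so that g a y = y on \<open>U\<close>, while g t t stays in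
    \<open>N\<close>.\<close>
  define g where "g = (\<lambda>x y. s' (f [x, y, y]))"
  have g_pol: "upol A F (\<lambda>x. g (k x) (l x))" "(\<lambda>x. g (k x) (l x)) ` A \<subseteq> U" if "upol A F k" "upol A F l" for k l
    using upol_o[OF s'(1) upol_fU(1)[OF that(1) that(2) that(2)]]
      upol_fU(2)[OF that(1) that(2) that(2)] s'(2) UA by (auto simp: g_def image_subset_iff)
  have g_\<alpha>: "(g x y, g x' y') \<in> \<alpha>" if "(x, x') \<in> \<alpha>" "(y, y') \<in> \<alpha>" for x x' y y'
    unfolding g_def by (rule \<alpha>_pol[OF s'(1) pol_3_\<alpha>[OF f that(1) that(2) that(2)]])
  have g_a: "g a y = y" if "y \<in> U" for y using s'(3) that by (simp add: g_def)
  define w where "w = g t t"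
  have wN: "w \<in> N" using s'N ft by (simp add: w_def g_def)
  \<comment> \<open>\<open>r1\<close> sends \<open>t\<close> into \<open>N\<close>, so it must
    collapse \<open>N\<close>; the common value modulo \<alpha> is the one at \<open>a\<close>,
    namely \<open>t\<close>.\<close>
  define r1 where "r1 = (\<lambda>x. g x t)"
  have r1: "upol A F r1" "r1 ` A \<subseteq> U" unfolding r1_def by (rule g_pol[OF upol_id upol_const[OF tA]])+
  have r1N: "(r1 x, t) \<in> \<alpha>" if "x \<in> N" for x
  proof (rule ccontr)
    assume "(r1 x, t) \<notin> \<alpha>"
    then have "(r1 x, r1 a) \<notin> \<alpha>" using g_a[OF tU] by (simp add: r1_def)
    then have "r1 t \<notin> N" by (rule tail_not_to_trace[OF r1 NU[OF that] aU N\<beta>[OF that aN]])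
    then show False using wN by (simp add: r1_def w_def)
  qed
  \<comment> \<open>Feeding \<open>r1\<close> back exchanges the values: modulo \<alpha>,
    \<open>r2\<close> is \<open>w\<close> on \<open>N\<close>, as g t t = w, and \<open>t\<close> at
    \<open>t\<close>, as \<open>r1\<close> sends w \<in> N to \<open>t\<close>.\<close>
  define r2 where "r2 = (\<lambda>x. g (r1 x) t)"
  have r2: "upol A F r2" unfolding r2_def by (rule g_pol(1)[OF r1(1) upol_const[OF tA]])
  have r2N: "(r2 x, w) \<in> \<alpha>" if "x \<in> N" for x
    unfolding r2_def w_def by (rule g_\<alpha>[OF r1N[OF that] \<alpha>_refl[OF tA]])
  have r2t: "(r2 t, t) \<in> \<alpha>" using r1N[OF wN] by (simp add: r2_def r1_def w_def)
  \<comment> \<open>Modulo \<alpha>, \<open>p\<close> is x \<mapsto> g x w on \<open>N\<close>,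
    which separates \<open>a\<close> from \<open>b\<close>, yet its value at \<open>t\<close> is g t
    t = w, an element of \<open>N\<close>.\<close>
  define p where "p = (\<lambda>x. g x (r2 x))"
  have p: "upol A F p" "p ` A \<subseteq> U" unfolding p_def by (rule g_pol[OF upol_id r2])+
  have p_\<alpha>: "(p x, g x w) \<in> \<alpha>" if "x \<in> N" for x
    unfolding p_def by (rule g_\<alpha>[OF \<alpha>_refl[OF NA[OF that]] r2N[OF that]])
  have "(g a w, g b w) \<notin> \<alpha>"
  proof
    assume "(g a w, g b w) \<in> \<alpha>"
    then have "(?s (g a w), ?s (g b w)) \<in> \<alpha>" by (rule \<alpha>_pol[OF s(1)])
    then show False using sep_\<alpha>[OF wN] s'(3) fU aA bA NA[OF wN] by (simp add: g_def)
  qed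
  then have "(p a, p b) \<notin> \<alpha>" using p_\<alpha>[OF aN] p_\<alpha>[OF bN] \<alpha>_sym \<alpha>_trans by blast
  then have "p t \<notin> N" by (rule tail_not_to_trace[OF p aU bU ab\<beta>])
  moreover have "(p t, w) \<in> \<alpha>" unfolding p_def w_def by (rule g_\<alpha>[OF \<alpha>_refl[OF tA] r2t])
  ultimately show False using N_closed[OF wN, of "p t"] p(2) tA \<alpha>\<beta> \<beta>_sym by blast
qed

lemma not_any_type: "\<not> minalg_type M G i"
proof
  assume "minalg_type M G i"
  then show False unfolding minalg_type_def
  proof (elim disjE conjE exE)
    fix H assume H: "\<forall>(n, h)\<in>H. n = 1 \<and> bij_betw (\<lambda>x. h [x]) M M" "poly_equiv M G H"
    show False by (rule not_type_1[OF _ H(2)]) (use H(1) in auto)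
  next
    fix R :: "('a set \<Rightarrow> 'a set) ring" and V :: "('a set \<Rightarrow> 'a set, 'a set) module"
    assume "module R V" "carrier V = M" "poly_equiv M G (vs_ops R V)"
    then show False by (rule not_type_2)
  next
    fix z u assume "z \<noteq> u" "M = {z, u}" "poly_equiv M G {(2, meet2 z u), (2, join2 z u), (1, compl2 z u)}"
    then show False by (rule not_type_3)
  next
    fix z u assume "z \<noteq> u" "M = {z, u}" "poly_equiv M G {(2, meet2 z u), (2, join2 z u)}"
    then show False by (intro not_type_4_5[of z u]) auto
  next
    fix z u assume "z \<noteq> u" "M = {z, u}" "poly_equiv M G {(2, meet2 z u)}"
    then show False by (intro not_type_4_5[of z u]) auto
  qed
qed

end

end

section \<open>The subpower\<close>

lemma upol_tct_pol:
  assumes "upol A F g" "is_algebra A F" "tct_pol A F n f"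
  shows "\<exists>f'. tct_pol A F n f' \<and> (\<forall>xs\<in>tuples A n. f' xs = g (f xs))"
proof -
  obtain p where p: "tct_pol A F 1 p" "\<forall>x\<in>A. g x = p [x]" using assms(1) by (auto simp: upol_def)
  have "tct_pol A F n (\<lambda>xs. p (map (\<lambda>q. q xs) [f]))" using p assms(3) by (intro tct_pol_comp) auto
  moreover have "\<forall>xs\<in>tuples A n. p (map (\<lambda>q. q xs) [f]) = g (f xs)"
    using p(2) tct_pol_closed[OF assms(2,3)] by simp
  ultimately show ?thesis by blast
qed

text \<open>The generated subalgebra in closed form: constant polynomials give the diagonal, the two
  projections give (a, t) and (b, t).\<close>

definition sub_gen :: "'a set \<Rightarrow> 'a ops \<Rightarrow> 'a \<Rightarrow> 'a \<Rightarrow> 'a \<Rightarrow> ('a \<times> 'a) set" where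
  "sub_gen A F a b t = {(h [a, b], h [t, t]) | h. tct_pol A F 2 h}"

lemma sub_genI: "tct_pol A F 2 h \<Longrightarrow> x = h [a, b] \<Longrightarrow> y = h [t, t] \<Longrightarrow> (x, y) \<in> sub_gen A F a b t"
  unfolding sub_gen_def by blast

lemma subalg_sub_gen:
  assumes "is_algebra A F" "a \<in> A" "b \<in> A" "t \<in> A"
  shows "subalg_sq A F (sub_gen A F a b t)"
  unfolding subalg_sq_def
proof (intro conjI)
  let ?S = "sub_gen A F a b t"
  have "tct_pol A F 2 (\<lambda>xs. xs ! 0)" by (rule tct_pol.proj) simp
  then show "?S \<noteq> {}" unfolding sub_gen_def by blast
  show "?S \<subseteq> A \<times> A"
    unfolding sub_gen_def using tct_pol_closed[OF assms(1)] assms(2-) by (auto simp: tuples_2)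
  have "g ps \<in> ?S" if g: "(n, g) \<in> sq_ops F" and ps: "ps \<in> tuples ?S n" for n g ps
  proof -
    obtain f where f: "(n, f) \<in> F" "g = (\<lambda>ps. (f (map fst ps), f (map snd ps)))"
      using g by (auto simp: sq_ops_iff)
    have "\<forall>p\<in>set ps. \<exists>h. tct_pol A F 2 h \<and> p = (h [a, b], h [t, t])"
      using ps by (auto simp: tuples_def sub_gen_def)
    then obtain Q where Q: "\<forall>p\<in>set ps. tct_pol A F 2 (Q p) \<and> p = (Q p [a, b], Q p [t, t])" by metis
    have h: "tct_pol A F 2 (\<lambda>xs. f (map (\<lambda>h. h xs) (map Q ps)))"
      using f(1) Q ps by (intro tct_pol.comp) (auto simp: tuples_def)
    have m: "map fst ps = map (\<lambda>h. h [a, b]) (map Q ps)" "map snd ps = map (\<lambda>h. h [t, t]) (map Q ps)"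
      using Q by (auto simp: comp_def)
    show ?thesis unfolding f(2) m by (rule sub_genI[OF h refl refl])
  qed
  then show "\<forall>(n, g)\<in>sq_ops F. \<forall>ps\<in>tuples ?S n. g ps \<in> ?S" by blast
qed

text \<open>A constant of the subpower is itself a binary polynomial evaluated at (a, b) and (t, t).
  Appending these as two further arguments lets one polynomial of \<open>A\<close> describe both
  coordinates.\<close>

lemma sub_gen_pol:
  assumes "tct_pol (sub_gen A F a b t) (sq_ops F) n P"
  shows "\<exists>f. tct_pol A F (n + 2) f \<and>
    (\<forall>ps. length ps = n \<longrightarrow> P ps = (f (map fst ps @ [a, b]), f (map snd ps @ [t, t])))"
  using assms
proof induction
  case (proj i n)
  then show ?case by (intro exI[of _ "\<lambda>xs. xs ! i"]) (auto simp: nth_append intro: tct_pol.proj)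
next
  case (const d n)
  then obtain h where h: "tct_pol A F 2 h" "d = (h [a, b], h [t, t])" by (auto simp: sub_gen_def)
  have "tct_pol A F (n + 2) (\<lambda>xs. h (map (\<lambda>q. q xs) [\<lambda>xs. xs ! n, \<lambda>xs. xs ! (n + 1)]))"
    by (rule tct_pol_comp[OF h(1)]) (auto intro: tct_pol.proj)
  then show ?case using h(2)
    by (intro exI[of _ "\<lambda>xs. h (map (\<lambda>q. q xs) [\<lambda>xs. xs ! n, \<lambda>xs. xs ! (n + 1)])"])
      (auto simp: nth_append)
next
  case (comp k g ps n)
  then obtain Q where Q: "\<forall>p\<in>set ps. tct_pol A F (n + 2) (Q p) \<and>
      (\<forall>xs. length xs = n \<longrightarrow> p xs = (Q p (map fst xs @ [a, b]), Q p (map snd xs @ [t, t])))" by metis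
  obtain f where f: "(k, f) \<in> F" "g = (\<lambda>ps. (f (map fst ps), f (map snd ps)))"
    using comp(1) by (auto simp: sq_ops_iff)
  have "tct_pol A F (n + 2) (\<lambda>xs. f (map (\<lambda>p. p xs) (map Q ps)))"
    using comp f Q by (intro tct_pol.comp) auto
  moreover have "g (map (\<lambda>p. p xs) ps) = (f (map (\<lambda>p. p (map fst xs @ [a, b])) (map Q ps)),
      f (map (\<lambda>p. p (map snd xs @ [t, t])) (map Q ps)))" if "length xs = n" for xs
  proof -
    have m: "map fst (map (\<lambda>p. p xs) ps) = map (\<lambda>p. p (map fst xs @ [a, b])) (map Q ps)"
      "map snd (map (\<lambda>p. p xs) ps) = map (\<lambda>p. p (map snd xs @ [t, t])) (map Q ps)"
      using that Q by auto
    show ?thesis unfolding f(2) m ..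
  qed
  ultimately show ?case by (intro exI[of _ "\<lambda>xs. f (map (\<lambda>p. p xs) (map Q ps))"]) blast
qed

context trace_tail
begin

lemma diagonal_subpower_sub_gen: "diagonal_subpower A F \<alpha> \<beta> U N a b (sub_gen A F a b t)"
proof unfold_locales
  show "subalg_sq A F (sub_gen A F a b t)" by (rule subalg_sub_gen[OF alg aA bA tA])
  show "(x, x) \<in> sub_gen A F a b t" if "x \<in> A" for x
    unfolding sub_gen_def using tct_pol.const[OF that, of F 2] by force
qed

lemma pentagon_exists:
  assumes type: "minalg_type (min_carrier \<alpha> N) (min_ops A F \<alpha> N) i"
  shows "\<exists>S. subalg_sq A F S \<and> (\<exists>\<gamma> \<delta> \<theta>. pentagon_of_type S (sq_ops F) \<gamma> \<delta> \<theta> i)"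
proof -
  let ?S = "sub_gen A F a b t"
  interpret D: diagonal_subpower A F \<alpha> \<beta> U N a b ?S by (rule diagonal_subpower_sub_gen)
  have proj: "tct_pol A F 2 (\<lambda>xs. xs ! 0)" "tct_pol A F 2 (\<lambda>xs. xs ! 1)" by (auto intro: tct_pol.proj)
  have S: "(a, t) \<in> ?S" "(b, t) \<in> ?S"
    using sub_genI[OF proj(1)] sub_genI[OF proj(2)] by simp_all
  have "((a, t), (b, t)) \<in> D.\<delta>"
  proof (rule ccontr)
    assume "((a, t), (b, t)) \<notin> D.\<delta>"
    then obtain P where P: "upol ?S (sq_ops F) P" "P (a, t) \<in> \<beta>" "(fst (P (a, t)), fst (P (b, t))) \<notin> \<alpha>"
      using S ab\<beta> \<beta>_refl[OF tA] by (auto simp: D.\<delta>_def)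
    obtain Q where Q: "tct_pol ?S (sq_ops F) 1 Q" "\<forall>p\<in>?S. P p = Q [p]" using P(1) by (auto simp: upol_def)
    obtain f where f: "tct_pol A F 3 f"
      "\<forall>ps. length ps = 1 \<longrightarrow> Q ps = (f (map fst ps @ [a, b]), f (map snd ps @ [t, t]))"
      using sub_gen_pol[OF Q(1)] by (auto simp: numeral_3_eq_3)
    have fP: "P (a, t) = (f [a, a, b], f [t, t, t])" "P (b, t) = (f [b, a, b], f [t, t, t])"
      using Q(2) f(2) S by simp_all
    have fA: "f [x, y, z] \<in> A" if "x \<in> A" "y \<in> A" "z \<in> A" for x y z
      using tct_pol_closed[OF alg f(1)] that by (simp add: tuples_3)
    have f\<beta>: "(f [a, a, b], f [b, a, b]) \<in> \<beta>"
      by (rule pol_\<beta>_N[OF f(1)]) (use aN bN in \<open>auto simp: tuples_3\<close>)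
    obtain k where k: "upol A F k" "k ` A = U" "(k (f [a, a, b]), k (f [b, a, b])) \<notin> \<alpha>"
      using separation_U[OF f\<beta>] P(3) fP by auto
    \<comment> \<open>This map separates \<open>a\<close> from \<open>b\<close>, hence permutes
      \<open>U\<close>; composing with its inverse \<rho>' turns \<open>f\<close> into a
      \<open>g\<close> with g(x, a, b) = x on \<open>U\<close>.\<close>
    let ?\<rho> = "\<lambda>x. k (f [x, a, b])"
    have "upol A F ?\<rho>"
      by (rule upol_o[OF k(1) pol_3_upol[OF f(1) upol_id upol_const[OF aA] upol_const[OF bA]]])
    moreover have "?\<rho> ` U \<subseteq> U" using k(2) fA UA aA bA by blast
    ultimately obtain \<rho>' where \<rho>': "upol A F \<rho>'" "\<rho>' ` A \<subseteq> U" "\<forall>x\<in>U. \<rho>' (?\<rho> x) = x \<and> ?\<rho> (\<rho>' x) = x"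
      using inverse_pol[OF _ _ aU bU ab\<beta> k(3)] by blast
    have \<rho>'k: "upol A F (\<lambda>x. \<rho>' (k x))" by (rule upol_o[OF \<rho>'(1) k(1)])
    obtain g where g: "tct_pol A F 3 g" "\<forall>xs\<in>tuples A 3. g xs = \<rho>' (k (f xs))"
      using upol_tct_pol[OF \<rho>'k alg f(1)] by blast
    have g_eq: "g [x, y, z] = \<rho>' (k (f [x, y, z]))" if "x \<in> A" "y \<in> A" "z \<in> A" for x y z
      using g(2) that by (simp add: tuples_3)
    have gU: "g [x, y, z] \<in> U" if "x \<in> A" "y \<in> A" "z \<in> A" for x y z
      using g_eq[OF that] fA[OF that] upol_in[OF k(1)] \<rho>'(2) by auto
    have gx: "g [x, a, b] = x" if "x \<in> U" for x
      using g_eq[of x a b] \<rho>'(3) that UA aA bA by auto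
    \<comment> \<open>\<open>P (a, t) \<in> \<beta>\<close> relates the two coordinates f(a, a, b)
      and f(t, t, t); after normalisation they are \<open>a\<close> and g(t, t, t).\<close>
    have "(\<rho>' (k (f [a, a, b])), \<rho>' (k (f [t, t, t]))) \<in> \<beta>" using \<beta>_pol[OF \<rho>'k] P(2) fP by simp
    then have "(a, g [t, t, t]) \<in> \<beta>" using gx[OF aU] g_eq aA bA tA by simp
    then have "g [t, t, t] \<in> N" using N_closed[OF aN gU] tA by blast
    from not_any_type[OF g(1) gU gx this] type show False by blast
  qed
  from D.pentagon[OF type this] show ?thesis using D.S ab by auto
qed

end

theorem theorem2p4:
  fixes A :: "'a set" and F :: "'a ops" and \<alpha> \<beta> :: "('a \<times> 'a) set"
    and U :: "'a set" and i :: nat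
  assumes "finite_algebra A F"
    and "con_covers A F \<alpha> \<beta>"
    and "minimal_set A F \<alpha> \<beta> U"
    and "tct_type A F \<alpha> \<beta> i"
    and "tail \<alpha> \<beta> U \<noteq> {}"
  shows "\<exists>S. subalg_sq A F S \<and>
           (\<exists>\<gamma> \<delta> \<theta>. pentagon_of_type S (sq_ops F) \<gamma> \<delta> \<theta> i)"
proof -
  obtain V N where V: "minimal_set A F \<alpha> \<beta> V" and N: "is_trace \<alpha> \<beta> V N"
    and type: "minalg_type (min_carrier \<alpha> N) (min_ops A F \<alpha> N) i"
    using assms(4) unfolding tct_type_def by blast
  interpret U: min_set A F \<alpha> \<beta> U using assms by unfold_locales
  interpret V: min_set A F \<alpha> \<beta> V using assms V by unfold_locales
  obtain t where t: "t \<in> tail \<alpha> \<beta> V"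
    using tail_nonempty_transfer[OF U.min_set_axioms V.min_set_axioms assms(5)] by blast
  obtain x where x: "x \<in> N" "x \<in> body \<alpha> \<beta> V"
  proof -
    obtain z where "z \<in> V" "N = restr \<beta> V `` {z}" using N unfolding is_trace_def by auto
    then have "z \<in> N" using U.\<beta>_refl V.UA by (auto simp: restr_def)
    then show ?thesis using that N unfolding body_def by blast
  qed
  then obtain y where y: "y \<in> V" "(x, y) \<in> \<beta>" "(x, y) \<notin> \<alpha>" using V.body_iff by blast
  have "y \<in> N"
  proof -
    obtain z where "z \<in> V" "N = restr \<beta> V `` {z}" using N unfolding is_trace_def by auto
    then show ?thesis using x(1) y U.\<beta>_trans unfolding restr_def by blast
  qed
  then interpret trace_tail A F \<alpha> \<beta> V N x y t
    using N x y t by unfold_locales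
  show ?thesis by (rule pentagon_exists[OF type])
qed

end
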